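(* Let $X,Y,c,y_0,Z,Q,b$ be as in the context. The following are equivalent: 1. $b$ satisfies (A3W) (on $Z\times Y$). 2. $c$ satisfies (A3W) (on $X\times Y$). 3. For every smooth surface (embedded submanifold) $S\subseteq X$ of dimension $n$ which is transverse to each $L_x$ that it intersects, the restriction $c|_{S\times Y}$ satisfies (A3W) (on $S\times Y$).
   Context: Let $m\ge n$, and let $X$ and $Y$ be smooth manifolds of dimensions $m$ and $n$, with $Y$ connected, smoothly embedded in larger manifolds in which their closures are compact. Let $c\in C^4(\overline X\times\overline Y)$ satisfy: (A1, twist) for every $x\in X$, $y\mapsto D_xc(x,y)$ is injective on $\overline Y$; (A2, non-degeneracy) $D^2_{xy}c(x,y):T_yY\to T^*_xX$, $\frac{\partial}{\partial y^i}\mapsto \frac{\partial^2c(x,y)}{\partial y^i\partial x^j}dx^j$, is injective for all $x\in X,y\in Y$. $D_xc$, $D_yc$ denote the differentials in $x$ and $y$. Assume that for every $x\in X$ the level set $L_x(y):=\{\overline x\in X: D_yc(\overline x,y)=D_yc(x,y)\}$ is connected and independent of $y\in Y$; write it $L_x$ (an $(m-n)$-dimensional submanifold). Let $Z=X/\!\sim$, where $x\sim\overline x$ iff $\overline x\in L_x$, with quotient map $Q:X\to Z$. Fix $y_0\in Y$. The map $x\mapsto D_yc(x,y_0)$ has the same level sets as $Q$ and is open, so $Z$ is identified with the open subset $D_yc(X,y_0)\subseteq T^*_{y_0}Y$ and $Q$ with $x\mapsto D_yc(x,y_0)$. The function $b:Z\times Y\to\mathbb R$ is defined uniquely by $D_yb(z,y)=D_yc(x,y)$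 for $x\in Q^{-1}(z)$, $y\in Y$, together with $b(z,y_0)=0$. MTW curvature: $c\text{-}exp_x$ denotes the inverse of $y\mapsto D_xc(x,y)$, i.e. $D_xc(x,c\text{-}exp_x(p))=p$ for $p\in D_xc(x,Y)$. For $x\in X$, $y\in Y$, $\mathbf u\in T_xX$, $\mathbf v\in T_yY$, set $\mathbf p=D_xc(x,y)$ and $\mathbf q=D^2_{xy}c(x,y)\cdot\mathbf v\in T^*_xX$; under the present assumptions $\mathbf p+t\mathbf q\in D_xc(x,Y)$ for small $t$. For any smooth curve $\beta$ in $X$ with $\beta(0)=x$, $\beta'(0)=\mathbf u$, $$MTW_{xy}\langle\mathbf u,\mathbf v\rangle:=-\frac32\,\frac{\partial^4}{\partial s^2\partial t^2}\Big|_{s=t=0}c\big(\beta(s),c\text{-}exp_x(\mathbf p+t\mathbf q)\big).$$ $c$ satisfies (A3W) if $MTW_{xy}\langle\mathbf u,\mathbf v\rangle\ge0$ for all $x\in X$, $y\in Y$, $\mathbf u\in T_xX$, $\mathbf v\in T_yY$ with $\mathbf u\cdot D^2_{xy}c(x,y)\cdot\mathbf v=0$. The same definitions apply to $b$ with $X$ replaced by $Z$, and to $c|_{S\times Y}$ with $X$ replaced by $S$. *)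

theory Defs
  imports "HOL-Analysis.Analysis"
begin

section \<open>Functions of class \<open>C\<^sup>k\<close> on open subsets of normed spaces\<close>

fun Ck_on :: "nat \<Rightarrow> 'a::real_normed_vector set \<Rightarrow> ('a \<Rightarrow> 'b::real_normed_vector) \<Rightarrow> bool" where
  "Ck_on 0 S f \<longleftrightarrow> continuous_on S f"
| "Ck_on (Suc k) S f \<longleftrightarrow>
     (\<forall>x\<in>S. f differentiable (at x)) \<and> (\<forall>v. Ck_on k S (\<lambda>x. frechet_derivative f (at x) v))"

definition smooth_on :: "'a::real_normed_vector set \<Rightarrow> ('a \<Rightarrow> 'b::real_normed_vector) \<Rightarrow> bool" where
  "smooth_on S f \<longleftrightarrow> (\<forall>k. Ck_on k S f)"

section \<open>Smooth manifolds\<close>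

text \<open>A manifold is given by an atlas. A chart is a pair of its domain and its coordinate map into
  the model space, whose dimension is the dimension of the manifold. The topology of the manifold
  is the one that makes the charts homeomorphisms onto open sets.\<close>

type_synonym ('a, 'e) chart = "'a set \<times> ('a \<Rightarrow> 'e)"
type_synonym ('a, 'e) atlas = "('a, 'e) chart set"

definition carrier_of :: "('a, 'e) atlas \<Rightarrow> 'a set" where
  "carrier_of A = (\<Union>(U, \<phi>)\<in>A. U)"

definition is_chart :: "('a, 'e::euclidean_space) chart \<Rightarrow> bool" where
  "is_chart = (\<lambda>(U, \<phi>). inj_on \<phi> U \<and> open (\<phi> ` U))"

definition compatible :: "('a, 'e::euclidean_space) chart \<Rightarrow> ('a, 'e) chart \<Rightarrow> bool" where
  "compatible = (\<lambda>(U, \<phi>) (V, \<psi>).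
     open (\<phi> ` (U \<inter> V)) \<and> open (\<psi> ` (U \<inter> V)) \<and>
     smooth_on (\<phi> ` (U \<inter> V)) (\<lambda>\<xi>. \<psi> (inv_into U \<phi> \<xi>)) \<and>
     smooth_on (\<psi> ` (U \<inter> V)) (\<lambda>\<eta>. \<phi> (inv_into V \<psi> \<eta>)))"

definition mfd_topology :: "('a, 'e::euclidean_space) atlas \<Rightarrow> 'a topology" where
  "mfd_topology A =
     topology (\<lambda>W. W \<subseteq> carrier_of A \<and> (\<forall>(U, \<phi>)\<in>A. open (\<phi> ` (W \<inter> U))))"

definition smooth_manifold :: "('a, 'e::euclidean_space) atlas \<Rightarrow> bool" where
  "smooth_manifold A \<longleftrightarrow>
     (\<forall>C\<in>A. is_chart C) \<and> (\<forall>C\<in>A. \<forall>D\<in>A. compatible C D) \<and>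
     Hausdorff_space (mfd_topology A) \<and> second_countable (mfd_topology A)"

definition maximal_atlas :: "('a, 'e::euclidean_space) atlas \<Rightarrow> ('a, 'e) atlas" where
  "maximal_atlas A =
     {C. is_chart C \<and> fst C \<subseteq> carrier_of A \<and> (\<forall>D\<in>A. compatible C D)}"

lemma openin_mfd_topology:
  assumes "smooth_manifold A"
  shows "openin (mfd_topology A) W \<longleftrightarrow>
           W \<subseteq> carrier_of A \<and> (\<forall>(U, \<phi>)\<in>A. open (\<phi> ` (W \<inter> U)))"
proof -
  define P where "P W \<longleftrightarrow> W \<subseteq> carrier_of A \<and> (\<forall>(U, \<phi>)\<in>A. open (\<phi> ` (W \<inter> U)))" for W
  have PI: "P W" if "W \<subseteq> carrier_of A" "\<And>U \<phi>. (U, \<phi>) \<in> A \<Longrightarrow> open (\<phi> ` (W \<inter> U))" for W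
    using that unfolding P_def by blast
  have PD: "open (\<phi> ` (W \<inter> U))" if "P W" "(U, \<phi>) \<in> A" for W U \<phi>
    using that unfolding P_def by blast
  have PC: "W \<subseteq> carrier_of A" if "P W" for W
    using that unfolding P_def by blast
  have inj: "inj_on \<phi> U" if "(U, \<phi>) \<in> A" for U \<phi>
    using assms that unfolding smooth_manifold_def is_chart_def by blast
  have 1: "P (S \<inter> T)" if S: "P S" and T: "P T" for S T
  proof (rule PI)
    show "S \<inter> T \<subseteq> carrier_of A" using PC[OF S] by blast
    fix U \<phi> assume c: "(U, \<phi>) \<in> A"
    have "\<phi> ` ((S \<inter> U) \<inter> (T \<inter> U)) = \<phi> ` (S \<inter> U) \<inter> \<phi> ` (T \<inter> U)"
      by (rule inj_on_image_Int[OF inj[OF c]]) auto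
    moreover have "(S \<inter> T) \<inter> U = (S \<inter> U) \<inter> (T \<inter> U)" by blast
    ultimately show "open (\<phi> ` ((S \<inter> T) \<inter> U))"
      using open_Int[OF PD[OF S c] PD[OF T c]] by simp
  qed
  have 2: "P (\<Union>K)" if K: "\<And>S. S \<in> K \<Longrightarrow> P S" for K
  proof (rule PI)
    show "\<Union>K \<subseteq> carrier_of A" using PC K by blast
    fix U \<phi> assume c: "(U, \<phi>) \<in> A"
    have "open (\<Union>S\<in>K. \<phi> ` (S \<inter> U))" using PD[OF K c] by (intro open_UN) blast
    moreover have "\<phi> ` (\<Union>K \<inter> U) = (\<Union>S\<in>K. \<phi> ` (S \<inter> U))" by blast
    ultimately show "open (\<phi> ` (\<Union>K \<inter> U))" by simp
  qed
  have "istopology P" unfolding istopology_def using 1 2 by blast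
  moreover have "mfd_topology A = topology P" unfolding mfd_topology_def P_def ..
  ultimately show ?thesis by (simp add: topology_inverse' P_def)
qed

text \<open>\<open>S\<close> is an embedded submanifold of \<open>A\<close>: near each of its points there is a slice chart of
  \<open>A\<close>, in which \<open>S\<close> is (the image of) a linear subspace, and the coordinates in this subspace
  form a chart of \<open>S\<close>.\<close>

definition embedded_submanifold ::
  "('a, 'g::euclidean_space) atlas \<Rightarrow> ('a, 'e::euclidean_space) atlas \<Rightarrow> bool" where
  "embedded_submanifold A S \<longleftrightarrow>
     smooth_manifold S \<and> carrier_of S \<subseteq> carrier_of A \<and>
     (\<forall>p\<in>carrier_of S. \<exists>U \<phi>. \<exists>j :: 'e \<Rightarrow> 'g.
        (U, \<phi>) \<in> maximal_atlas A \<and> p \<in> U \<and> linear j \<and> inj j \<and>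
        \<phi> ` (U \<inter> carrier_of S) = \<phi> ` U \<inter> range j \<and>
        (U \<inter> carrier_of S, \<lambda>x. inv j (\<phi> x)) \<in> maximal_atlas S)"

text \<open>\<open>c\<close> is of class \<open>C\<^sup>k\<close> on a not necessarily open set \<open>P \<times> R\<close>, in the usual sense that it has
  a \<open>C\<^sup>k\<close> extension to an open neighbourhood.\<close>

definition Ck_on_product ::
  "nat \<Rightarrow> ('a, 'g::euclidean_space) atlas \<Rightarrow> ('b, 'h::euclidean_space) atlas \<Rightarrow>
   'a set \<Rightarrow> 'b set \<Rightarrow> ('a \<Rightarrow> 'b \<Rightarrow> real) \<Rightarrow> bool" where
  "Ck_on_product k M N P R c \<longleftrightarrow>
     (\<exists>W f. openin (prod_topology (mfd_topology M) (mfd_topology N)) W \<and> P \<times> R \<subseteq> W \<and>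
        (\<forall>x\<in>P. \<forall>y\<in>R. f x y = c x y) \<and>
        (\<forall>(U, \<phi>)\<in>M. \<forall>(V, \<psi>)\<in>N.
           Ck_on k ((\<lambda>(x, y). (\<phi> x, \<psi> y)) ` (W \<inter> U \<times> V))
             (\<lambda>(\<xi>, \<eta>). f (inv_into U \<phi> \<xi>) (inv_into V \<psi> \<eta>))))"

section \<open>Tangent and cotangent vectors\<close>

text \<open>The tangent space at \<open>x\<close> is identified with the model space by means of a chart that is
  chosen at \<open>x\<close> once and for all. A covector is represented by its coordinates with respect to
  the dual basis, so that its pairing with a tangent vector is \<open>(\<bullet>)\<close>; no Riemannian metric is
  involved.\<close>

definition chart_at :: "('a, 'e) atlas \<Rightarrow> 'a \<Rightarrow> ('a, 'e) chart" where
  "chart_at A x = (SOME C. C \<in> A \<and> x \<in> fst C)"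

definition coord :: "('a, 'e) atlas \<Rightarrow> 'a \<Rightarrow> 'a \<Rightarrow> 'e" where
  "coord A x = snd (chart_at A x)"

definition param :: "('a, 'e) atlas \<Rightarrow> 'a \<Rightarrow> 'e \<Rightarrow> 'a" where
  "param A x = inv_into (fst (chart_at A x)) (coord A x)"

definition differentiable_at ::
  "('a, 'e::euclidean_space) atlas \<Rightarrow> ('a \<Rightarrow> real) \<Rightarrow> 'a \<Rightarrow> bool" where
  "differentiable_at A f x \<longleftrightarrow> (\<lambda>\<xi>. f (param A x \<xi>)) differentiable (at (coord A x x))"

definition differential ::
  "('a, 'e::euclidean_space) atlas \<Rightarrow> ('a \<Rightarrow> real) \<Rightarrow> 'a \<Rightarrow> 'e" where
  "differential A f x =
     (\<Sum>i\<in>Basis. frechet_derivative (\<lambda>\<xi>. f (param A x \<xi>)) (at (coord A x x)) i *\<^sub>R i)"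

definition D1 ::
  "('a, 'e::euclidean_space) atlas \<Rightarrow> ('a \<Rightarrow> 'b \<Rightarrow> real) \<Rightarrow> 'a \<Rightarrow> 'b \<Rightarrow> 'e" where
  "D1 A c x y = differential A (\<lambda>x'. c x' y) x"

definition D2 ::
  "('b, 'f::euclidean_space) atlas \<Rightarrow> ('a \<Rightarrow> 'b \<Rightarrow> real) \<Rightarrow> 'a \<Rightarrow> 'b \<Rightarrow> 'f" where
  "D2 B c x y = differential B (c x) y"

text \<open>\<open>D12 A B c x y v\<close> is the covector at \<open>x\<close> obtained by differentiating the map
  \<open>y \<mapsto> D1 A c x y\<close> in the direction of the tangent vector \<open>v\<close> at \<open>y\<close>.\<close>

definition D12 ::
  "('a, 'e::euclidean_space) atlas \<Rightarrow> ('b, 'f::euclidean_space) atlas \<Rightarrow>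
   ('a \<Rightarrow> 'b \<Rightarrow> real) \<Rightarrow> 'a \<Rightarrow> 'b \<Rightarrow> 'f \<Rightarrow> 'e" where
  "D12 A B c x y v = frechet_derivative (\<lambda>\<eta>. D1 A c x (param B y \<eta>)) (at (coord B y y)) v"

definition Ck_curve ::
  "nat \<Rightarrow> ('a, 'e::euclidean_space) atlas \<Rightarrow> real \<Rightarrow> (real \<Rightarrow> 'a) \<Rightarrow> bool" where
  "Ck_curve k A \<epsilon> \<beta> \<longleftrightarrow>
     \<beta> ` {-\<epsilon><..<\<epsilon>} \<subseteq> carrier_of A \<and>
     (\<forall>(U, \<phi>)\<in>A. open {s \<in> {-\<epsilon><..<\<epsilon>}. \<beta> s \<in> U} \<and>
        Ck_on k {s \<in> {-\<epsilon><..<\<epsilon>}. \<beta> s \<in> U} (\<lambda>s. \<phi> (\<beta> s)))"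

definition smooth_curve :: "('a, 'e::euclidean_space) atlas \<Rightarrow> (real \<Rightarrow> 'a) \<Rightarrow> bool" where
  "smooth_curve A \<beta> \<longleftrightarrow> (\<exists>\<epsilon>>0. \<forall>k. Ck_curve k A \<epsilon> \<beta>)"

definition velocity :: "('a, 'e::euclidean_space) atlas \<Rightarrow> (real \<Rightarrow> 'a) \<Rightarrow> 'e" where
  "velocity A \<beta> = vector_derivative (\<lambda>s. coord A (\<beta> 0) (\<beta> s)) (at 0)"

text \<open>The tangent space at \<open>p\<close> of a submanifold \<open>S\<close> of \<open>A\<close>, as a subspace of the tangent space
  of \<open>A\<close>. Curves are only required to be \<open>C\<^sup>1\<close> because level sets of derivatives of \<open>c\<close> are
  submanifolds of finite differentiability class.\<close>

definition tangent_to :: "('a, 'e::euclidean_space) atlas \<Rightarrow> 'a set \<Rightarrow> 'a \<Rightarrow> 'e set" where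
  "tangent_to A S p =
     {velocity A \<gamma> | \<gamma>. \<gamma> 0 = p \<and> (\<exists>\<epsilon>>0. Ck_curve 1 A \<epsilon> \<gamma> \<and> \<gamma> ` {-\<epsilon><..<\<epsilon>} \<subseteq> S)}"

definition transverse :: "('a, 'e::euclidean_space) atlas \<Rightarrow> 'a set \<Rightarrow> 'a set \<Rightarrow> bool" where
  "transverse A S L \<longleftrightarrow>
     (\<forall>p\<in>S \<inter> L. \<forall>w. \<exists>u\<in>tangent_to A S p. \<exists>v\<in>tangent_to A L p. w = u + v)"

section \<open>The curvature condition (A3W)\<close>

definition c_exp ::
  "('a, 'e::euclidean_space) atlas \<Rightarrow> ('b, 'f::euclidean_space) atlas \<Rightarrow>
   ('a \<Rightarrow> 'b \<Rightarrow> real) \<Rightarrow> 'a \<Rightarrow> 'e \<Rightarrow> 'b" where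
  "c_exp A B c x = inv_into (carrier_of B) (D1 A c x)"

text \<open>The curvature at \<open>(\<beta> 0, y)\<close> evaluated on the vectors \<open>velocity A \<beta>\<close> and \<open>v\<close>. It depends on
  the curve only through its position and velocity at \<open>0\<close>, so \<open>A3W\<close> quantifies over all smooth
  curves.\<close>

definition MTW ::
  "('a, 'e::euclidean_space) atlas \<Rightarrow> ('b, 'f::euclidean_space) atlas \<Rightarrow>
   ('a \<Rightarrow> 'b \<Rightarrow> real) \<Rightarrow> 'b \<Rightarrow> (real \<Rightarrow> 'a) \<Rightarrow> 'f \<Rightarrow> real" where
  "MTW A B c y \<beta> v =
     (let x = \<beta> 0; p = D1 A c x y; q = D12 A B c x y v in
      - 3 / 2 * (deriv ^^ 2) (\<lambda>s. (deriv ^^ 2) (\<lambda>t. c (\<beta> s) (c_exp A B c x (p + t *\<^sub>R q))) 0) 0)"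

definition A3W ::
  "('a, 'e::euclidean_space) atlas \<Rightarrow> ('b, 'f::euclidean_space) atlas \<Rightarrow>
   ('a \<Rightarrow> 'b \<Rightarrow> real) \<Rightarrow> bool" where
  "A3W A B c \<longleftrightarrow>
     (\<forall>x\<in>carrier_of A. \<forall>y\<in>carrier_of B. \<forall>u v. u \<bullet> D12 A B c x y v = 0 \<longrightarrow>
        (\<forall>\<beta>. smooth_curve A \<beta> \<and> \<beta> 0 = x \<and> velocity A \<beta> = u \<longrightarrow> 0 \<le> MTW A B c y \<beta> v))"

section \<open>Level sets and the quotient\<close>

definition level_set ::
  "('a, 'e) atlas \<Rightarrow> ('b, 'f::euclidean_space) atlas \<Rightarrow> ('a \<Rightarrow> 'b \<Rightarrow> real) \<Rightarrow> 'b \<Rightarrow> 'a \<Rightarrow> 'a set" where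
  "level_set X Y c y x = {x' \<in> carrier_of X. D2 Y c x' y = D2 Y c x y}"

text \<open>The points of the quotient are the level sets themselves, so the fibre of the quotient map
  over \<open>z\<close> is \<open>z\<close>. The map \<open>x \<mapsto> D2 Y c x y\<^sub>0\<close> induces an injection of the quotient into the
  cotangent space of \<open>Y\<close> at \<open>y\<^sub>0\<close>, and this is taken as the single chart.\<close>

definition quotient_manifold ::
  "('a, 'e) atlas \<Rightarrow> ('b, 'f::euclidean_space) atlas \<Rightarrow> ('a \<Rightarrow> 'b \<Rightarrow> real) \<Rightarrow> 'b \<Rightarrow>
   ('a set, 'f) atlas" where
  "quotient_manifold X Y c y\<^sub>0 =
     {(carrier_of X // {(x, x'). x \<in> carrier_of X \<and> x' \<in> level_set X Y c y\<^sub>0 x},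
       \<lambda>z. the_elem ((\<lambda>x. D2 Y c x y\<^sub>0) ` z))}"

end

theory Submission
  imports Defs
begin

text \<open>Since \<open>Y\<close> is connected, \<open>c (x, y) = b (Q x, y) + c (x, y\<^sub>0)\<close>, so a local \<open>C\<^sup>2\<close> map \<open>\<iota>\<close> into \<open>X\<close>
  from \<open>X\<close> itself (the identity), from \<open>Z\<close> (a local section of \<open>Q\<close>) or from a surface \<open>S\<close> (the
  inclusion) turns \<open>c\<close> into the cost on \<open>X\<close>, \<open>Z\<close> or \<open>S\<close> up to a term that does not depend on \<open>y\<close>.
  Such a term affects neither the \<open>c\<close>-exponential curve \<open>t \<mapsto> y\<^sub>t\<close> nor \<open>g x' = \<partial>\<^sub>t\<^sup>2 c (x', y\<^sub>t)\<close> at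
  \<open>t = 0\<close>. As the differential of \<open>c (\<sqdot>, y\<^sub>t)\<close> at \<open>x\<close> is affine in \<open>t\<close>, \<open>x\<close> is a critical point of \<open>g\<close>;
  hence the curvature is \<open>-3/2\<close> times the Hessian of \<open>g\<close> at the image of the velocity under \<open>D(Q \<circ> \<iota>)\<close>.
  When \<open>Q \<circ> \<iota>\<close> is a submersion, (A3W) at a point is therefore the same condition for all these
  manifolds, and transversality of \<open>S\<close> means exactly that it is one. Conversely a transverse surface
  passes through every point of \<open>X\<close>.\<close>

section \<open>Directional derivatives and functions of class \<open>C\<^sup>k\<close>\<close>

text \<open>Differentiability is budgeted tightly. From \<open>c\<close> of class C^4 come a
  quotient map and a map from \<open>y\<close> to the differential of \<open>c\<close> in
  \<open>x\<close> of class C^3. The inverse function theorem used here gives up one more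
  derivative, so sections of the quotient map and \<open>c\<close>-exponential curves are C^2. Two
  derivatives in \<open>s\<close> on top of two in \<open>t\<close> then use up all four derivatives
  of \<open>c\<close>. A smooth section is not at hand, so manifolds are compared through C^2 maps
  in coordinates. The other obstacle is that the dimension of \<open>X\<close> may exceed that of
  \<open>Y\<close>: the differential of \<open>c\<close> in \<open>x\<close>, as a function of
  \<open>y\<close>, then has no local inverse. But its values differ only by covectors that vanish
  on the kernel of DQ, and a linear right inverse of DQ identifies the space of these covectors with
  the model space of \<open>Y\<close>. This reduces the inversion to equal dimensions and also lets
  an equation between pulled-back covectors be lifted to \<open>X\<close>.\<close>

definition dd :: "'a::real_normed_vector \<Rightarrow> ('a \<Rightarrow> 'b::real_normed_vector) \<Rightarrow> 'a \<Rightarrow> 'b" where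
  "dd v f = (\<lambda>x. frechet_derivative f (at x) v)"

text \<open>With the direction as first argument, \<open>dd v f\<close> is a function again, so
  derivatives iterate as \<open>dd u (dd v f)\<close> and the recursion of \<open>Ck_on\<close>
  becomes closure under \<open>dd v\<close>. The defining equation leaves the simpset in favour of
  this form.\<close>

lemma Ck_on_Suc:
  "Ck_on (Suc k) S f \<longleftrightarrow> (\<forall>x\<in>S. f differentiable (at x)) \<and> (\<forall>v. Ck_on k S (dd v f))"
  by (simp add: dd_def)

declare Ck_on.simps(2) [simp del]

lemma dd_eqI: "(f has_derivative f') (at x) \<Longrightarrow> dd v f x = f' v"
  unfolding dd_def using frechet_derivative_at by metis

lemma has_derivative_dd:
  assumes "f differentiable (at x)" shows "(f has_derivative (\<lambda>v. dd v f x)) (at x)"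
  using assms frechet_derivative_works unfolding dd_def by blast

lemma linear_dd: "f differentiable (at x) \<Longrightarrow> linear (\<lambda>v. dd v f x)"
  using has_derivative_dd has_derivative_linear by blast

text \<open>Functions that agree near \<open>x\<close> have the same derivatives there, so the
  choice behind \<open>frechet_derivative\<close> picks the same one, even where neither function is
  differentiable.\<close>

lemma dd_cong:
  assumes "open S" "x \<in> S" "\<And>y. y \<in> S \<Longrightarrow> f y = g y"
  shows "dd v f x = dd v g x"
proof -
  have "(f has_derivative f') (at x) \<longleftrightarrow> (g has_derivative f') (at x)" for f'
    using assms has_derivative_transform_within_open[of f f' x UNIV S g]
      has_derivative_transform_within_open[of g f' x UNIV S f] by auto
  then show ?thesis unfolding dd_def frechet_derivative_def by simp
qed

lemma differentiable_cong_open: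
  assumes "open S" "x \<in> S" "\<And>y. y \<in> S \<Longrightarrow> f y = g y" "f differentiable (at x)"
  shows "g differentiable (at x)"
  using assms has_derivative_transform_within_open[of f _ x UNIV S g]
  unfolding differentiable_def by auto

lemma Ck_on_cong:
  assumes "open S" "\<And>x. x \<in> S \<Longrightarrow> f x = g x" "Ck_on k S f"
  shows "Ck_on k S g"
  using assms(2,3)
proof (induction k arbitrary: f g)
  case 0
  then show ?case by (auto intro: continuous_on_eq)
next
  case (Suc k)
  show ?case unfolding Ck_on_Suc
  proof (intro conjI ballI allI)
    show "g differentiable (at x)" if "x \<in> S" for x
      using differentiable_cong_open[OF assms(1) that Suc(2)] Suc(3) that by (auto simp: Ck_on_Suc)
    show "Ck_on k S (dd v g)" for v
      using Suc(1)[of "dd v f" "dd v g"] dd_cong[OF assms(1) _ Suc(2)] Suc(3) by (auto simp: Ck_on_Suc)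
  qed
qed

lemma Ck_on_subset: "Ck_on k S f \<Longrightarrow> T \<subseteq> S \<Longrightarrow> Ck_on k T f"
  by (induction k arbitrary: f) (auto simp: Ck_on_Suc intro: continuous_on_subset)

lemma Ck_on_Suc_imp: "Ck_on (Suc k) S f \<Longrightarrow> Ck_on k S f"
proof (induction k arbitrary: f)
  case 0
  then show ?case
    by (auto simp: Ck_on_Suc intro!: continuous_at_imp_continuous_on differentiable_imp_continuous_within)
next
  case (Suc k)
  then show ?case by (subst Ck_on_Suc, subst (asm) Ck_on_Suc) blast
qed

lemma Ck_on_le: "Ck_on k S f \<Longrightarrow> l \<le> k \<Longrightarrow> Ck_on l S f"
  by (induction k) (auto simp: le_Suc_eq dest: Ck_on_Suc_imp)

lemma Ck_on_imp_continuous_on: "Ck_on k S f \<Longrightarrow> continuous_on S f"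
  using Ck_on_le[of k S f 0] by simp

lemma Ck_on_imp_differentiable: "Ck_on k S f \<Longrightarrow> 0 < k \<Longrightarrow> x \<in> S \<Longrightarrow> f differentiable (at x)"
  by (cases k) (auto simp: Ck_on_Suc)

lemma Ck_on_dd: "Ck_on (Suc k) S f \<Longrightarrow> Ck_on k S (dd v f)"
  by (simp add: Ck_on_Suc)

lemma Ck_on_dd_less: "Ck_on k S f \<Longrightarrow> l < k \<Longrightarrow> Ck_on l S (dd v f)"
  by (cases k) (auto intro: Ck_on_dd Ck_on_le)

text \<open>Differentiability in \<open>Ck_on\<close> refers to the whole space even if
  \<open>S\<close> is not open. Only the continuity at level 0 is relative to \<open>S\<close>, and
  it can be tested on an open neighbourhood of each point.\<close>

lemma Ck_on_local:
  assumes "\<And>x. x \<in> S \<Longrightarrow> \<exists>T. open T \<and> x \<in> T \<and> Ck_on k (S \<inter> T) f"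
  shows "Ck_on k S f"
  using assms
proof (induction k arbitrary: f)
  case 0
  show ?case unfolding Ck_on.simps continuous_on_eq_continuous_within
  proof
    fix x assume "x \<in> S"
    then obtain T where T: "open T" "x \<in> T" "continuous_on (S \<inter> T) f"
      using 0 by (metis Ck_on.simps(1))
    then have "continuous (at x within (S \<inter> T)) f"
      using \<open>x \<in> S\<close> by (simp add: continuous_on_eq_continuous_within)
    moreover have "at x within (S \<inter> T) = at x within S"
      using T by (intro at_within_nhd[of x T]) auto
    ultimately show "continuous (at x within S) f" by (simp add: continuous_within)
  qed
next
  case (Suc k)
  show ?case unfolding Ck_on_Suc
  proof (intro conjI ballI allI)
    show "f differentiable (at x)" if "x \<in> S" for x
      using Suc(2)[OF that] that by (auto simp: Ck_on_Suc)
    show "Ck_on k S (dd v f)" for v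
      by (rule Suc(1)) (use Suc(2)[unfolded Ck_on_Suc] in blast)
  qed
qed

lemma dd_const [simp]: "dd v (\<lambda>x. c) = (\<lambda>x. 0)"
  by (rule ext) (rule dd_eqI, rule has_derivative_const)

lemma Ck_on_const [simp]: "Ck_on k S (\<lambda>x. c)"
  by (induction k arbitrary: c) (auto simp: Ck_on_Suc)

lemma dd_bounded_linear: "bounded_linear L \<Longrightarrow> dd v L x = L v"
  by (rule dd_eqI) (rule bounded_linear_imp_has_derivative)

lemma Ck_on_bounded_linear:
  assumes "bounded_linear L" shows "Ck_on k S L"
proof (cases k)
  case 0
  then show ?thesis using linear_continuous_on[OF assms] by simp
next
  case (Suc l)
  have "dd v L = (\<lambda>x. L v)" for v using dd_bounded_linear[OF assms] by blast
  then show ?thesis using Suc bounded_linear_imp_differentiable[OF assms] by (simp add: Ck_on_Suc)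
qed

lemma Ck_on_id: "Ck_on k S (\<lambda>x. x)"
  by (rule Ck_on_bounded_linear[OF bounded_linear_ident])

lemma dd_compose:
  assumes "g differentiable (at x)" "f differentiable (at (g x))"
  shows "dd v (\<lambda>x. f (g x)) x = dd (dd v g x) f (g x)"
  using diff_chain_at[OF has_derivative_dd[OF assms(1)] has_derivative_dd[OF assms(2)]]
  by (intro dd_eqI) (simp add: o_def)

lemma differentiable_compose_at:
  assumes "g differentiable (at x)" "f differentiable (at (g x))"
  shows "(\<lambda>x. f (g x)) differentiable (at x)"
  using differentiable_chain_at[OF assms] by (simp add: o_def)

lemma dd_add: "f differentiable (at x) \<Longrightarrow> g differentiable (at x) \<Longrightarrow>
    dd v (\<lambda>x. f x + g x) x = dd v f x + dd v g x"
  by (intro dd_eqI has_derivative_add has_derivative_dd)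

lemma dd_diff: "f differentiable (at x) \<Longrightarrow> g differentiable (at x) \<Longrightarrow>
    dd v (\<lambda>x. f x - g x) x = dd v f x - dd v g x"
  by (intro dd_eqI has_derivative_diff has_derivative_dd)

lemma dd_linear_compose:
  assumes "bounded_linear L" "f differentiable (at x)"
  shows "dd v (\<lambda>x. L (f x)) x = L (dd v f x)"
  by (intro dd_eqI bounded_linear.has_derivative[OF assms(1)] has_derivative_dd assms)

lemma Ck_on_add:
  assumes "open S" "Ck_on k S f" "Ck_on k S g"
  shows "Ck_on k S (\<lambda>x. f x + g x)"
  using assms(2,3)
proof (induction k arbitrary: f g)
  case (Suc k)
  show ?case unfolding Ck_on_Suc
  proof (intro conjI ballI allI)
    show "Ck_on k S (dd v (\<lambda>x. f x + g x))" for v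
    proof (rule Ck_on_cong[OF assms(1)])
      show "Ck_on k S (\<lambda>x. dd v f x + dd v g x)" by (rule Suc(1)) (use Suc in \<open>auto simp: Ck_on_Suc\<close>)
      show "dd v f x + dd v g x = dd v (\<lambda>x. f x + g x) x" if "x \<in> S" for x
        using that Suc by (subst dd_add) (auto simp: Ck_on_Suc)
    qed
  qed (use Suc in \<open>auto simp: Ck_on_Suc\<close>)
qed (auto intro: continuous_on_add)

lemma Ck_on_linear_compose:
  assumes "open S" "bounded_linear L" "Ck_on k S f"
  shows "Ck_on k S (\<lambda>x. L (f x))"
  using assms(3)
proof (induction k arbitrary: f)
  case 0
  then show ?case using bounded_linear.continuous_on[OF assms(2)] by auto
next
  case (Suc k)
  show ?case unfolding Ck_on_Suc
  proof (intro conjI ballI allI)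
    show "Ck_on k S (dd v (\<lambda>x. L (f x)))" for v
    proof (rule Ck_on_cong[OF assms(1)])
      show "Ck_on k S (\<lambda>x. L (dd v f x))" by (rule Suc(1)) (use Suc in \<open>auto simp: Ck_on_Suc\<close>)
      show "L (dd v f x) = dd v (\<lambda>x. L (f x)) x" if "x \<in> S" for x
        using that Suc by (subst dd_linear_compose[OF assms(2)]) (auto simp: Ck_on_Suc)
    qed
    show "(\<lambda>x. L (f x)) differentiable (at x)" if "x \<in> S" for x
      using bounded_linear.has_derivative[OF assms(2) has_derivative_dd[of f x]] Suc(2) that
      unfolding differentiable_def Ck_on_Suc by blast
  qed
qed

lemma Ck_on_diff:
  assumes "open S" "Ck_on k S f" "Ck_on k S g"
  shows "Ck_on k S (\<lambda>x. f x - g x)"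
  using Ck_on_add[OF assms(1,2) Ck_on_linear_compose[OF assms(1) bounded_linear_minus[OF bounded_linear_ident] assms(3)]]
  by simp

lemma Ck_on_sum:
  assumes "open S" "\<And>i. i \<in> I \<Longrightarrow> Ck_on k S (f i)"
  shows "Ck_on k S (\<lambda>x. \<Sum>i\<in>I. f i x)"
  using assms(2) by (induction I rule: infinite_finite_induct) (auto intro: Ck_on_add[OF assms(1)])

lemma Ck_on_scaleR:
  fixes f :: "'a::real_normed_vector \<Rightarrow> real"
  assumes "open S" "Ck_on k S f" "Ck_on k S g"
  shows "Ck_on k S (\<lambda>x. f x *\<^sub>R g x)"
  using assms(2,3)
proof (induction k arbitrary: f g)
  case (Suc k)
  have D: "f differentiable (at x)" "g differentiable (at x)" if "x \<in> S" for x
    using Suc that by (auto simp: Ck_on_Suc)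
  have hd: "((\<lambda>x. f x *\<^sub>R g x) has_derivative (\<lambda>v. f x *\<^sub>R dd v g x + dd v f x *\<^sub>R g x)) (at x)" if "x \<in> S" for x
    by (rule has_derivative_scaleR; rule has_derivative_dd; rule D; fact)
  show ?case unfolding Ck_on_Suc
  proof (intro conjI ballI allI)
    show "Ck_on k S (dd v (\<lambda>x. f x *\<^sub>R g x))" for v
    proof (rule Ck_on_cong[OF assms(1)])
      show "Ck_on k S (\<lambda>x. f x *\<^sub>R dd v g x + dd v f x *\<^sub>R g x)"
        by (intro Ck_on_add assms(1) Suc(1)) (use Suc in \<open>auto intro: Ck_on_dd Ck_on_Suc_imp\<close>)
      show "f x *\<^sub>R dd v g x + dd v f x *\<^sub>R g x = dd v (\<lambda>x. f x *\<^sub>R g x) x" if "x \<in> S" for x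
        by (rule sym, rule dd_eqI[OF hd[OF that]])
    qed
    show "(\<lambda>x. f x *\<^sub>R g x) differentiable (at x)" if "x \<in> S" for x
      using hd[OF that] differentiable_def by blast
  qed
qed (auto intro: continuous_on_scaleR)

lemma Ck_on_euclidean:
  fixes f :: "'a::real_normed_vector \<Rightarrow> 'b::euclidean_space"
  assumes "open S" "\<And>i. i \<in> Basis \<Longrightarrow> Ck_on k S (\<lambda>x. f x \<bullet> i)"
  shows "Ck_on k S f"
proof -
  have "Ck_on k S (\<lambda>x. \<Sum>i\<in>Basis. (f x \<bullet> i) *\<^sub>R i)"
    by (intro Ck_on_sum Ck_on_scaleR assms Ck_on_const)
  then show ?thesis by (simp add: euclidean_representation)
qed

lemma linear_basis_sum:
  fixes L :: "'b::euclidean_space \<Rightarrow> 'c::real_vector"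
  assumes "linear L"
  shows "L w = (\<Sum>i\<in>Basis. (w \<bullet> i) *\<^sub>R L i)"
  using linear_sum[OF assms, of "\<lambda>i. (w \<bullet> i) *\<^sub>R i" Basis] linear_scale[OF assms]
  by (simp add: euclidean_representation)

lemma Ck_on_compose:
  fixes g :: "'a::real_normed_vector \<Rightarrow> 'b::euclidean_space"
  assumes "open S" "Ck_on k T f" "Ck_on k S g" "g ` S \<subseteq> T"
  shows "Ck_on k S (\<lambda>x. f (g x))"
  using assms(2-)
proof (induction k arbitrary: f)
  case 0
  then show ?case using continuous_on_compose2[of T f S g] by auto
next
  case (Suc k)
  have D: "g differentiable (at x)" "f differentiable (at (g x))" if "x \<in> S" for x
    using Suc that by (auto simp: Ck_on_Suc)
  show ?case unfolding Ck_on_Suc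
  proof (intro conjI ballI allI)
    show "(\<lambda>x. f (g x)) differentiable (at x)" if "x \<in> S" for x
      using D[OF that] by (rule differentiable_compose_at)
    show "Ck_on k S (dd v (\<lambda>x. f (g x)))" for v
    proof (rule Ck_on_cong[OF assms(1)])
      \<comment> \<open>The chain rule gives \<open>dd (dd v g x) f (g x)\<close>, whose direction
        moves with \<open>x\<close>. Expanding it in a basis leaves fixed directions, to which the
        induction hypothesis applies.\<close>
      show "Ck_on k S (\<lambda>x. \<Sum>i\<in>Basis. (dd v g x \<bullet> i) *\<^sub>R dd i f (g x))"
        by (intro Ck_on_sum Ck_on_scaleR assms(1) Suc(1)
            Ck_on_linear_compose[OF assms(1) bounded_linear_inner_left])
           (use Suc in \<open>auto intro: Ck_on_dd Ck_on_Suc_imp\<close>)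
      show "(\<Sum>i\<in>Basis. (dd v g x \<bullet> i) *\<^sub>R dd i f (g x)) = dd v (\<lambda>x. f (g x)) x" if "x \<in> S" for x
        using D[OF that] by (simp add: dd_compose linear_basis_sum[OF linear_dd, of f "g x" "dd v g x"])
    qed
  qed
qed

lemma Ck_on_Pair:
  assumes "open S" "Ck_on k S f" "Ck_on k S g"
  shows "Ck_on k S (\<lambda>x. (f x, g x))"
proof -
  have "bounded_linear (\<lambda>x::'b. (x, 0::'c))" "bounded_linear (\<lambda>x::'c. (0::'b, x))"
    by (intro bounded_linear_Pair bounded_linear_ident bounded_linear_zero)+
  then have "Ck_on k S (\<lambda>x. (f x, 0) + (0, g x))"
    by (intro Ck_on_add Ck_on_linear_compose[where L = "\<lambda>x. (x, 0)"] Ck_on_linear_compose[where L = "\<lambda>x. (0, x)"] assms)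
  then show ?thesis by simp
qed

lemma smooth_on_Ck: "smooth_on S f \<Longrightarrow> Ck_on k S f"
  by (simp add: smooth_on_def)

lemma dd_line:
  assumes "f differentiable (at (p + s *\<^sub>R u))"
  shows "((\<lambda>s. f (p + s *\<^sub>R u)) has_vector_derivative dd u f (p + s *\<^sub>R u)) (at s)"
proof -
  have "((\<lambda>s. p + s *\<^sub>R u) has_derivative (\<lambda>t. t *\<^sub>R u)) (at s)"
    by (auto intro!: derivative_eq_intros)
  from has_derivative_compose[OF this has_derivative_dd[OF assms]]
  show ?thesis using linear_scale[OF linear_dd[OF assms]]
    by (simp add: has_vector_derivative_def)
qed

lemma dd_line_real:
  fixes f :: "'a::real_normed_vector \<Rightarrow> real"
  assumes "f differentiable (at (p + s *\<^sub>R u))"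
  shows "((\<lambda>s. f (p + s *\<^sub>R u)) has_real_derivative dd u f (p + s *\<^sub>R u)) (at s)"
  using dd_line[OF assms] by (simp add: has_real_derivative_iff_has_vector_derivative)

lemma dd_line_eqI:
  assumes "f differentiable (at x)" "((\<lambda>s. f (x + s *\<^sub>R u)) has_vector_derivative d) (at 0)"
  shows "dd u f x = d"
  using dd_line[of f x 0 u] assms vector_derivative_unique_at[of "\<lambda>s. f (x + s *\<^sub>R u)"] by simp

section \<open>Second derivatives\<close>

text \<open>Mean value theorem twice: in direction \<open>u\<close> for the difference
  \<open>\<phi>\<close> of two parallel segments, then in direction \<open>v\<close> for
  \<open>dd u f\<close>. The second difference is symmetric in \<open>u\<close> and
  \<open>v\<close>, which will make derivatives commute.\<close>

lemma mixed_difference: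
  fixes f :: "'a::real_normed_vector \<Rightarrow> real"
  assumes "Ck_on 2 S f" "0 < h" and sub: "\<And>s t. \<lbrakk>0 \<le> s; s \<le> h; 0 \<le> t; t \<le> h\<rbrakk> \<Longrightarrow> x + s *\<^sub>R u + t *\<^sub>R v \<in> S"
  shows "\<exists>s t. 0 < s \<and> s < h \<and> 0 < t \<and> t < h \<and>
    f (x + h *\<^sub>R u + h *\<^sub>R v) - f (x + h *\<^sub>R u) - f (x + h *\<^sub>R v) + f x
      = h * h * dd v (dd u f) (x + s *\<^sub>R u + t *\<^sub>R v)"
proof -
  have C: "f differentiable (at y)" "dd u f differentiable (at y)" if "y \<in> S" for y
    using assms(1) that by (auto simp: Ck_on_Suc numeral_2_eq_2)
  define \<phi> where "\<phi> s = f (x + h *\<^sub>R v + s *\<^sub>R u) - f (x + s *\<^sub>R u)" for s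
  have 1: "(\<phi> has_real_derivative (dd u f (x + h *\<^sub>R v + s *\<^sub>R u) - dd u f (x + s *\<^sub>R u))) (at s)"
    if "0 \<le> s" "s \<le> h" for s
  proof -
    have "x + h *\<^sub>R v + s *\<^sub>R u \<in> S" "x + s *\<^sub>R u \<in> S"
      using sub[of s h] sub[of s 0] that assms(2) by (auto simp: algebra_simps)
    then show ?thesis unfolding \<phi>_def
      by (intro DERIV_diff dd_line_real C)
  qed
  obtain s where s: "0 < s" "s < h" "\<phi> h - \<phi> 0 = h * (dd u f (x + h *\<^sub>R v + s *\<^sub>R u) - dd u f (x + s *\<^sub>R u))"
    using MVT2[OF assms(2), of \<phi> "\<lambda>s. dd u f (x + h *\<^sub>R v + s *\<^sub>R u) - dd u f (x + s *\<^sub>R u)"] 1 by auto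
  have 2: "((\<lambda>t. dd u f (x + s *\<^sub>R u + t *\<^sub>R v)) has_real_derivative dd v (dd u f) (x + s *\<^sub>R u + t *\<^sub>R v)) (at t)"
    if "0 \<le> t" "t \<le> h" for t
    using that s assms(2)
    by (intro dd_line_real C sub) auto
  obtain t where t: "0 < t" "t < h" "dd u f (x + s *\<^sub>R u + h *\<^sub>R v) - dd u f (x + s *\<^sub>R u + 0 *\<^sub>R v)
      = h * dd v (dd u f) (x + s *\<^sub>R u + t *\<^sub>R v)"
    using MVT2[OF assms(2), of "\<lambda>t. dd u f (x + s *\<^sub>R u + t *\<^sub>R v)", OF 2] by auto
  have e: "x + h *\<^sub>R v + s *\<^sub>R u = x + s *\<^sub>R u + h *\<^sub>R v" by simp
  have t3: "dd u f (x + s *\<^sub>R u + h *\<^sub>R v) - dd u f (x + s *\<^sub>R u) = h * dd v (dd u f) (x + s *\<^sub>R u + t *\<^sub>R v)"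
    using t(3) by simp
  have "\<phi> h - \<phi> 0 = h * h * dd v (dd u f) (x + s *\<^sub>R u + t *\<^sub>R v)"
    unfolding s(3) e t3 by simp
  then show ?thesis using s t unfolding \<phi>_def by (auto simp: algebra_simps)
qed

text \<open>Both mixed derivatives, each at its own intermediate point, equal the same second
  difference divided by \<open>h * h\<close>. Continuity at \<open>x\<close> then excludes two
  different values.\<close>

lemma dd_commute:
  fixes f :: "'a::real_normed_vector \<Rightarrow> real"
  assumes "open S" "Ck_on 2 S f" "x \<in> S"
  shows "dd u (dd v f) x = dd v (dd u f) x"
proof (rule ccontr)
  assume ne: "dd u (dd v f) x \<noteq> dd v (dd u f) x"
  define e where "e = dist (dd u (dd v f) x) (dd v (dd u f) x) / 2"
  have "e > 0" using ne by (simp add: e_def)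
  have C: "continuous_on S (dd u (dd v f))" "continuous_on S (dd v (dd u f))"
    using assms(2) by (auto simp: Ck_on_Suc numeral_2_eq_2)
  obtain d1 where d1: "d1 > 0" "\<And>y. y \<in> S \<Longrightarrow> dist y x < d1 \<Longrightarrow> dist (dd u (dd v f) y) (dd u (dd v f) x) < e"
    using C(1)[unfolded continuous_on_iff] assms(3) \<open>e > 0\<close> by blast
  obtain d2 where d2: "d2 > 0" "\<And>y. y \<in> S \<Longrightarrow> dist y x < d2 \<Longrightarrow> dist (dd v (dd u f) y) (dd v (dd u f) x) < e"
    using C(2)[unfolded continuous_on_iff] assms(3) \<open>e > 0\<close> by blast
  obtain d3 where d3: "d3 > 0" "ball x d3 \<subseteq> S" using assms open_contains_ball by blast
  define d where "d = min d1 (min d2 d3)"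
  \<comment> \<open>Keeps the whole parallelogram within \<open>d / 2\<close> of \<open>x\<close>;
    the summand 1 makes the denominator positive when \<open>u\<close> and \<open>v\<close>
    vanish.\<close>
  define h where "h = d / (2 * (norm u + norm v + 1))"
  have pos: "norm u + norm v + 1 > 0" by (smt (verit) norm_ge_zero)
  have "d > 0" using d1 d2 d3 by (simp add: d_def)
  then have "h > 0" using pos by (simp add: h_def)
  have near: "dist (x + s *\<^sub>R u + t *\<^sub>R v) x < d" if "0 \<le> s" "s \<le> h" "0 \<le> t" "t \<le> h" for s t
  proof -
    have "dist (x + s *\<^sub>R u + t *\<^sub>R v) x \<le> s * norm u + t * norm v"
      using norm_triangle_ineq[of "s *\<^sub>R u" "t *\<^sub>R v"] that by (simp add: dist_norm)
    also have "\<dots> \<le> h * norm u + h * norm v" using that by (intro add_mono mult_right_mono) auto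
    also have "\<dots> \<le> h * (norm u + norm v + 1)" using \<open>h > 0\<close> by (simp add: algebra_simps)
    also have "\<dots> = d / 2" using pos by (simp add: h_def divide_simps)
    finally show ?thesis using \<open>d > 0\<close> by simp
  qed
  have S1: "x + s *\<^sub>R u + t *\<^sub>R v \<in> S" if "0 \<le> s" "s \<le> h" "0 \<le> t" "t \<le> h" for s t
    using near[OF that] d3 by (auto simp: d_def dist_commute subset_eq)
  have S2: "x + s *\<^sub>R v + t *\<^sub>R u \<in> S" if "0 \<le> s" "s \<le> h" "0 \<le> t" "t \<le> h" for s t
    using S1[of t s] that by (simp add: algebra_simps)
  obtain s t where st: "0 < s" "s < h" "0 < t" "t < h" "f (x + h *\<^sub>R u + h *\<^sub>R v) - f (x + h *\<^sub>R u) - f (x + h *\<^sub>R v) + f x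
      = h * h * dd v (dd u f) (x + s *\<^sub>R u + t *\<^sub>R v)"
    using mixed_difference[OF assms(2) \<open>h > 0\<close> S1] by blast
  obtain s' t' where st': "0 < s'" "s' < h" "0 < t'" "t' < h" "f (x + h *\<^sub>R v + h *\<^sub>R u) - f (x + h *\<^sub>R v) - f (x + h *\<^sub>R u) + f x
      = h * h * dd u (dd v f) (x + s' *\<^sub>R v + t' *\<^sub>R u)"
    using mixed_difference[OF assms(2) \<open>h > 0\<close> S2] by blast
  have e: "x + h *\<^sub>R v + h *\<^sub>R u = x + h *\<^sub>R u + h *\<^sub>R v" by simp
  have "h * h * dd v (dd u f) (x + s *\<^sub>R u + t *\<^sub>R v) = h * h * dd u (dd v f) (x + s' *\<^sub>R v + t' *\<^sub>R u)"
    using st(5) st'(5) unfolding e by linarith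
  then have "dd v (dd u f) (x + s *\<^sub>R u + t *\<^sub>R v) = dd u (dd v f) (x + s' *\<^sub>R v + t' *\<^sub>R u)"
    using \<open>h > 0\<close> by simp
  moreover have "dist (dd v (dd u f) (x + s *\<^sub>R u + t *\<^sub>R v)) (dd v (dd u f) x) < e"
    using st S1 near[of s t] by (intro d2) (auto simp: d_def)
  moreover have "dist (dd u (dd v f) (x + s' *\<^sub>R v + t' *\<^sub>R u)) (dd u (dd v f) x) < e"
    using st' S2 near[of t' s'] by (intro d1) (auto simp: d_def algebra_simps)
  ultimately show False
    using dist_triangle3[of "dd u (dd v f) x" "dd v (dd u f) x" "dd u (dd v f) (x + s' *\<^sub>R v + t' *\<^sub>R u)"]
    by (simp add: e_def)
qed

section \<open>Second derivatives of real functions along curves\<close>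

lemma deriv_eq_dd:
  fixes f :: "real \<Rightarrow> real"
  assumes "f differentiable (at s)" shows "deriv f s = dd 1 f s"
proof (rule DERIV_imp_deriv)
  have "dd t f s = dd 1 f s * t" for t
    using linear_scale[OF linear_dd[OF assms], of t 1] by (metis mult.commute mult.right_neutral real_scaleR_def)
  then have "(\<lambda>v. dd v f s) = (*) (dd 1 f s)" by blast
  then show "(f has_field_derivative dd 1 f s) (at s)"
    using has_derivative_dd[OF assms] unfolding has_field_derivative_def by simp
qed

lemma deriv2_cong:
  fixes f g :: "real \<Rightarrow> real"
  assumes "open I" "s \<in> I" "\<And>t. t \<in> I \<Longrightarrow> f t = g t"
  shows "(deriv ^^ 2) f s = (deriv ^^ 2) g s"
proof -
  have ev: "\<forall>\<^sub>F t in nhds s. t \<in> I" using assms eventually_nhds by blast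
  have "\<forall>\<^sub>F t in nhds s'. f t = g t" if "s' \<in> I" for s'
    using that assms eventually_nhds by blast
  then have "\<forall>\<^sub>F t in nhds s. deriv f t = deriv g t"
    using ev by (auto elim!: eventually_mono intro: deriv_cong_ev)
  then show ?thesis by (simp add: numeral_2_eq_2 deriv_cong_ev)
qed

text \<open>The direction \<open>dd 1 \<gamma> t\<close> moves with \<open>t\<close>, so the first
  derivative is written in a basis and differentiated as a sum of products. At a critical point of
  \<open>f\<close> only the Hessian term survives, which is the case needed later.\<close>

lemma deriv2_compose_curve:
  fixes f :: "'a::euclidean_space \<Rightarrow> real" and \<gamma> :: "real \<Rightarrow> 'a"
  assumes S: "open S" "Ck_on 2 S f" and I: "open I" "s \<in> I" "Ck_on 2 I \<gamma>" "\<gamma> ` I \<subseteq> S"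
  shows "(deriv ^^ 2) (\<lambda>s. f (\<gamma> s)) s =
    dd (dd 1 \<gamma> s) (dd (dd 1 \<gamma> s) f) (\<gamma> s) + dd (dd 1 (dd 1 \<gamma>) s) f (\<gamma> s)"
proof -
  let ?h = "dd 1 \<gamma> s"
  have df: "f differentiable (at y)" "dd v f differentiable (at y)" if "y \<in> S" for y v
    using S(2) that by (auto simp: Ck_on_Suc numeral_2_eq_2)
  have dg: "\<gamma> differentiable (at t)" "dd 1 \<gamma> differentiable (at t)" if "t \<in> I" for t
    using I(3) that by (auto simp: Ck_on_Suc numeral_2_eq_2)
  have "\<gamma> s \<in> S" using I by auto
  have 1: "deriv (\<lambda>s. f (\<gamma> s)) t = (\<Sum>i\<in>Basis. (dd 1 \<gamma> t \<bullet> i) * dd i f (\<gamma> t))" if "t \<in> I" for t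
  proof -
    have "\<gamma> t \<in> S" using that I by auto
    then show ?thesis using dg[OF that] df[OF \<open>\<gamma> t \<in> S\<close>] linear_basis_sum[OF linear_dd, of f "\<gamma> t" "dd 1 \<gamma> t"]
      by (simp add: deriv_eq_dd differentiable_compose_at dd_compose)
  qed
  have c: "(\<lambda>t. dd i f (\<gamma> t)) differentiable (at s)" for i
    by (rule differentiable_compose_at[OF dg(1)[OF I(2)] df(2)[OF \<open>\<gamma> s \<in> S\<close>]])
  have 2: "((\<lambda>t. \<Sum>i\<in>Basis. (dd 1 \<gamma> t \<bullet> i) * dd i f (\<gamma> t)) has_derivative
     (\<lambda>a. \<Sum>i\<in>Basis. (dd 1 \<gamma> s \<bullet> i) * dd a (\<lambda>t. dd i f (\<gamma> t)) s + (dd a (dd 1 \<gamma>) s \<bullet> i) * dd i f (\<gamma> s))) (at s)"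
    by (rule has_derivative_sum, rule has_derivative_mult, rule has_derivative_inner_left)
       (rule has_derivative_dd, rule dg, rule I, rule has_derivative_dd, rule c)
  \<comment> \<open>Commuting the derivatives puts the basis vector into the outer slot, where
    \<open>linear_dd\<close> applies and collapses the sum to the Hessian.\<close>
  have 3: "dd 1 (\<lambda>t. dd i f (\<gamma> t)) s = dd i (dd ?h f) (\<gamma> s)" for i
    using dd_compose[OF dg(1)[OF I(2)] df(2)[OF \<open>\<gamma> s \<in> S\<close>]] dd_commute[OF S \<open>\<gamma> s \<in> S\<close>] by simp
  have "(deriv ^^ 2) (\<lambda>s. f (\<gamma> s)) s = deriv (\<lambda>t. \<Sum>i\<in>Basis. (dd 1 \<gamma> t \<bullet> i) * dd i f (\<gamma> t)) s"
    using I(1,2) 1 by (simp add: numeral_2_eq_2 eventually_nhds) (rule deriv_cong_ev, auto simp: eventually_nhds)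
  also have "\<dots> = dd 1 (\<lambda>t. \<Sum>i\<in>Basis. (dd 1 \<gamma> t \<bullet> i) * dd i f (\<gamma> t)) s"
    using 2 differentiable_def by (intro deriv_eq_dd) blast
  also have "\<dots> = (\<Sum>i\<in>Basis. (?h \<bullet> i) * dd i (dd ?h f) (\<gamma> s) + (dd 1 (dd 1 \<gamma>) s \<bullet> i) * dd i f (\<gamma> s))"
    using dd_eqI[OF 2, of 1] 3 by simp
  also have "\<dots> = dd ?h (dd ?h f) (\<gamma> s) + dd (dd 1 (dd 1 \<gamma>) s) f (\<gamma> s)"
    using linear_basis_sum[OF linear_dd[OF df(2)[OF \<open>\<gamma> s \<in> S\<close>, of ?h]], of ?h]
      linear_basis_sum[OF linear_dd[OF df(1)[OF \<open>\<gamma> s \<in> S\<close>]], of "dd 1 (dd 1 \<gamma>) s"]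
    by (simp add: sum.distrib)
  finally show ?thesis .
qed

section \<open>The inverse function theorem for \<open>C\<^sup>2\<close> maps\<close>

lemma linear_inj_on_self_inverse:
  fixes L :: "'a::euclidean_space \<Rightarrow> 'a"
  assumes "linear L" "inj L"
  obtains L' where "linear L'" "\<And>v. L (L' v) = v" "\<And>v. L' (L v) = v"
  using linear_injective_isomorphism[OF assms] by blast

lemma inverse_differentiable:
  fixes K :: "'a::euclidean_space \<Rightarrow> 'a"
  assumes "open U" "Ck_on 1 U K" "\<And>x. x \<in> U \<Longrightarrow> L (K x) = x" "\<And>x. x \<in> U \<Longrightarrow> inj (\<lambda>v. dd v K x)" "x \<in> U"
  shows "L differentiable (at (K x))" and "dd (dd v K x) L (K x) = v"
proof -
  have K: "K differentiable (at x)" using assms Ck_on_imp_differentiable by fastforce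
  obtain D' where D': "linear D'" "\<And>v. dd (D' v) K x = v" "\<And>v. D' (dd v K x) = v"
    by (rule linear_inj_on_self_inverse[OF linear_dd[OF K] assms(4)[OF assms(5)]]) (rule that)
  have "(L has_derivative D') (at (K x))"
    using D' by (intro has_derivative_inverse_strong[OF assms(1,5) Ck_on_imp_continuous_on[OF assms(2)] assms(3) has_derivative_dd[OF K]])
      (auto simp: o_def id_def)
  then show "L differentiable (at (K x))" "dd (dd v K x) L (K x) = v"
    using D'(3) by (auto simp: differentiable_def dd_eqI)
qed

text \<open>\<open>L\<close> is given only as a left inverse on \<open>U\<close>; openness of the
  image comes from invariance of domain. The class is \<open>Suc k\<close> so that the tangent map,
  which spends one derivative, has class \<open>k\<close>.\<close>

locale Ck_inverse =
  fixes k :: nat and U :: "'a::euclidean_space set" and K L :: "'a \<Rightarrow> 'a"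
  assumes open_U: "open U" and K: "Ck_on (Suc k) U K" and L: "\<And>x. x \<in> U \<Longrightarrow> L (K x) = x"
    and inj: "\<And>x. x \<in> U \<Longrightarrow> inj (\<lambda>v. dd v K x)"
begin

lemma K1: "Ck_on 1 U K" using K by (rule Ck_on_le) simp

lemma K_diff: "x \<in> U \<Longrightarrow> K differentiable (at x)"
  using K1 Ck_on_imp_differentiable by fastforce

lemma open_image: "open (K ` U)"
proof (rule invariance_of_domain[OF Ck_on_imp_continuous_on[OF K] open_U])
  show "inj_on K U" using L by (metis inj_onI)
qed

lemma L_diff: "y \<in> K ` U \<Longrightarrow> L differentiable (at y)"
  using inverse_differentiable(1)[OF open_U K1 L inj] by blast

lemma dd_L: "x \<in> U \<Longrightarrow> dd (dd v K x) L (K x) = v"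
  using inverse_differentiable(2)[OF open_U K1 L inj] by blast

lemma dd_dd_L: "x \<in> U \<Longrightarrow> dd (dd v L (K x)) K x = v"
proof -
  assume "x \<in> U"
  have "surj (\<lambda>v. dd v K x)"
    using linear_injective_imp_surjective[OF linear_dd[OF K_diff] inj] \<open>x \<in> U\<close> by simp
  then obtain w where "dd w K x = v" by (metis surjD)
  then show ?thesis using dd_L[OF \<open>x \<in> U\<close>] by metis
qed

text \<open>The tangent maps of \<open>K\<close> and \<open>L\<close> are again inverse to each other, so the differentiability of
  the inverse applied to them gives higher derivatives of \<open>L\<close>.\<close>

definition TK :: "'a \<times> 'a \<Rightarrow> 'a \<times> 'a" where "TK p = (K (fst p), dd (snd p) K (fst p))"
definition TL :: "'a \<times> 'a \<Rightarrow> 'a \<times> 'a" where "TL p = (L (fst p), dd (snd p) L (fst p))"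

lemma TK_Ck: "Ck_on k (U \<times> UNIV) TK"
proof -
  have o: "open (U \<times> (UNIV::'a set))" using open_U by (simp add: open_Times)
  have "Ck_on k (U \<times> UNIV) (\<lambda>p. (K (fst p), \<Sum>i\<in>Basis. (snd p \<bullet> i) *\<^sub>R dd i K (fst p)))"
  proof (intro Ck_on_Pair Ck_on_sum Ck_on_scaleR o Ck_on_linear_compose[OF o bounded_linear_inner_left])
    show "Ck_on k (U \<times> UNIV) (\<lambda>p::'a \<times> 'a. K (fst p))"
      by (rule Ck_on_compose[where g = "fst :: 'a \<times> 'a \<Rightarrow> 'a" and f = K, OF o Ck_on_Suc_imp[OF K] Ck_on_bounded_linear[OF bounded_linear_fst]]) auto
    show "Ck_on k (U \<times> UNIV) (\<lambda>p::'a \<times> 'a. dd i K (fst p))" for i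
      by (rule Ck_on_compose[where g = "fst :: 'a \<times> 'a \<Rightarrow> 'a" and f = "dd i K", OF o Ck_on_dd[OF K] Ck_on_bounded_linear[OF bounded_linear_fst]]) auto
    show "Ck_on k (U \<times> UNIV) (snd :: 'a \<times> 'a \<Rightarrow> 'a)"
      by (rule Ck_on_bounded_linear[OF bounded_linear_snd])
  qed
  then show ?thesis
  proof (rule Ck_on_cong[OF o, rotated])
    show "(K (fst p), \<Sum>i\<in>Basis. (snd p \<bullet> i) *\<^sub>R dd i K (fst p)) = TK p" if "p \<in> U \<times> UNIV" for p
      using that linear_basis_sum[OF linear_dd[OF K_diff], of "fst p" "snd p"] by (auto simp: TK_def)
  qed
qed

lemma TL_TK: "p \<in> U \<times> UNIV \<Longrightarrow> TL (TK p) = p"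
  by (auto simp: TL_def TK_def L dd_L)

lemma TK_image: "TK ` (U \<times> UNIV) = K ` U \<times> UNIV"
proof
  show "K ` U \<times> UNIV \<subseteq> TK ` (U \<times> UNIV)"
  proof
    fix p assume "p \<in> K ` U \<times> (UNIV::'a set)"
    then obtain x v where "x \<in> U" "p = (K x, v)" by auto
    then have "p = TK (x, dd v L (K x))" by (simp add: TK_def dd_dd_L)
    then show "p \<in> TK ` (U \<times> UNIV)" using \<open>x \<in> U\<close> by blast
  qed
qed (auto simp: TK_def)

text \<open>The derivative of \<open>TK\<close> is block triangular with the derivative of
  \<open>K\<close> twice on the diagonal, so injectivity passes from the latter to the
  former.\<close>

lemma TK_inj:
  assumes "0 < k" "p \<in> U \<times> UNIV" shows "inj (\<lambda>v. dd v TK p)"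
proof -
  have D: "TK differentiable (at p)" using TK_Ck assms Ck_on_imp_differentiable by blast
  have "a = 0 \<and> b = 0" if z: "dd (a, b) TK p = 0" for a b
  proof -
    obtain x w where p: "p = (x, w)" "x \<in> U" using assms by auto
    have "fst (dd (a, b) TK p) = dd (a, b) (\<lambda>p. K (fst p)) p"
      using dd_linear_compose[OF bounded_linear_fst D] by (simp add: TK_def)
    also have "\<dots> = dd a K x"
      using dd_compose[of fst p K "(a, b)"] K_diff[OF p(2)] p(1)
      by (simp add: dd_bounded_linear[OF bounded_linear_fst] bounded_linear_imp_differentiable bounded_linear_fst)
    finally have "dd a K x = 0" using z by simp
    then have "a = 0" using inj[OF p(2)] linear_0[OF linear_dd[OF K_diff[OF p(2)]]]
      by (metis injD)
    have l: "linear (\<lambda>v. dd v K x)" using linear_dd[OF K_diff[OF p(2)]] .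
    \<comment> \<open>\<open>TK\<close> is affine along \<open>(0, b)\<close>, so the second
      diagonal block can be read off without forming second derivatives of \<open>K\<close>.\<close>
    have "((\<lambda>s. TK (p + s *\<^sub>R (0, b))) has_vector_derivative (0, dd b K x)) (at 0)"
    proof -
      have "TK (p + s *\<^sub>R (0, b)) = (K x, dd w K x + s *\<^sub>R dd b K x)" for s
        using p by (simp add: TK_def linear_add[OF l] linear_scale[OF l])
      then show ?thesis
        by (auto simp: has_vector_derivative_def intro!: derivative_eq_intros)
    qed
    then have "dd (0, b) TK p = (0, dd b K x)" using dd_line_eqI[OF D] by blast
    then have "dd b K x = 0" using z \<open>a = 0\<close> by (simp add: zero_prod_def)
    then have "b = 0" using inj[OF p(2)] linear_0[OF l] by (metis injD)
    with \<open>a = 0\<close> show ?thesis by simp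
  qed
  then have "\<forall>v. dd v TK p = 0 \<longrightarrow> v = 0" by (simp add: zero_prod_def)
  then show ?thesis using linear_injective_0[OF linear_dd[OF D]] by simp
qed

end

text \<open>\<open>TL\<close> inverts \<open>TK\<close> and is therefore differentiable. Its second
  component is the derivative of \<open>L\<close>, which is thus differentiable and in particular
  continuous. Keeping only the continuity is where a degree is lost.\<close>

lemma Ck_on_inverse_1:
  assumes "Ck_inverse 1 U K L" shows "Ck_on 1 (K ` U) L"
proof -
  interpret Ck_inverse 1 U K L by fact
  have T: "TL differentiable (at p)" if "p \<in> K ` U \<times> UNIV" for p
  proof -
    have o: "open (U \<times> (UNIV::'a set))" using open_U by (simp add: open_Times)
    have "p \<in> TK ` (U \<times> UNIV)" using that TK_image by simp
    then obtain q where q: "q \<in> U \<times> UNIV" "p = TK q" by blast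
    show ?thesis unfolding q(2)
      by (rule inverse_differentiable(1)[OF o TK_Ck TL_TK TK_inj[OF zero_less_one] q(1)])
  qed
  have "dd v L differentiable (at y)" if "y \<in> K ` U" for v y
  proof -
    have c: "(\<lambda>y. (y, v)) differentiable (at y)" for y :: 'a
      by (auto simp: differentiable_def intro!: derivative_eq_intros)
    have "(\<lambda>y. TL (y, v)) differentiable (at y)"
      by (rule differentiable_compose_at[OF c T]) (use that in auto)
    then have "(\<lambda>y. snd (TL (y, v))) differentiable (at y)"
      by (rule differentiable_compose_at[OF _ bounded_linear_imp_differentiable[OF bounded_linear_snd]])
    then show ?thesis by (simp add: TL_def)
  qed
  then have "continuous_on (K ` U) (dd v L)" for v
    by (auto intro!: continuous_at_imp_continuous_on differentiable_imp_continuous_within)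
  then show ?thesis using L_diff by (simp add: Ck_on_Suc One_nat_def[symmetric] del: One_nat_def) (simp add: Ck_on_Suc)
qed

text \<open>The previous case, applied to the pair \<open>TK\<close> and \<open>TL\<close>, makes
  the derivative of \<open>L\<close> a C^1 map.\<close>

lemma Ck_on_inverse_2:
  assumes "Ck_inverse 2 U K L" shows "Ck_on 2 (K ` U) L"
proof -
  interpret Ck_inverse 2 U K L by fact
  have o: "open (U \<times> (UNIV::'a set))" using open_U by (simp add: open_Times)
  have "Ck_inverse 1 (U \<times> UNIV) TK TL"
    using TK_Ck TL_TK TK_inj o by unfold_locales (auto simp: numeral_2_eq_2)
  then have T: "Ck_on 1 (K ` U \<times> UNIV) TL" using Ck_on_inverse_1 TK_image by metis
  have "Ck_on 1 (K ` U) (dd v L)" for v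
  proof -
    have "Ck_on 1 (K ` U) (\<lambda>y. TL (y, v))"
      by (rule Ck_on_compose[OF open_image T Ck_on_Pair[OF open_image Ck_on_bounded_linear[OF bounded_linear_ident] Ck_on_const]]) auto
    from Ck_on_linear_compose[OF open_image bounded_linear_snd this] show ?thesis by (simp add: TL_def)
  qed
  then show ?thesis using L_diff by (simp add: Ck_on_Suc[of 1, simplified] numeral_2_eq_2)
qed

text \<open>The drop from 3 to 2 is affordable, because local inverses are later differentiated at
  most twice.\<close>

theorem inverse_function_Ck:
  fixes K :: "'a::euclidean_space \<Rightarrow> 'a"
  assumes S: "open S" "x \<in> S" "Ck_on 3 S K" and inj: "inj (\<lambda>v. dd v K x)"
  obtains U V L where "open U" "x \<in> U" "U \<subseteq> S" "open V" "K ` U = V" "L ` V = U"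
    "\<And>x. x \<in> U \<Longrightarrow> L (K x) = x" "\<And>y. y \<in> V \<Longrightarrow> K (L y) = y" "Ck_on 2 V L"
proof -
  have D: "K differentiable (at y)" if "y \<in> S" for y
    using that S(3) Ck_on_imp_differentiable by fastforce
  \<comment> \<open>The classical theorem asks for a derivative that is continuous in operator norm;
    in finite dimension this reduces to continuity of the directional derivatives.\<close>
  define K' where "K' y = Blinfun (\<lambda>v. dd v K y)" for y
  have K': "blinfun_apply (K' y) = (\<lambda>v. dd v K y)" if "y \<in> S" for y
    unfolding K'_def using linear_dd[OF D[OF that]] by (intro bounded_linear_Blinfun_apply) (simp add: linear_conv_bounded_linear)
  have cont: "continuous_on S K'"
  proof (rule continuous_on_blinfun_componentwise)
    fix i :: 'a
    have "continuous_on S (dd i K)"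
      using S(3) Ck_on_dd[of 2 S K i] Ck_on_imp_continuous_on by (simp add: numeral_3_eq_3 numeral_2_eq_2)
    then show "continuous_on S (\<lambda>y. blinfun_apply (K' y) i)"
      by (rule continuous_on_eq) (simp add: K')
  qed
  obtain D' where D': "linear D'" "\<And>v. D' (dd v K x) = v"
    by (rule linear_inj_on_self_inverse[OF linear_dd[OF D[OF S(2)]] inj]) (rule that)
  have inv: "Blinfun D' o\<^sub>L K' x = id_blinfun"
    using D' S(2) by (intro blinfun_eqI) (simp add: bounded_linear_Blinfun_apply linear_conv_bounded_linear[symmetric] K')
  obtain U V L L' where U: "open U" "U \<subseteq> S" "x \<in> U" "open V" "K x \<in> V" "homeomorphism U V K L"
    and L': "\<And>y. y \<in> V \<Longrightarrow> bij (blinfun_apply (K' (L y)))"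
  proof (rule inverse_function_theorem[OF S(1) _ cont S(2) inv])
    show "(K has_derivative blinfun_apply (K' y)) (at y)" if "y \<in> S" for y
      using has_derivative_dd[OF D[OF that]] K'[OF that] by simp
  qed (rule that; assumption)
  have h: "K ` U = V" "L ` V = U" "\<And>x. x \<in> U \<Longrightarrow> L (K x) = x" "\<And>y. y \<in> V \<Longrightarrow> K (L y) = y"
    using U(6) by (auto simp: homeomorphism_def)
  have "inj (\<lambda>v. dd v K y)" if "y \<in> U" for y
    using L'[of "K y"] h that U K'[of y] by (auto simp: bij_def)
  then have "Ck_inverse 2 U K L"
    using U h Ck_on_subset[OF S(3) U(2)] by unfold_locales (auto simp: numeral_3_eq_3 numeral_2_eq_2)
  then have "Ck_on 2 V L" using Ck_on_inverse_2 h by metis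
  then show ?thesis using that U h by metis
qed

text \<open>The coordinate change is the inverse of \<open>\<xi> \<mapsto> \<xi> + R (Q \<xi> - Q x - DQ (\<xi> - x))\<close>, whose
  derivative at \<open>x\<close> is the identity.\<close>

theorem submersion_normal_form:
  fixes Q :: "'a::euclidean_space \<Rightarrow> 'b::euclidean_space"
  assumes S: "open S" "x \<in> S" "Ck_on 3 S Q" and R: "linear R" "\<And>v. dd (R v) Q x = v"
  obtains W \<Psi> where "open W" "x \<in> W" "\<Psi> ` W \<subseteq> S" "Ck_on 2 W \<Psi>" "\<Psi> x = x" "\<And>v. dd v \<Psi> x = v"
    "\<And>\<theta>. \<theta> \<in> W \<Longrightarrow> Q (\<Psi> \<theta>) = Q x + dd (\<theta> - x) Q x"
proof -
  let ?T = "\<lambda>v. dd v Q x"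
  define \<Phi> where "\<Phi> \<xi> = \<xi> + R (Q \<xi> - Q x - ?T (\<xi> - x))" for \<xi>
  have Qd: "Q differentiable (at x)" using S Ck_on_imp_differentiable by fastforce
  have T: "linear ?T" by (rule linear_dd[OF Qd])
  then have T': "bounded_linear ?T" "bounded_linear R"
    using R(1) by (auto simp: linear_conv_bounded_linear)
  have "Ck_on 3 S \<Phi>" unfolding \<Phi>_def
    by (intro Ck_on_add Ck_on_diff Ck_on_linear_compose[OF S(1) T'(2)] Ck_on_linear_compose[OF S(1) T'(1)] S
        Ck_on_const Ck_on_bounded_linear[OF bounded_linear_ident])
  have "(\<Phi> has_derivative (\<lambda>v. v + R (?T v - 0 - ?T (v - 0)))) (at x)" unfolding \<Phi>_def
    by (intro has_derivative_add has_derivative_diff bounded_linear.has_derivative[OF T'(2)]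
        bounded_linear.has_derivative[OF T'(1)] has_derivative_dd[OF Qd] has_derivative_const has_derivative_ident)
  then have d: "dd v \<Phi> x = v" for v using dd_eqI linear_0[OF R(1)] by fastforce
  obtain U V L where L: "open U" "x \<in> U" "U \<subseteq> S" "open V" "\<Phi> ` U = V" "L ` V = U"
    "\<And>x. x \<in> U \<Longrightarrow> L (\<Phi> x) = x" "\<And>y. y \<in> V \<Longrightarrow> \<Phi> (L y) = y" "Ck_on 2 V L"
    using inverse_function_Ck[OF S(1,2) \<open>Ck_on 3 S \<Phi>\<close>] d by (auto simp: inj_on_def)
  have x: "\<Phi> x = x" using linear_0[OF T] linear_0[OF R(1)] by (simp add: \<Phi>_def)
  \<comment> \<open>\<open>?T\<close> recovers the correction term from its image under
    \<open>R\<close>, so in the new coordinate \<open>\<Phi> \<xi>\<close> the map \<open>Q\<close>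
    becomes its own linearisation at \<open>x\<close>.\<close>
  have TP: "?T (\<Phi> \<xi> - x) = Q \<xi> - Q x" for \<xi>
    using linear_add[OF T, of "\<xi> - x" "R (Q \<xi> - Q x - ?T (\<xi> - x))"] R(2)
    by (simp add: \<Phi>_def algebra_simps)
  have "x \<in> V" using x L by force
  moreover have Lx: "L x = x" using L(2) L(7)[of x] x by simp
  moreover have "dd v L x = v" for v
  proof -
    have "L differentiable (at x)" "\<Phi> differentiable (at x)"
      using L \<open>x \<in> V\<close> S \<open>Ck_on 3 S \<Phi>\<close> Ck_on_imp_differentiable by fastforce+
    then have "dd v (\<lambda>\<theta>. \<Phi> (L \<theta>)) x = dd v L x" using Lx d by (subst dd_compose) auto
    moreover have "dd v (\<lambda>\<theta>. \<Phi> (L \<theta>)) x = dd v (\<lambda>\<theta>. \<theta>) x"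
      using L \<open>x \<in> V\<close> by (intro dd_cong[of V]) auto
    ultimately show ?thesis using dd_bounded_linear[OF bounded_linear_ident] by metis
  qed
  moreover have "Q (L \<theta>) = Q x + ?T (\<theta> - x)" if "\<theta> \<in> V" for \<theta>
    using TP[of "L \<theta>"] L(8)[OF that] by simp
  ultimately show ?thesis using that[of V L] L by blast
qed

section \<open>Charts\<close>

lemma open_vimage_Ck: "open S \<Longrightarrow> Ck_on k S f \<Longrightarrow> open O' \<Longrightarrow> open {x \<in> S. f x \<in> O'}"
  using continuous_open_preimage[of S f O'] Ck_on_imp_continuous_on[of k S f]
  by (simp add: Int_def vimage_def)

text \<open>The axioms of \<open>smooth_manifold\<close> that concern charts alone. Calculations
  with curves and differentials rest on them, and for the quotient it is this part that is
  established.\<close>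

definition smooth_atlas :: "('a, 'e::euclidean_space) atlas \<Rightarrow> bool" where
  "smooth_atlas A \<longleftrightarrow> (\<forall>C\<in>A. is_chart C) \<and> (\<forall>C\<in>A. \<forall>D\<in>A. compatible C D)"

lemma smooth_manifold_atlas: "smooth_manifold A \<Longrightarrow> smooth_atlas A"
  by (simp add: smooth_manifold_def smooth_atlas_def)

lemma is_chartD: "is_chart (U, \<phi>) \<Longrightarrow> inj_on \<phi> U" "is_chart (U, \<phi>) \<Longrightarrow> open (\<phi> ` U)"
  by (simp_all add: is_chart_def)

lemma compatibleD:
  assumes "compatible (U, \<phi>) (V, \<psi>)"
  shows "open (\<phi> ` (U \<inter> V))" "Ck_on k (\<phi> ` (U \<inter> V)) (\<lambda>\<xi>. \<psi> (inv_into U \<phi> \<xi>))"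
    "open (\<psi> ` (U \<inter> V))" "Ck_on k (\<psi> ` (U \<inter> V)) (\<lambda>\<eta>. \<phi> (inv_into V \<psi> \<eta>))"
  using assms by (auto simp: compatible_def intro: smooth_on_Ck)

lemma compatible_sym: "compatible C D \<Longrightarrow> compatible D C"
  unfolding compatible_def by (auto simp: Int_commute split: prod.splits)

lemma atlas_chart: "smooth_atlas A \<Longrightarrow> C \<in> A \<Longrightarrow> is_chart C"
  by (simp add: smooth_atlas_def)

lemma atlas_compatible: "smooth_atlas A \<Longrightarrow> C \<in> A \<Longrightarrow> D \<in> A \<Longrightarrow> compatible C D"
  by (simp add: smooth_atlas_def)

lemma carrier_ofE:
  assumes "x \<in> carrier_of A" obtains U \<phi> where "(U, \<phi>) \<in> A" "x \<in> U"
  using assms unfolding carrier_of_def by blast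

lemma chart_subset_carrier: "(U, \<phi>) \<in> A \<Longrightarrow> U \<subseteq> carrier_of A"
  unfolding carrier_of_def by blast

definition cdom :: "('a, 'e) atlas \<Rightarrow> 'a \<Rightarrow> 'a set" where "cdom A x = fst (chart_at A x)"

lemma chart_at:
  assumes "x \<in> carrier_of A"
  shows "(cdom A x, coord A x) \<in> A" "x \<in> cdom A x"
proof -
  obtain U \<phi> where "(U, \<phi>) \<in> A" "x \<in> U" using assms by (rule carrier_ofE)
  then have "\<exists>C. C \<in> A \<and> x \<in> fst C" by (intro exI[of _ "(U, \<phi>)"]) simp
  then have "chart_at A x \<in> A \<and> x \<in> fst (chart_at A x)" unfolding chart_at_def by (rule someI_ex)
  then show "(cdom A x, coord A x) \<in> A" "x \<in> cdom A x" by (simp_all add: cdom_def coord_def)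
qed

lemma param_eq: "param A x = inv_into (cdom A x) (coord A x)"
  by (simp add: param_def cdom_def)

lemma inv_chart: "is_chart (U, \<phi>) \<Longrightarrow> p \<in> U \<Longrightarrow> inv_into U \<phi> (\<phi> p) = p"
  by (simp add: is_chart_def)

lemma cdom_subset: "x \<in> carrier_of A \<Longrightarrow> cdom A x \<subseteq> carrier_of A"
  using chart_at(1) chart_subset_carrier by metis

lemma chart_at_open: "smooth_atlas A \<Longrightarrow> x \<in> carrier_of A \<Longrightarrow> open (coord A x ` cdom A x)"
  using chart_at(1) atlas_chart is_chartD(2) by metis

lemma param_coord: "smooth_atlas A \<Longrightarrow> x \<in> carrier_of A \<Longrightarrow> p \<in> cdom A x \<Longrightarrow> param A x (coord A x p) = p"
  using inv_chart atlas_chart chart_at(1) unfolding param_eq by metis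

lemma coord_param: "\<xi> \<in> coord A x ` cdom A x \<Longrightarrow> coord A x (param A x \<xi>) = \<xi>"
  unfolding param_eq by (rule f_inv_into_f)

lemma param_in: "\<xi> \<in> coord A x ` cdom A x \<Longrightarrow> param A x \<xi> \<in> cdom A x"
  unfolding param_eq by (rule inv_into_into)

lemma topspace_mfd:
  assumes "smooth_manifold A" shows "topspace (mfd_topology A) = carrier_of A"
proof -
  have "openin (mfd_topology A) (carrier_of A)"
    unfolding openin_mfd_topology[OF assms]
  proof (intro conjI ballI, simp, clarify)
    fix U \<phi> assume "(U, \<phi>) \<in> A"
    then have "carrier_of A \<inter> U = U" "open (\<phi> ` U)"
      using chart_subset_carrier assms atlas_chart is_chartD(2) smooth_manifold_atlas by (blast, metis)
    then show "open (\<phi> ` (carrier_of A \<inter> U))" by simp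
  qed
  moreover have "topspace (mfd_topology A) \<subseteq> carrier_of A"
    using openin_mfd_topology[OF assms] openin_topspace by blast
  ultimately show ?thesis using openin_subset by blast
qed

lemma openin_chart_image:
  assumes A: "smooth_manifold A" and c: "(V, \<psi>) \<in> A" and O': "open O'" "O' \<subseteq> \<psi> ` V"
  shows "openin (mfd_topology A) (inv_into V \<psi> ` O')"
  unfolding openin_mfd_topology[OF A]
proof (intro conjI ballI, goal_cases)
  case 1
  have "inv_into V \<psi> ` O' \<subseteq> V" using O' by (auto intro: inv_into_into)
  then show ?case using chart_subset_carrier[OF c] by blast
next
  case (2 D)
  obtain U \<phi> where D: "D = (U, \<phi>)" "(U, \<phi>) \<in> A" using 2 by (cases D) auto
  have comp: "compatible (U, \<phi>) (V, \<psi>)"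
    using A D(2) c smooth_manifold_atlas atlas_compatible by blast
  have ch: "is_chart (U, \<phi>)" "is_chart (V, \<psi>)" using A D(2) c smooth_manifold_atlas atlas_chart by blast+
  have "\<phi> ` (inv_into V \<psi> ` O' \<inter> U) = {\<xi> \<in> \<phi> ` (U \<inter> V). \<psi> (inv_into U \<phi> \<xi>) \<in> O'}"
  proof (intro equalityI subsetI)
    fix \<xi> assume "\<xi> \<in> \<phi> ` (inv_into V \<psi> ` O' \<inter> U)"
    then obtain \<eta> where e: "\<eta> \<in> O'" "inv_into V \<psi> \<eta> \<in> U" "\<xi> = \<phi> (inv_into V \<psi> \<eta>)" by blast
    have "inv_into V \<psi> \<eta> \<in> V" "\<psi> (inv_into V \<psi> \<eta>) = \<eta>"
      using e(1) O'(2) by (auto intro: inv_into_into f_inv_into_f)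
    then show "\<xi> \<in> {\<xi> \<in> \<phi> ` (U \<inter> V). \<psi> (inv_into U \<phi> \<xi>) \<in> O'}"
      using e inv_chart[OF ch(1)] by simp
  next
    fix \<xi> assume "\<xi> \<in> {\<xi> \<in> \<phi> ` (U \<inter> V). \<psi> (inv_into U \<phi> \<xi>) \<in> O'}"
    then obtain p where "p \<in> U" "p \<in> V" "\<xi> = \<phi> p" "\<psi> p \<in> O'" using inv_chart[OF ch(1)] by auto
    then show "\<xi> \<in> \<phi> ` (inv_into V \<psi> ` O' \<inter> U)" using inv_chart[OF ch(2), of p] by (metis IntI imageI)
  qed
  then show ?case using open_vimage_Ck[OF compatibleD(1)[OF comp] compatibleD(2)[OF comp] O'(1)] D by simp
qed

section \<open>Differentials in charts and connectedness\<close>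

lemma differential_inner:
  assumes "differentiable_at A f x"
  shows "differential A f x \<bullet> u = dd u (\<lambda>\<xi>. f (param A x \<xi>)) (coord A x x)"
proof -
  have "linear (\<lambda>v. dd v (\<lambda>\<xi>. f (param A x \<xi>)) (coord A x x))"
    using assms linear_dd unfolding differentiable_at_def by blast
  from linear_basis_sum[OF this, of u] show ?thesis
    unfolding differential_def inner_sum_left inner_scaleR_left dd_def
    by (simp add: inner_commute[of _ u] mult.commute)
qed

text \<open>\<open>differential\<close> at \<open>p\<close> refers to the chart chosen at
  \<open>p\<close>, which changes from point to point. This is the passage to one fixed chart,
  needed for statements about a neighbourhood.\<close>

lemma differentiable_in_chart:
  assumes A: "smooth_atlas A" and c: "(V, \<psi>) \<in> A" "p \<in> V" and f: "differentiable_at A f p"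
  shows "(\<lambda>\<eta>. f (inv_into V \<psi> \<eta>)) differentiable (at (\<psi> p))"
    "dd v (\<lambda>\<eta>. f (inv_into V \<psi> \<eta>)) (\<psi> p) =
      differential A f p \<bullet> dd v (\<lambda>\<eta>. coord A p (inv_into V \<psi> \<eta>)) (\<psi> p)"
proof -
  have p: "p \<in> carrier_of A" using c chart_subset_carrier by blast
  have comp: "compatible (V, \<psi>) (cdom A p, coord A p)" using A c chart_at(1)[OF p] atlas_compatible by blast
  let ?O = "\<psi> ` (V \<inter> cdom A p)" and ?t = "\<lambda>\<eta>. coord A p (inv_into V \<psi> \<eta>)"
  have o: "open ?O" "\<psi> p \<in> ?O" using compatibleD(1)[OF comp] c chart_at(2)[OF p] by auto
  have iv: "inv_into V \<psi> (\<psi> q) = q" if "q \<in> V" for q using inv_chart[OF atlas_chart[OF A c(1)] that] .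
  have t: "?t differentiable (at (\<psi> p))" using compatibleD(2)[OF comp, of 1] o(2) Ck_on_imp_differentiable by fastforce
  have f': "(\<lambda>\<xi>. f (param A p \<xi>)) differentiable (at (?t (\<psi> p)))"
    using f iv[OF c(2)] by (simp add: differentiable_at_def)
  have e: "f (param A p (?t \<eta>)) = f (inv_into V \<psi> \<eta>)" if "\<eta> \<in> ?O" for \<eta>
    using that iv param_coord[OF A p] by auto
  show "(\<lambda>\<eta>. f (inv_into V \<psi> \<eta>)) differentiable (at (\<psi> p))"
    by (rule differentiable_cong_open[OF o e differentiable_compose_at[OF t f']])
  have "dd v (\<lambda>\<eta>. f (inv_into V \<psi> \<eta>)) (\<psi> p) = dd v (\<lambda>\<eta>. f (param A p (?t \<eta>))) (\<psi> p)"
    by (rule dd_cong[OF o]) (use e in auto)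
  also have "\<dots> = dd (dd v ?t (\<psi> p)) (\<lambda>\<xi>. f (param A p \<xi>)) (coord A p p)"
    using dd_compose[OF t f'] iv[OF c(2)] by simp
  finally show "dd v (\<lambda>\<eta>. f (inv_into V \<psi> \<eta>)) (\<psi> p) = differential A f p \<bullet> dd v ?t (\<psi> p)"
    by (simp add: differential_inner[OF f])
qed

text \<open>A coordinate ball is convex, so a vanishing derivative forces a constant on it. Every
  set described by the value of \<open>f\<close> is then open, and connectedness leaves a single
  value.\<close>

lemma differential_zero_constant:
  assumes A: "smooth_manifold A" "connected_space (mfd_topology A)"
    and f: "\<And>p. p \<in> carrier_of A \<Longrightarrow> differentiable_at A f p" "\<And>p. p \<in> carrier_of A \<Longrightarrow> differential A f p = 0"
    and "p \<in> carrier_of A" "q \<in> carrier_of A"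
  shows "f p = f q"
proof -
  note at = smooth_manifold_atlas[OF A(1)]
  have loc: "\<exists>W. openin (mfd_topology A) W \<and> r \<in> W \<and> (\<forall>s\<in>W. f s = f r)" if r: "r \<in> carrier_of A" for r
  proof -
    let ?V = "cdom A r" and ?\<psi> = "coord A r"
    obtain e where e: "e > 0" "ball (?\<psi> r) e \<subseteq> ?\<psi> ` ?V"
      using chart_at_open[OF at r] chart_at(2)[OF r] open_contains_ball by (metis imageI)
    have "((\<lambda>\<eta>. f (inv_into ?V ?\<psi> \<eta>)) has_derivative (\<lambda>h. 0)) (at \<eta> within ball (?\<psi> r) e)" if "\<eta> \<in> ball (?\<psi> r) e" for \<eta>
    proof -
      have "\<eta> \<in> ?\<psi> ` ?V" using e that by blast
      then obtain s where s: "s \<in> ?V" "\<eta> = ?\<psi> s" by blast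
      have sc: "s \<in> carrier_of A" using cdom_subset[OF r] s by blast
      note d = differentiable_in_chart[OF at chart_at(1)[OF r] s(1) f(1)[OF sc]]
      have "((\<lambda>\<eta>. f (inv_into ?V ?\<psi> \<eta>)) has_derivative (\<lambda>h. 0)) (at \<eta>)"
        using has_derivative_dd[OF d(1)] d(2) f(2)[OF sc] s(2) by simp
      then show ?thesis by (rule has_derivative_at_withinI)
    qed
    then obtain c where c: "\<forall>\<eta>\<in>ball (?\<psi> r) e. f (inv_into ?V ?\<psi> \<eta>) = c"
      using has_derivative_zero_constant[OF convex_ball] by metis
    have "f r = c" using c[rule_format, of "?\<psi> r"] e(1) inv_chart[OF atlas_chart[OF at chart_at(1)[OF r]] chart_at(2)[OF r]] by simp
    have "openin (mfd_topology A) (inv_into ?V ?\<psi> ` ball (?\<psi> r) e)"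
      by (rule openin_chart_image[OF A(1) chart_at(1)[OF r] open_ball e(2)])
    moreover have "r \<in> inv_into ?V ?\<psi> ` ball (?\<psi> r) e"
      using e(1) inv_chart[OF atlas_chart[OF at chart_at(1)[OF r]] chart_at(2)[OF r]] by (metis centre_in_ball imageI)
    ultimately show ?thesis using c \<open>f r = c\<close> by blast
  qed
  let ?E = "{r \<in> carrier_of A. f r = f q}" and ?F = "{r \<in> carrier_of A. f r \<noteq> f q}"
  have sub: "W \<subseteq> carrier_of A" if "openin (mfd_topology A) W" for W
    using that openin_mfd_topology[OF A(1)] by blast
  have "openin (mfd_topology A) {r \<in> carrier_of A. P (f r)}" for P
  proof (subst openin_subopen, intro ballI)
    fix r assume "r \<in> {r \<in> carrier_of A. P (f r)}"
    then obtain W where W: "openin (mfd_topology A) W" "r \<in> W" "\<forall>s\<in>W. f s = f r" "P (f r)" using loc by blast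
    have "W \<subseteq> {r \<in> carrier_of A. P (f r)}"
    proof
      fix s assume "s \<in> W"
      then have "f s = f r" "s \<in> carrier_of A" using W(3) sub[OF W(1)] by blast+
      then show "s \<in> {r \<in> carrier_of A. P (f r)}" using W(4) by simp
    qed
    then show "\<exists>T. openin (mfd_topology A) T \<and> r \<in> T \<and> T \<subseteq> {r \<in> carrier_of A. P (f r)}"
      using W by blast
  qed
  from this[of "\<lambda>v. v = f q"] this[of "\<lambda>v. v \<noteq> f q"]
  have "openin (mfd_topology A) ?E" "openin (mfd_topology A) ?F" .
  moreover have "topspace (mfd_topology A) \<subseteq> ?E \<union> ?F" "?E \<inter> ?F = {}" "?E \<noteq> {}"
    using topspace_mfd[OF A(1)] assms by auto
  ultimately have "?F = {}" using A(2) unfolding connected_space_def by blast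
  then show ?thesis using assms(5) by blast
qed

section \<open>Curves\<close>

lemma vector_derivative_eq_dd:
  assumes "f differentiable (at s)" shows "vector_derivative f (at s) = dd 1 f s"
proof (rule vector_derivative_at)
  have "dd t f s = t *\<^sub>R dd 1 f s" for t
    using linear_scale[OF linear_dd[OF assms], of t 1] by (metis mult.right_neutral real_scaleR_def)
  then have "(\<lambda>v. dd v f s) = (\<lambda>t. t *\<^sub>R dd 1 f s)" by blast
  then show "(f has_vector_derivative dd 1 f s) (at s)"
    using has_derivative_dd[OF assms] by (simp add: has_vector_derivative_def)
qed

lemma Ck_curve_chart:
  assumes A: "smooth_atlas A" and c: "(U, \<phi>) \<in> A" and g: "Ck_on k {-\<epsilon><..<\<epsilon>} \<gamma>" "\<gamma> ` {-\<epsilon><..<\<epsilon>} \<subseteq> \<phi> ` U"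
  shows "Ck_curve k A \<epsilon> (\<lambda>s. inv_into U \<phi> (\<gamma> s))"
  unfolding Ck_curve_def
proof (intro conjI ballI, goal_cases)
  case 1
  then show ?case using g(2) chart_subset_carrier[OF c] inv_into_into[of _ \<phi> U] by blast
next
  case (2 D)
  obtain V \<psi> where D: "D = (V, \<psi>)" "(V, \<psi>) \<in> A" using 2 by (cases D) auto
  have comp: "compatible (U, \<phi>) (V, \<psi>)" using A c D atlas_compatible by blast
  have "inv_into U \<phi> (\<gamma> s) \<in> V \<longleftrightarrow> \<gamma> s \<in> \<phi> ` (U \<inter> V)" if "s \<in> {-\<epsilon><..<\<epsilon>}" for s
  proof -
    have "\<gamma> s \<in> \<phi> ` U" using that g(2) by blast
    then obtain q where q: "q \<in> U" "\<gamma> s = \<phi> q" by blast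
    then show ?thesis using inv_chart[OF atlas_chart[OF A c] q(1)]
        inj_on_image_mem_iff[OF is_chartD(1)[OF atlas_chart[OF A c]] q(1) Int_lower1] by simp
  qed
  then have e: "{s \<in> {-\<epsilon><..<\<epsilon>}. inv_into U \<phi> (\<gamma> s) \<in> V} = {s \<in> {-\<epsilon><..<\<epsilon>}. \<gamma> s \<in> \<phi> ` (U \<inter> V)}" by blast
  have o: "open {s \<in> {-\<epsilon><..<\<epsilon>}. \<gamma> s \<in> \<phi> ` (U \<inter> V)}"
    by (rule open_vimage_Ck[OF open_greaterThanLessThan g(1) compatibleD(1)[OF comp]])
  have "Ck_on k {s \<in> {-\<epsilon><..<\<epsilon>}. \<gamma> s \<in> \<phi> ` (U \<inter> V)} (\<lambda>s. \<psi> (inv_into U \<phi> (\<gamma> s)))"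
    by (rule Ck_on_compose[OF o compatibleD(2)[OF comp] Ck_on_subset[OF g(1)]]) auto
  then show ?case using o e D by simp
qed

text \<open>\<open>Ck_curve\<close> tests only the charts of the atlas, while slice charts of
  submanifolds lie in the maximal atlas. A transition map carries the regularity over on a smaller
  parameter set.\<close>

lemma Ck_curve_maximal_chart:
  assumes A: "smooth_atlas A" and c: "(U, \<phi>) \<in> maximal_atlas A" and b: "Ck_curve k A \<epsilon> \<beta>" "0 < \<epsilon>" "\<beta> 0 \<in> U"
  obtains J where "open J" "0 \<in> J" "J \<subseteq> {-\<epsilon><..<\<epsilon>}" "\<beta> ` J \<subseteq> U" "Ck_on k J (\<lambda>s. \<phi> (\<beta> s))"
proof -
  have "\<beta> 0 \<in> carrier_of A" using c b by (auto simp: maximal_atlas_def)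
  then obtain V \<psi> where V: "(V, \<psi>) \<in> A" "\<beta> 0 \<in> V" by (rule carrier_ofE)
  let ?I = "{s \<in> {-\<epsilon><..<\<epsilon>}. \<beta> s \<in> V}"
  have I: "open ?I" "Ck_on k ?I (\<lambda>s. \<psi> (\<beta> s))" using b(1) V(1) by (auto simp: Ck_curve_def)
  have comp: "compatible (U, \<phi>) (V, \<psi>)" using c V by (simp add: maximal_atlas_def)
  have ch: "is_chart (V, \<psi>)" using atlas_chart[OF A V(1)] .
  let ?J = "{s \<in> ?I. \<psi> (\<beta> s) \<in> \<psi> ` (U \<inter> V)}"
  have J: "open ?J" by (rule open_vimage_Ck[OF I compatibleD(3)[OF comp]])
  have U: "\<beta> s \<in> U" if "s \<in> ?J" for s using that is_chartD(1)[OF ch] by (auto dest: inj_onD)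
  have "Ck_on k ?J (\<lambda>s. \<phi> (inv_into V \<psi> (\<psi> (\<beta> s))))"
    by (rule Ck_on_compose[OF J compatibleD(4)[OF comp] Ck_on_subset[OF I(2)]]) auto
  then have "Ck_on k ?J (\<lambda>s. \<phi> (\<beta> s))"
    by (rule Ck_on_cong[OF J, rotated]) (simp add: inv_chart[OF ch])
  moreover have "0 \<in> ?J" using b V by auto
  ultimately show ?thesis using that[of ?J] J U by blast
qed

lemma atlas_maximal: "smooth_atlas A \<Longrightarrow> C \<in> A \<Longrightarrow> C \<in> maximal_atlas A"
  unfolding maximal_atlas_def using atlas_chart atlas_compatible chart_subset_carrier by (cases C) fastforce

lemma velocity_curve:
  assumes A: "smooth_atlas A" and b: "Ck_curve k A \<epsilon> \<beta>" "0 < \<epsilon>" "0 < k"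
  shows "velocity A \<beta> = dd 1 (\<lambda>s. coord A (\<beta> 0) (\<beta> s)) 0" "(\<lambda>s. coord A (\<beta> 0) (\<beta> s)) differentiable (at 0)"
proof -
  have c: "\<beta> 0 \<in> carrier_of A" using b by (auto simp: Ck_curve_def image_subset_iff)
  obtain J where "0 \<in> J" "Ck_on k J (\<lambda>s. coord A (\<beta> 0) (\<beta> s))"
    by (rule Ck_curve_maximal_chart[OF A atlas_maximal[OF A chart_at(1)[OF c]] b(1,2) chart_at(2)[OF c]])
  then show *: "(\<lambda>s. coord A (\<beta> 0) (\<beta> s)) differentiable (at 0)" using b(3) Ck_on_imp_differentiable by blast
  then show "velocity A \<beta> = dd 1 (\<lambda>s. coord A (\<beta> 0) (\<beta> s)) 0"
    unfolding velocity_def by (rule vector_derivative_eq_dd)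
qed

lemma line_in_open:
  fixes x :: "'a::real_normed_vector"
  assumes "open S" "x \<in> S" obtains \<epsilon> where "0 < \<epsilon>" "\<And>s. s \<in> {-\<epsilon><..<\<epsilon>} \<Longrightarrow> x + s *\<^sub>R u \<in> S"
proof -
  have "open ((\<lambda>s. x + s *\<^sub>R u) -` S)"
    by (intro open_vimage assms continuous_intros)
  then obtain e where "0 < e" "ball 0 e \<subseteq> (\<lambda>s. x + s *\<^sub>R u) -` S"
    using assms(2) openE[of _ 0] by (metis (no_types, lifting) add.right_neutral scaleR_zero_left vimage_eq)
  then have "x + s *\<^sub>R u \<in> S" if "s \<in> {-e<..<e}" for s
    using that by (auto simp: subset_eq dist_real_def)
  then show ?thesis using that \<open>0 < e\<close> by blast
qed

lemma Ck_on_line: "Ck_on k S (\<lambda>s::real. x + s *\<^sub>R u)"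
proof -
  have "Ck_on k UNIV (\<lambda>s::real. x + s *\<^sub>R u)"
    by (intro Ck_on_add Ck_on_scaleR Ck_on_const Ck_on_bounded_linear bounded_linear_ident) auto
  then show ?thesis by (rule Ck_on_subset) simp
qed

lemma dd_line_coord [simp]: "dd 1 (\<lambda>s::real. x + s *\<^sub>R u) s = u"
proof -
  have "((\<lambda>s::real. x + s *\<^sub>R u) has_derivative (\<lambda>t. t *\<^sub>R u)) (at s)"
    by (auto intro!: derivative_eq_intros)
  then show ?thesis using dd_eqI by fastforce
qed

lemma coordinate_line:
  assumes A: "smooth_atlas A" and p: "p \<in> carrier_of A"
  obtains \<beta> where "smooth_curve A \<beta>" "\<beta> 0 = p" "velocity A \<beta> = u"
proof -
  obtain \<epsilon> where \<epsilon>: "0 < \<epsilon>" "\<And>s. s \<in> {-\<epsilon><..<\<epsilon>} \<Longrightarrow> coord A p p + s *\<^sub>R u \<in> coord A p ` cdom A p"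
    using line_in_open[OF chart_at_open[OF A p] imageI[OF chart_at(2)[OF p]]] by metis
  define \<beta> where "\<beta> s = inv_into (cdom A p) (coord A p) (coord A p p + s *\<^sub>R u)" for s :: real
  have c: "Ck_curve k A \<epsilon> \<beta>" for k unfolding \<beta>_def
    by (rule Ck_curve_chart[OF A chart_at(1)[OF p] Ck_on_line]) (use \<epsilon> in blast)
  have b0: "\<beta> 0 = p" using param_coord[OF A p chart_at(2)[OF p]] by (simp add: \<beta>_def param_eq)
  have "velocity A \<beta> = dd 1 (\<lambda>s. coord A p (\<beta> s)) 0"
    using velocity_curve(1)[OF A c \<epsilon>(1), of 1] b0 by simp
  also have "\<dots> = dd 1 (\<lambda>s. coord A p p + s *\<^sub>R u) 0"
    by (rule dd_cong[OF open_greaterThanLessThan, of _ "-\<epsilon>" \<epsilon>]) (use \<epsilon> in \<open>auto simp: \<beta>_def f_inv_into_f\<close>)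
  finally have "velocity A \<beta> = u" by simp
  then show ?thesis using that[of \<beta>] c b0 \<epsilon>(1) by (auto simp: smooth_curve_def)
qed

section \<open>Embedded submanifolds\<close>

text \<open>In coordinates the inclusion factors into the transition to slice coordinates of
  \<open>S\<close>, the linear map \<open>j\<close>, and the transition from the slice chart to the
  given chart of \<open>A\<close>; each factor is smooth.\<close>

lemma submanifold_inclusion:
  fixes A :: "('a, 'g::euclidean_space) atlas" and S :: "('a, 'e::euclidean_space) atlas"
  assumes A: "smooth_atlas A" and S: "embedded_submanifold A S" and p: "p \<in> U" "p \<in> V"
    and c: "(U, \<phi>) \<in> A" "(V, \<psi>) \<in> S"
  obtains O' where "open O'" "\<psi> p \<in> O'" "O' \<subseteq> \<psi> ` V" "inv_into V \<psi> ` O' \<subseteq> U"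
    "\<And>k. Ck_on k O' (\<lambda>\<eta>. \<phi> (inv_into V \<psi> \<eta>))"
proof -
  have pS: "p \<in> carrier_of S" using p c chart_subset_carrier by blast
  obtain U' \<phi>' and j :: "'e \<Rightarrow> 'g" where s: "(U', \<phi>') \<in> maximal_atlas A" "p \<in> U'" "linear j" "inj j"
    "\<phi>' ` (U' \<inter> carrier_of S) = \<phi>' ` U' \<inter> range j" "(U' \<inter> carrier_of S, \<lambda>x. inv j (\<phi>' x)) \<in> maximal_atlas S"
    using S pS unfolding embedded_submanifold_def by meson
  let ?\<chi> = "\<lambda>x. inv j (\<phi>' x)" and ?VU = "V \<inter> (U' \<inter> carrier_of S)"
  have "compatible (U' \<inter> carrier_of S, ?\<chi>) (V, \<psi>)"
    using s(6) c(2) by (auto simp: maximal_atlas_def)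
  then have c1: "compatible (V, \<psi>) (U' \<inter> carrier_of S, ?\<chi>)" by (rule compatible_sym)
  have c2: "compatible (U', \<phi>') (U, \<phi>)" using s(1) c(1) by (auto simp: maximal_atlas_def)
  have ch: "is_chart (V, \<psi>)" using atlas_chart[OF smooth_manifold_atlas c(2)] S by (simp add: embedded_submanifold_def)
  have ch': "is_chart (U', \<phi>')" using s(1) by (simp add: maximal_atlas_def)
  have o1: "open (\<psi> ` ?VU)" "Ck_on k (\<psi> ` ?VU) (\<lambda>\<eta>. ?\<chi> (inv_into V \<psi> \<eta>))" for k
    using compatibleD(1,2)[OF c1] by auto
  let ?m = "\<lambda>\<eta>. j (?\<chi> (inv_into V \<psi> \<eta>))"
  have bj: "bounded_linear j" using s(3) by (simp add: linear_conv_bounded_linear)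
  have m: "Ck_on k (\<psi> ` ?VU) ?m" for k by (rule Ck_on_linear_compose[OF o1(1) bj o1(2)])
  let ?O = "{\<eta> \<in> \<psi> ` ?VU. ?m \<eta> \<in> \<phi>' ` (U' \<inter> U)}"
  have o: "open ?O" by (rule open_vimage_Ck[OF o1(1) m compatibleD(1)[OF c2]])
  \<comment> \<open>On \<open>S\<close> the slice coordinates lie in \<open>range j\<close>, so
    \<open>j\<close> undoes \<open>inv j\<close>.\<close>
  have q: "?m (\<psi> q) = \<phi>' q" if "q \<in> ?VU" for q
    using that s(5) inv_chart[OF ch, of q] f_inv_into_f[of "\<phi>' q" j UNIV] by auto
  have O: "q \<in> U' \<inter> U" if "q \<in> ?VU" "\<psi> q \<in> ?O" for q
    using q[OF that(1)] that is_chartD(1)[OF ch'] by (auto dest: inj_onD)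
  have "Ck_on k ?O (\<lambda>\<eta>. \<phi> (inv_into U' \<phi>' (?m \<eta>)))" for k
    by (rule Ck_on_compose[OF o compatibleD(2)[OF c2] Ck_on_subset[OF m]]) auto
  moreover have "\<phi> (inv_into U' \<phi>' (?m \<eta>)) = \<phi> (inv_into V \<psi> \<eta>)" if "\<eta> \<in> ?O" for \<eta>
  proof -
    obtain q' where q': "q' \<in> ?VU" "\<eta> = \<psi> q'" using \<open>\<eta> \<in> ?O\<close> by (elim CollectE conjE imageE)
    then show ?thesis using q[OF q'(1)] inv_chart[OF ch'] inv_chart[OF ch] by simp
  qed
  ultimately have k: "Ck_on k ?O (\<lambda>\<eta>. \<phi> (inv_into V \<psi> \<eta>))" for k
    by (rule Ck_on_cong[OF o, rotated])
  have "p \<in> ?VU" using p s(2) pS by blast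
  then have 1: "\<psi> p \<in> ?O" using q[OF \<open>p \<in> ?VU\<close>] p s(2) by auto
  have 2: "inv_into V \<psi> ` ?O \<subseteq> U"
  proof
    fix r assume "r \<in> inv_into V \<psi> ` ?O"
    then obtain \<eta> where r: "\<eta> \<in> ?O" "r = inv_into V \<psi> \<eta>" by blast
    then obtain q' where q': "q' \<in> ?VU" "\<eta> = \<psi> q'" by (elim CollectE conjE imageE)
    then have "r = q'" using r(2) inv_chart[OF ch, of q'] by simp
    moreover have "\<psi> q' \<in> ?O" using r(1) unfolding q'(2) .
    ultimately show "r \<in> U" using O[OF q'(1)] by simp
  qed
  show ?thesis by (rule that[OF o 1 _ 2 k]) blast
qed

text \<open>Regularity of \<open>c\<close> is assumed for an extension on the larger manifolds.
  Pulled back along the two smooth inclusions, the extension agrees with \<open>c\<close> and gives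
  regularity in the charts of \<open>X\<close> and \<open>Y\<close> themselves.\<close>

lemma Ck_on_product_submanifold:
  assumes M: "smooth_manifold M" "smooth_manifold N"
    and X: "embedded_submanifold M X" and Y: "embedded_submanifold N Y"
    and f: "Ck_on_product k M N (mfd_topology M closure_of carrier_of X) (mfd_topology N closure_of carrier_of Y) c"
    and ch: "(U, \<phi>) \<in> X" "(V, \<psi>) \<in> Y"
  shows "Ck_on k (\<phi> ` U \<times> \<psi> ` V) (\<lambda>p. c (inv_into U \<phi> (fst p)) (inv_into V \<psi> (snd p)))"
proof (rule Ck_on_local)
  fix p assume p: "p \<in> \<phi> ` U \<times> \<psi> ` V"
  have at: "smooth_atlas M" "smooth_atlas N" "smooth_atlas X" "smooth_atlas Y"
    using M X Y smooth_manifold_atlas by (auto simp: embedded_submanifold_def)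
  have cX: "carrier_of X \<subseteq> mfd_topology M closure_of carrier_of X"
    using X topspace_mfd[OF M(1)] by (intro closure_of_subset) (auto simp: embedded_submanifold_def)
  have cY: "carrier_of Y \<subseteq> mfd_topology N closure_of carrier_of Y"
    using Y topspace_mfd[OF M(2)] by (intro closure_of_subset) (auto simp: embedded_submanifold_def)
  obtain W f where W: "(mfd_topology M closure_of carrier_of X) \<times> (mfd_topology N closure_of carrier_of Y) \<subseteq> W"
    and fc: "\<forall>x\<in>mfd_topology M closure_of carrier_of X. \<forall>y\<in>mfd_topology N closure_of carrier_of Y. f x y = c x y"
    and C: "\<forall>(U, \<phi>)\<in>M. \<forall>(V, \<psi>)\<in>N. Ck_on k ((\<lambda>(x, y). (\<phi> x, \<psi> y)) ` (W \<inter> U \<times> V))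
             (\<lambda>(\<xi>, \<eta>). f (inv_into U \<phi> \<xi>) (inv_into V \<psi> \<eta>))"
    using f unfolding Ck_on_product_def by blast
  obtain x y where xy: "x \<in> U" "y \<in> V" "p = (\<phi> x, \<psi> y)" using p by blast
  have "x \<in> carrier_of X" "y \<in> carrier_of Y"
    using xy chart_subset_carrier[OF ch(1)] chart_subset_carrier[OF ch(2)] by blast+
  then have "x \<in> carrier_of M" "y \<in> carrier_of N"
    using X Y unfolding embedded_submanifold_def by blast+
  then obtain U0 \<phi>0 V0 \<psi>0 where c0: "(U0, \<phi>0) \<in> M" "x \<in> U0" "(V0, \<psi>0) \<in> N" "y \<in> V0"
    by (meson carrier_ofE)
  obtain O1 where O1: "open O1" "\<phi> x \<in> O1" "O1 \<subseteq> \<phi> ` U" "inv_into U \<phi> ` O1 \<subseteq> U0"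
    and k1: "\<And>k. Ck_on k O1 (\<lambda>\<eta>. \<phi>0 (inv_into U \<phi> \<eta>))"
    by (rule submanifold_inclusion[OF at(1) X c0(2) xy(1) c0(1) ch(1)]) (rule that)
  obtain O2 where O2: "open O2" "\<psi> y \<in> O2" "O2 \<subseteq> \<psi> ` V" "inv_into V \<psi> ` O2 \<subseteq> V0"
    and k2: "\<And>k. Ck_on k O2 (\<lambda>\<eta>. \<psi>0 (inv_into V \<psi> \<eta>))"
    by (rule submanifold_inclusion[OF at(2) Y c0(4) xy(2) c0(3) ch(2)]) (rule that)
  have o: "open (O1 \<times> O2)" using O1 O2 by (simp add: open_Times)
  let ?F = "\<lambda>(\<xi>, \<eta>). f (inv_into U0 \<phi>0 \<xi>) (inv_into V0 \<psi>0 \<eta>)"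
  let ?g = "\<lambda>p. (\<phi>0 (inv_into U \<phi> (fst p)), \<psi>0 (inv_into V \<psi> (snd p)))"
  have inX: "inv_into U \<phi> \<xi> \<in> carrier_of X" if "\<xi> \<in> O1" for \<xi>
    using that O1(3) inv_into_into[of \<xi> \<phi> U] chart_subset_carrier[OF ch(1)] by blast
  have inY: "inv_into V \<psi> \<eta> \<in> carrier_of Y" if "\<eta> \<in> O2" for \<eta>
    using that O2(3) inv_into_into[of \<eta> \<psi> V] chart_subset_carrier[OF ch(2)] by blast
  have "Ck_on k (O1 \<times> O2) (\<lambda>p. \<phi>0 (inv_into U \<phi> (fst p)))"
    by (rule Ck_on_compose[OF o k1 Ck_on_bounded_linear[OF bounded_linear_fst]]) auto
  moreover have "Ck_on k (O1 \<times> O2) (\<lambda>p. \<psi>0 (inv_into V \<psi> (snd p)))"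
    by (rule Ck_on_compose[OF o k2 Ck_on_bounded_linear[OF bounded_linear_snd]]) auto
  ultimately have g: "Ck_on k (O1 \<times> O2) ?g" by (rule Ck_on_Pair[OF o])
  have F: "Ck_on k ((\<lambda>(x, y). (\<phi>0 x, \<psi>0 y)) ` (W \<inter> U0 \<times> V0)) ?F" using C c0 by blast
  have "?g ` (O1 \<times> O2) \<subseteq> (\<lambda>(x, y). (\<phi>0 x, \<psi>0 y)) ` (W \<inter> U0 \<times> V0)"
  proof
    fix r assume "r \<in> ?g ` (O1 \<times> O2)"
    then obtain \<xi> \<eta> where r: "\<xi> \<in> O1" "\<eta> \<in> O2" "r = ?g (\<xi>, \<eta>)" by blast
    have "(inv_into U \<phi> \<xi>, inv_into V \<psi> \<eta>) \<in> W \<inter> U0 \<times> V0"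
      using inX[OF r(1)] inY[OF r(2)] cX cY W O1(4) O2(4) r by blast
    then show "r \<in> (\<lambda>(x, y). (\<phi>0 x, \<psi>0 y)) ` (W \<inter> U0 \<times> V0)" using r(3) by force
  qed
  from Ck_on_compose[OF o F g this] have "Ck_on k (O1 \<times> O2) (\<lambda>p. ?F (?g p))" .
  then have "Ck_on k (O1 \<times> O2) (\<lambda>p. c (inv_into U \<phi> (fst p)) (inv_into V \<psi> (snd p)))"
  proof (rule Ck_on_cong[OF o, rotated])
    fix q assume "q \<in> O1 \<times> O2"
    then have q: "fst q \<in> O1" "snd q \<in> O2" by auto
    have "inv_into U0 \<phi>0 (\<phi>0 (inv_into U \<phi> (fst q))) = inv_into U \<phi> (fst q)"
      using inv_chart[OF atlas_chart[OF at(1) c0(1)]] O1(4) q by blast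
    moreover have "inv_into V0 \<psi>0 (\<psi>0 (inv_into V \<psi> (snd q))) = inv_into V \<psi> (snd q)"
      using inv_chart[OF atlas_chart[OF at(2) c0(3)]] O2(4) q by blast
    ultimately show "?F (?g q) = c (inv_into U \<phi> (fst q)) (inv_into V \<psi> (snd q))"
      using fc inX[OF q(1)] inY[OF q(2)] cX cY by auto
  qed
  then show "\<exists>T. open T \<and> p \<in> T \<and> Ck_on k (\<phi> ` U \<times> \<psi> ` V \<inter> T) (\<lambda>p. c (inv_into U \<phi> (fst p)) (inv_into V \<psi> (snd p)))"
    using o O1(2) O2(2) xy(3) Ck_on_subset[OF _ Int_lower2] by blast
qed

section \<open>Functions of two variables\<close>

lemma dd_snd:
  assumes "G differentiable (at (\<xi>, \<eta>))"
  shows "(\<lambda>\<eta>. G (\<xi>, \<eta>)) differentiable (at \<eta>)" "dd v (\<lambda>\<eta>. G (\<xi>, \<eta>)) \<eta> = dd (0, v) G (\<xi>, \<eta>)"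
proof -
  have "((\<lambda>\<eta>. (\<xi>, \<eta>)) has_derivative (\<lambda>v. (0, v))) (at \<eta>)"
    by (auto intro!: derivative_eq_intros)
  from has_derivative_compose[OF this has_derivative_dd[OF assms]]
  show "(\<lambda>\<eta>. G (\<xi>, \<eta>)) differentiable (at \<eta>)" "dd v (\<lambda>\<eta>. G (\<xi>, \<eta>)) \<eta> = dd (0, v) G (\<xi>, \<eta>)"
    by (auto simp: differentiable_def dd_eqI)
qed

lemma dd_fst:
  assumes "G differentiable (at (\<xi>, \<eta>))"
  shows "(\<lambda>\<xi>. G (\<xi>, \<eta>)) differentiable (at \<xi>)" "dd u (\<lambda>\<xi>. G (\<xi>, \<eta>)) \<xi> = dd (u, 0) G (\<xi>, \<eta>)"
proof -
  have "((\<lambda>\<xi>. (\<xi>, \<eta>)) has_derivative (\<lambda>v. (v, 0))) (at \<xi>)"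
    by (auto intro!: derivative_eq_intros)
  from has_derivative_compose[OF this has_derivative_dd[OF assms]]
  show "(\<lambda>\<xi>. G (\<xi>, \<eta>)) differentiable (at \<xi>)" "dd u (\<lambda>\<xi>. G (\<xi>, \<eta>)) \<xi> = dd (u, 0) G (\<xi>, \<eta>)"
    by (auto simp: differentiable_def dd_eqI)
qed

lemma Ck_on_snd:
  fixes A :: "'a::euclidean_space set" and B :: "'b::euclidean_space set"
  assumes "Ck_on k (A \<times> B) G" "open B" "\<xi> \<in> A"
  shows "Ck_on k B (\<lambda>\<eta>. G (\<xi>, \<eta>))"
  by (rule Ck_on_compose[OF assms(2,1) Ck_on_Pair[OF assms(2) Ck_on_const Ck_on_bounded_linear[OF bounded_linear_ident]]])
     (use assms(3) in auto)

lemma Ck_on_fst: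
  fixes A :: "'a::euclidean_space set" and B :: "'b::euclidean_space set"
  assumes "Ck_on k (A \<times> B) G" "open A" "\<eta> \<in> B"
  shows "Ck_on k A (\<lambda>\<xi>. G (\<xi>, \<eta>))"
  by (rule Ck_on_compose[OF assms(2,1) Ck_on_Pair[OF assms(2) Ck_on_bounded_linear[OF bounded_linear_ident] Ck_on_const]])
     (use assms(3) in auto)

text \<open>Both functions have the same derivatives at every point, so \<open>deriv\<close> agrees
  as a total function, default values included.\<close>

lemma deriv2_add_const: "(deriv ^^ 2) (\<lambda>t. f t + d) s = (deriv ^^ 2) f s" for d :: real
proof -
  have "((\<lambda>t. f t + d) has_field_derivative D) (at t) \<longleftrightarrow> (f has_field_derivative D) (at t)" for t D
    using DERIV_add[of "\<lambda>t. f t + d" D t UNIV "\<lambda>t. - d" 0] DERIV_add[of f D t UNIV "\<lambda>t. d" 0] by auto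
  then have "deriv (\<lambda>t. f t + d) = deriv f" unfolding deriv_def by presburger
  then show ?thesis by (simp add: numeral_2_eq_2)
qed

lemma differential_eq_constant:
  assumes A: "smooth_manifold A" "connected_space (mfd_topology A)"
    and f: "\<And>p. p \<in> carrier_of A \<Longrightarrow> differentiable_at A f p" "\<And>p. p \<in> carrier_of A \<Longrightarrow> differentiable_at A g p"
      "\<And>p. p \<in> carrier_of A \<Longrightarrow> differential A f p = differential A g p"
    and "p \<in> carrier_of A" "q \<in> carrier_of A"
  shows "f p - g p = f q - g q"
proof (rule differential_zero_constant[OF A _ _ assms(6,7), of "\<lambda>p. f p - g p"])
  fix r assume r: "r \<in> carrier_of A"
  show d: "differentiable_at A (\<lambda>p. f p - g p) r"
    using f(1,2)[OF r] unfolding differentiable_at_def by (rule differentiable_diff)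
  have "differential A (\<lambda>p. f p - g p) r \<bullet> u = 0" for u
    using f[OF r] differential_inner[OF d, of u] differential_inner[OF f(1)[OF r], of u]
      differential_inner[OF f(2)[OF r], of u]
    by (simp add: dd_diff differentiable_at_def)
  from this[of "differential A (\<lambda>p. f p - g p) r"] show "differential A (\<lambda>p. f p - g p) r = 0" by simp
qed

section \<open>The cost in coordinates\<close>

text \<open>The setting freed from the surrounding manifolds: regularity is stated in charts of
  \<open>X\<close> and \<open>Y\<close>, and independence of the level sets in the form that
  equality of \<open>D2\<close> at \<open>y\<^sub>0\<close> spreads to every
  \<open>y\<close>.\<close>

locale cost =
  fixes X :: "('a, 'e::euclidean_space) atlas" and Y :: "('b, 'f::euclidean_space) atlas"
    and c :: "'a \<Rightarrow> 'b \<Rightarrow> real" and y\<^sub>0 :: 'b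
  assumes X: "smooth_atlas X" and Y: "smooth_manifold Y" and Y_connected: "connected_space (mfd_topology Y)"
    and Ck: "\<And>U \<phi> V \<psi>. (U, \<phi>) \<in> X \<Longrightarrow> (V, \<psi>) \<in> Y \<Longrightarrow>
        Ck_on 4 (\<phi> ` U \<times> \<psi> ` V) (\<lambda>p. c (inv_into U \<phi> (fst p)) (inv_into V \<psi> (snd p)))"
    and twist: "\<And>x. x \<in> carrier_of X \<Longrightarrow> inj_on (D1 X c x) (carrier_of Y)"
    and nondegenerate: "\<And>x y. x \<in> carrier_of X \<Longrightarrow> y \<in> carrier_of Y \<Longrightarrow> inj (D12 X Y c x y)"
    and level: "\<And>x x' y. x \<in> carrier_of X \<Longrightarrow> x' \<in> carrier_of X \<Longrightarrow> y \<in> carrier_of Y \<Longrightarrow>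
        D2 Y c x' y\<^sub>0 = D2 Y c x y\<^sub>0 \<Longrightarrow> D2 Y c x' y = D2 Y c x y"
    and y\<^sub>0: "y\<^sub>0 \<in> carrier_of Y"
begin

lemmas Y_atlas = smooth_manifold_atlas[OF Y]

abbreviation XD where "XD x \<equiv> coord X x ` cdom X x"
abbreviation YD where "YD y \<equiv> coord Y y ` cdom Y y"
abbreviation xc where "xc x \<equiv> coord X x x"
abbreviation yc where "yc y \<equiv> coord Y y y"

text \<open>A function of one pair, so that derivatives in either variable are
  \<open>dd (u, 0)\<close> and \<open>dd (0, v)\<close> of the same function and can be exchanged by
  \<open>dd_commute\<close>.\<close>

definition F where "F x y p = c (param X x (fst p)) (param Y y (snd p))"

lemma F_Ck: "x \<in> carrier_of X \<Longrightarrow> y \<in> carrier_of Y \<Longrightarrow> Ck_on 4 (XD x \<times> YD y) (F x y)"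
  unfolding F_def param_eq by (rule Ck[OF chart_at(1) chart_at(1)])

lemma open_XD: "x \<in> carrier_of X \<Longrightarrow> open (XD x)" by (rule chart_at_open[OF X])
lemma open_YD: "y \<in> carrier_of Y \<Longrightarrow> open (YD y)" by (rule chart_at_open[OF Y_atlas])
lemma open_XYD: "x \<in> carrier_of X \<Longrightarrow> y \<in> carrier_of Y \<Longrightarrow> open (XD x \<times> YD y)"
  by (simp add: open_Times open_XD open_YD)
lemma xc: "x \<in> carrier_of X \<Longrightarrow> xc x \<in> XD x" by (simp add: chart_at(2))
lemma yc: "y \<in> carrier_of Y \<Longrightarrow> yc y \<in> YD y" by (simp add: chart_at(2))
lemma param_xc: "x \<in> carrier_of X \<Longrightarrow> param X x (xc x) = x" by (simp add: param_coord[OF X] chart_at(2))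
lemma param_yc: "y \<in> carrier_of Y \<Longrightarrow> param Y y (yc y) = y" by (simp add: param_coord[OF Y_atlas] chart_at(2))
lemma param_X: "x \<in> carrier_of X \<Longrightarrow> \<xi> \<in> XD x \<Longrightarrow> param X x \<xi> \<in> carrier_of X"
  by (rule subsetD[OF cdom_subset param_in])
lemma param_Y: "y \<in> carrier_of Y \<Longrightarrow> \<eta> \<in> YD y \<Longrightarrow> param Y y \<eta> \<in> carrier_of Y"
  by (rule subsetD[OF cdom_subset param_in])

lemma F_diff:
  assumes "x \<in> carrier_of X" "y \<in> carrier_of Y" "p \<in> XD x \<times> YD y"
  shows "F x y differentiable (at p)" "dd u (F x y) differentiable (at p)"
    "dd u (dd v (F x y)) differentiable (at p)"
proof -
  have F: "Ck_on 3 (XD x \<times> YD y) (F x y)" using F_Ck[OF assms(1,2)] by (rule Ck_on_le) simp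
  have F': "Ck_on 2 (XD x \<times> YD y) (dd w (F x y))" for w by (rule Ck_on_dd_less[OF F]) simp
  have F'': "Ck_on 1 (XD x \<times> YD y) (dd u (dd v (F x y)))" by (rule Ck_on_dd_less[OF F']) simp
  show "F x y differentiable (at p)" "dd u (F x y) differentiable (at p)"
    "dd u (dd v (F x y)) differentiable (at p)"
    using Ck_on_imp_differentiable[OF F _ assms(3)] Ck_on_imp_differentiable[OF F' _ assms(3)]
      Ck_on_imp_differentiable[OF F'' _ assms(3)] by simp_all
qed

lemma D1_inner:
  assumes x: "x \<in> carrier_of X" and y: "y \<in> carrier_of Y" and \<eta>: "\<eta> \<in> YD y"
  shows "D1 X c x (param Y y \<eta>) \<bullet> u = dd (u, 0) (F x y) (xc x, \<eta>)"
proof -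
  have d: "F x y differentiable (at (xc x, \<eta>))" using F_diff(1)[OF x y] xc[OF x] \<eta> by blast
  have "differentiable_at X (\<lambda>x'. c x' (param Y y \<eta>)) x"
    using dd_fst(1)[OF d] by (simp add: differentiable_at_def F_def)
  from differential_inner[OF this, of u] dd_fst(2)[OF d, of u]
  show ?thesis by (simp add: D1_def F_def)
qed

lemma c_diff_Y:
  assumes x: "x \<in> carrier_of X" and y: "y \<in> carrier_of Y" and \<xi>: "\<xi> \<in> XD x"
  shows "differentiable_at Y (c (param X x \<xi>)) y" "D2 Y c (param X x \<xi>) y \<bullet> v = dd (0, v) (F x y) (\<xi>, yc y)"
proof -
  have d: "F x y differentiable (at (\<xi>, yc y))" using F_diff(1)[OF x y] yc[OF y] \<xi> by blast
  show da: "differentiable_at Y (c (param X x \<xi>)) y"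
    using dd_snd(1)[OF d] by (simp add: differentiable_at_def F_def)
  from differential_inner[OF this, of v] dd_snd(2)[OF d, of v]
  show "D2 Y c (param X x \<xi>) y \<bullet> v = dd (0, v) (F x y) (\<xi>, yc y)" by (simp add: D2_def F_def)
qed

lemma D1_Ck:
  assumes x: "x \<in> carrier_of X" and y: "y \<in> carrier_of Y"
  shows "Ck_on 3 (YD y) (\<lambda>\<eta>. D1 X c x (param Y y \<eta>))"
proof (rule Ck_on_euclidean[OF open_YD[OF y]])
  fix i :: 'e
  have "Ck_on 3 (XD x \<times> YD y) (dd (i, 0) (F x y))"
    by (rule Ck_on_dd_less[OF F_Ck[OF x y]]) simp
  from Ck_on_snd[OF this open_YD[OF y] xc[OF x]]
  show "Ck_on 3 (YD y) (\<lambda>\<eta>. D1 X c x (param Y y \<eta>) \<bullet> i)"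
    by (rule Ck_on_cong[OF open_YD[OF y], rotated]) (simp add: D1_inner[OF x y])
qed

lemma D1_diff:
  assumes x: "x \<in> carrier_of X" and y: "y \<in> carrier_of Y" and \<eta>: "\<eta> \<in> YD y"
  shows "(\<lambda>\<eta>. D1 X c x (param Y y \<eta>)) differentiable (at \<eta>)"
  using Ck_on_imp_differentiable[OF D1_Ck[OF x y] _ \<eta>] by simp

lemma D12_dd: "D12 X Y c x y v = dd v (\<lambda>\<eta>. D1 X c x (param Y y \<eta>)) (yc y)"
  by (simp add: D12_def dd_def)

lemma D12_linear: "x \<in> carrier_of X \<Longrightarrow> y \<in> carrier_of Y \<Longrightarrow> linear (D12 X Y c x y)"
  using linear_dd[OF D1_diff[OF _ _ yc]] by (simp add: D12_dd[abs_def])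

lemma dd_D1_inner:
  assumes x: "x \<in> carrier_of X" and y: "y \<in> carrier_of Y" and \<eta>: "\<eta> \<in> YD y"
  shows "dd v (\<lambda>\<eta>. D1 X c x (param Y y \<eta>)) \<eta> \<bullet> u = dd (0, v) (dd (u, 0) (F x y)) (xc x, \<eta>)"
proof -
  have "dd v (\<lambda>\<eta>. D1 X c x (param Y y \<eta>)) \<eta> \<bullet> u = dd v (\<lambda>\<eta>. D1 X c x (param Y y \<eta>) \<bullet> u) \<eta>"
    using dd_linear_compose[OF bounded_linear_inner_left[of u] D1_diff[OF assms]] by simp
  also have "\<dots> = dd v (\<lambda>\<eta>. dd (u, 0) (F x y) (xc x, \<eta>)) \<eta>"
    by (rule dd_cong[OF open_YD[OF y] \<eta>]) (simp add: D1_inner[OF x y])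
  also have "\<dots> = dd (0, v) (dd (u, 0) (F x y)) (xc x, \<eta>)"
    using F_diff(2)[OF x y] xc[OF x] \<eta> by (intro dd_snd(2)) blast
  finally show ?thesis .
qed

section \<open>The submersion onto the quotient\<close>

text \<open>The quotient map in the chart at \<open>x\<close>, with the cotangent space at
  \<open>y\<^sub>0\<close> as target; \<open>T x\<close> is its differential at the base
  point.\<close>

definition Q where "Q x \<xi> = D2 Y c (param X x \<xi>) y\<^sub>0"
definition T where "T x u = dd u (Q x) (xc x)"

lemma Q_Ck: assumes x: "x \<in> carrier_of X" shows "Ck_on 3 (XD x) (Q x)"
proof (rule Ck_on_euclidean[OF open_XD[OF x]])
  fix i :: 'f
  have "Ck_on 3 (XD x \<times> YD y\<^sub>0) (dd (0, i) (F x y\<^sub>0))"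
    by (rule Ck_on_dd_less[OF F_Ck[OF x y\<^sub>0]]) simp
  from Ck_on_fst[OF this open_XD[OF x] yc[OF y\<^sub>0]]
  show "Ck_on 3 (XD x) (\<lambda>\<xi>. Q x \<xi> \<bullet> i)"
    by (rule Ck_on_cong[OF open_XD[OF x], rotated]) (simp add: Q_def c_diff_Y(2)[OF x y\<^sub>0])
qed

lemma Q_diff: "x \<in> carrier_of X \<Longrightarrow> \<xi> \<in> XD x \<Longrightarrow> Q x differentiable (at \<xi>)"
  using Ck_on_imp_differentiable[OF Q_Ck] by simp

lemma linear_T: "x \<in> carrier_of X \<Longrightarrow> linear (T x)"
  using linear_dd[OF Q_diff[OF _ xc]] by (simp add: T_def[abs_def])

text \<open>Symmetry of mixed second derivatives: \<open>T x\<close> differentiates first in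
  \<open>y\<close> and then in \<open>x\<close>, \<open>D12\<close> in the opposite order. The two
  linear maps are thus adjoint.\<close>

lemma T_inner:
  assumes x: "x \<in> carrier_of X" shows "T x u \<bullet> v = u \<bullet> D12 X Y c x y\<^sub>0 v"
proof -
  have "T x u \<bullet> v = dd u (\<lambda>\<xi>. Q x \<xi> \<bullet> v) (xc x)"
    using dd_linear_compose[OF bounded_linear_inner_left[of v] Q_diff[OF x xc[OF x]]] by (simp add: T_def)
  also have "\<dots> = dd u (\<lambda>\<xi>. dd (0, v) (F x y\<^sub>0) (\<xi>, yc y\<^sub>0)) (xc x)"
    by (rule dd_cong[OF open_XD[OF x] xc[OF x]]) (simp add: Q_def c_diff_Y(2)[OF x y\<^sub>0])
  also have "\<dots> = dd (u, 0) (dd (0, v) (F x y\<^sub>0)) (xc x, yc y\<^sub>0)"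
    using F_diff(2)[OF x y\<^sub>0] xc[OF x] yc[OF y\<^sub>0] by (intro dd_fst(2)) blast
  also have "\<dots> = dd (0, v) (dd (u, 0) (F x y\<^sub>0)) (xc x, yc y\<^sub>0)"
    using xc[OF x] yc[OF y\<^sub>0] Ck_on_le[OF F_Ck[OF x y\<^sub>0], of 2]
    by (intro dd_commute[OF open_XYD[OF x y\<^sub>0]]) auto
  also have "\<dots> = D12 X Y c x y\<^sub>0 v \<bullet> u"
    by (simp add: D12_dd dd_D1_inner[OF x y\<^sub>0 yc[OF y\<^sub>0]])
  finally show ?thesis by (simp add: inner_commute)
qed

text \<open>The adjoint of an injective map is onto. This is how non-degeneracy at
  \<open>y\<^sub>0\<close> makes the quotient map a submersion.\<close>

lemma surj_T: assumes x: "x \<in> carrier_of X" shows "surj (T x)"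
proof -
  have "adjoint (D12 X Y c x y\<^sub>0) = T x"
    using T_inner[OF x] by (intro adjoint_unique allI) (metis inner_commute)
  then show ?thesis
    using surj_adjoint_iff_inj[OF D12_linear[OF x y\<^sub>0]] nondegenerate[OF x y\<^sub>0] by simp
qed

text \<open>A linear splitting of \<open>T x\<close> with three uses: it is the derivative of a
  section of the quotient map, its adjoint restricts covectors to a complement of the kernel, and
  its range gives the directions of a transverse surface.\<close>

definition R where "R x = (SOME R. linear R \<and> (\<forall>v. T x (R v) = v))"

lemma R: assumes x: "x \<in> carrier_of X" shows "linear (R x)" "T x (R x v) = v"
proof -
  have "\<exists>R. linear R \<and> T x \<circ> R = id"
    using linear_surjective_right_inverse[OF linear_T[OF x] surj_T[OF x]] .
  then have "\<exists>R. linear R \<and> (\<forall>v. T x (R v) = v)" by (metis comp_apply id_apply)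
  from someI_ex[OF this] show "linear (R x)" "T x (R x v) = v" unfolding R_def by blast+
qed

lemma straightening:
  assumes x: "x \<in> carrier_of X"
  obtains W \<Psi> where "open W" "xc x \<in> W" "\<Psi> ` W \<subseteq> XD x" "Ck_on 2 W \<Psi>" "\<Psi> (xc x) = xc x"
    "\<And>v. dd v \<Psi> (xc x) = v" "\<And>\<theta>. \<theta> \<in> W \<Longrightarrow> Q x (\<Psi> \<theta>) = Q x (xc x) + T x (\<theta> - xc x)"
  by (rule submersion_normal_form[OF open_XD[OF x] xc[OF x] Q_Ck[OF x] R(1)[OF x] R(2)[OF x, unfolded T_def]])
     (rule that, assumption+, simp add: T_def)

text \<open>Restrict the straightening map to the affine space through \<open>xc x\<close> in the
  directions of \<open>R x\<close>. There the straightened quotient map is the identity, because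
  \<open>T x\<close> undoes \<open>R x\<close>.\<close>

lemma section_of_Q:
  assumes x: "x \<in> carrier_of X"
  obtains V \<sigma> where "open V" "Q x (xc x) \<in> V" "\<sigma> ` V \<subseteq> XD x" "Ck_on 2 V \<sigma>" "\<sigma> (Q x (xc x)) = xc x"
    "\<And>v. dd v \<sigma> (Q x (xc x)) = R x v" "\<And>\<zeta>. \<zeta> \<in> V \<Longrightarrow> Q x (\<sigma> \<zeta>) = \<zeta>"
proof -
  obtain W \<Psi> where W: "open W" "xc x \<in> W" "\<Psi> ` W \<subseteq> XD x" "Ck_on 2 W \<Psi>" "\<Psi> (xc x) = xc x"
    "\<And>v. dd v \<Psi> (xc x) = v" "\<And>\<theta>. \<theta> \<in> W \<Longrightarrow> Q x (\<Psi> \<theta>) = Q x (xc x) + T x (\<theta> - xc x)"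
    by (rule straightening[OF x]) (rule that)
  let ?l = "\<lambda>\<zeta>. xc x + R x (\<zeta> - Q x (xc x))"
  let ?V = "{\<zeta> \<in> UNIV. ?l \<zeta> \<in> W}"
  have bR: "bounded_linear (R x)" using R(1)[OF x] by (simp add: linear_conv_bounded_linear)
  have l: "Ck_on k UNIV ?l" for k
    by (intro Ck_on_add Ck_on_linear_compose[OF open_UNIV bR] Ck_on_diff Ck_on_const Ck_on_id open_UNIV)
  have V: "open ?V" by (rule open_vimage_Ck[OF open_UNIV l W(1)])
  have z: "?l (Q x (xc x)) = xc x" using linear_0[OF R(1)[OF x]] by simp
  have "Ck_on 2 ?V (\<lambda>\<zeta>. \<Psi> (?l \<zeta>))"
    by (rule Ck_on_compose[OF V W(4) Ck_on_subset[OF l]]) auto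
  moreover have "dd v (\<lambda>\<zeta>. \<Psi> (?l \<zeta>)) (Q x (xc x)) = R x v" for v
  proof -
    have 1: "(?l has_derivative (\<lambda>v. 0 + R x (v - 0))) (at (Q x (xc x)))"
      by (intro has_derivative_add has_derivative_const bounded_linear.has_derivative[OF bR]
          has_derivative_diff has_derivative_ident)
    have "\<Psi> differentiable (at (?l (Q x (xc x))))"
      unfolding z using Ck_on_imp_differentiable[OF W(4) _ W(2)] by simp
    then have "dd v (\<lambda>\<zeta>. \<Psi> (?l \<zeta>)) (Q x (xc x)) = dd (dd v ?l (Q x (xc x))) \<Psi> (?l (Q x (xc x)))"
      using 1 by (intro dd_compose) (auto simp: differentiable_def)
    then show ?thesis using dd_eqI[OF 1, of v] W(6) z by simp
  qed
  moreover have "Q x (\<Psi> (?l \<zeta>)) = \<zeta>" if "\<zeta> \<in> ?V" for \<zeta>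
    using W(7)[of "?l \<zeta>"] R(2)[OF x] that by simp
  moreover have "Q x (xc x) \<in> ?V" using z W(2) by simp
  moreover have "(\<lambda>\<zeta>. \<Psi> (?l \<zeta>)) ` ?V \<subseteq> XD x" using W(3) by blast
  ultimately show ?thesis using that[OF V, of "\<lambda>\<zeta>. \<Psi> (?l \<zeta>)"] z W(5) by simp
qed

section \<open>Covectors and the kernel of the quotient differential\<close>

lemma c_differentiable_Y: "x \<in> carrier_of X \<Longrightarrow> y \<in> carrier_of Y \<Longrightarrow> differentiable_at Y (c x) y"
  using c_diff_Y(1)[OF _ _ xc] param_xc by metis

lemma level_difference:
  assumes "x \<in> carrier_of X" "x' \<in> carrier_of X" "D2 Y c x' y\<^sub>0 = D2 Y c x y\<^sub>0" "y \<in> carrier_of Y"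
  shows "c x' y = c x y + (c x' y\<^sub>0 - c x y\<^sub>0)"
proof -
  have "c x' y - c x y = c x' y\<^sub>0 - c x y\<^sub>0"
    using level[OF assms(1,2) _ assms(3)] c_differentiable_Y[OF assms(1)] c_differentiable_Y[OF assms(2)]
    by (intro differential_eq_constant[OF Y Y_connected _ _ _ assms(4) y\<^sub>0]) (auto simp: D2_def)
  then show ?thesis by simp
qed

lemma Q_level:
  assumes "x \<in> carrier_of X" "\<xi> \<in> XD x" "\<xi>' \<in> XD x" "Q x \<xi>' = Q x \<xi>" "y \<in> carrier_of Y"
  shows "c (param X x \<xi>') y = c (param X x \<xi>) y + (c (param X x \<xi>') y\<^sub>0 - c (param X x \<xi>) y\<^sub>0)"
  using level_difference[OF param_X[OF assms(1,2)] param_X[OF assms(1,3)] _ assms(5)] assms(4)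
  by (simp add: Q_def)

lemma param_diff_X:
  assumes x: "x \<in> carrier_of X" and y: "y \<in> carrier_of Y" and \<xi>: "\<xi> \<in> XD x"
  shows "(\<lambda>\<xi>. c (param X x \<xi>) y) differentiable (at \<xi>)"
proof -
  have "F x y differentiable (at (\<xi>, yc y))" using F_diff(1)[OF x y] \<xi> yc[OF y] by blast
  from dd_fst(1)[OF this] show ?thesis by (simp add: F_def param_yc[OF y])
qed

lemma D1_dd:
  assumes x: "x \<in> carrier_of X" and y: "y \<in> carrier_of Y"
  shows "D1 X c x y \<bullet> u = dd u (\<lambda>\<xi>. c (param X x \<xi>) y) (xc x)"
  unfolding D1_def using param_diff_X[OF x y xc[OF x]]
  by (intro differential_inner) (simp add: differentiable_at_def)

text \<open>The straightened line in direction \<open>k\<close> stays in one level set. Along it the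
  costs at \<open>y\<close> and at \<open>y\<^sub>0\<close> differ by a constant, so they have the
  same derivative.\<close>

lemma D1_kernel:
  assumes x: "x \<in> carrier_of X" and y: "y \<in> carrier_of Y" and k: "T x k = 0"
  shows "D1 X c x y \<bullet> k = D1 X c x y\<^sub>0 \<bullet> k"
proof -
  obtain W \<Psi> where W: "open W" "xc x \<in> W" "\<Psi> ` W \<subseteq> XD x" "Ck_on 2 W \<Psi>" "\<Psi> (xc x) = xc x"
    "\<And>v. dd v \<Psi> (xc x) = v" "\<And>\<theta>. \<theta> \<in> W \<Longrightarrow> Q x (\<Psi> \<theta>) = Q x (xc x) + T x (\<theta> - xc x)"
    by (rule straightening[OF x]) (rule that)
  obtain \<epsilon> where \<epsilon>: "0 < \<epsilon>" "\<And>s. s \<in> {-\<epsilon><..<\<epsilon>} \<Longrightarrow> xc x + s *\<^sub>R k \<in> W"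
    by (rule line_in_open[OF W(1,2)]) (rule that)
  let ?h = "\<lambda>\<xi>. c (param X x \<xi>) y - c (param X x \<xi>) y\<^sub>0"
  have dP: "\<Psi> differentiable (at (xc x))" using Ck_on_imp_differentiable[OF W(4) _ W(2)] by simp
  have dh: "?h differentiable (at (\<Psi> (xc x)))"
    unfolding W(5) by (intro differentiable_diff param_diff_X x y y\<^sub>0 xc)
  have hc: "?h (\<Psi> (xc x + s *\<^sub>R k)) = ?h (xc x)" if "s \<in> {-\<epsilon><..<\<epsilon>}" for s
  proof -
    have "Q x (\<Psi> (xc x + s *\<^sub>R k)) = Q x (xc x)"
      using W(7)[OF \<epsilon>(2)[OF that]] linear_scale[OF linear_T[OF x], of s k] k by simp
    then show ?thesis using Q_level[OF x xc[OF x] _ _ y] W(3) \<epsilon>(2)[OF that] by fastforce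
  qed
  have "((\<lambda>s. ?h (\<Psi> (xc x + s *\<^sub>R k))) has_vector_derivative 0) (at 0)"
  proof (rule has_vector_derivative_transform_within_open)
    show "((\<lambda>s. ?h (xc x)) has_vector_derivative 0) (at 0)" by (rule has_vector_derivative_const)
    show "open {-\<epsilon><..<\<epsilon>}" "0 \<in> {-\<epsilon><..<\<epsilon>}" using \<epsilon>(1) by auto
  qed (rule hc[symmetric])
  from dd_line_eqI[OF differentiable_compose_at[OF dP dh] this]
  have "dd k (\<lambda>\<theta>. ?h (\<Psi> \<theta>)) (xc x) = 0" .
  then have "dd k ?h (xc x) = 0" using dd_compose[OF dP dh] W(5,6) by simp
  then show ?thesis
    using dd_diff[OF param_diff_X[OF x y xc[OF x]] param_diff_X[OF x y\<^sub>0 xc[OF x]], of k]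
    by (simp add: D1_dd[OF x y] D1_dd[OF x y\<^sub>0])
qed

text \<open>This differentiates \<open>D1_kernel\<close> in \<open>y\<close>, whose right-hand side
  is constant in \<open>y\<close>.\<close>

lemma D12_kernel:
  assumes x: "x \<in> carrier_of X" and y: "y \<in> carrier_of Y" and k: "T x k = 0"
  shows "D12 X Y c x y v \<bullet> k = 0"
proof -
  have "D12 X Y c x y v \<bullet> k = dd v (\<lambda>\<eta>. D1 X c x (param Y y \<eta>) \<bullet> k) (yc y)"
    using dd_linear_compose[OF bounded_linear_inner_left[of k] D1_diff[OF x y yc[OF y]]] by (simp add: D12_dd)
  also have "\<dots> = dd v (\<lambda>\<eta>. D1 X c x y\<^sub>0 \<bullet> k) (yc y)"
    by (rule dd_cong[OF open_YD[OF y] yc[OF y]]) (rule D1_kernel[OF x param_Y[OF y] k])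
  finally show ?thesis by simp
qed

text \<open>Consequently the orthogonality in (A3W) sees \<open>u\<close> only through
  \<open>T x u\<close>, the datum that vectors on different manifolds can share.\<close>

lemma T_kernel_inner:
  assumes x: "x \<in> carrier_of X" and y: "y \<in> carrier_of Y" and "T x u = T x u'"
  shows "D12 X Y c x y v \<bullet> u = D12 X Y c x y v \<bullet> u'"
  using D12_kernel[OF x y, of "u - u'" v] linear_diff[OF linear_T[OF x], of u u'] assms(3)
  by (simp add: inner_diff_right)

text \<open>All covectors that occur differ by elements of the annihilator of the kernel of \<open>T x\<close>.\<close>

lemma covector_eqI:
  assumes x: "x \<in> carrier_of X" and y: "y \<in> carrier_of Y" "y' \<in> carrier_of Y" "y'' \<in> carrier_of Y"
    and I: "\<And>e. \<exists>u. T x (I u) = e"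
    and eq: "\<And>u. D1 X c x y' \<bullet> I u = (D1 X c x y'' + t *\<^sub>R D12 X Y c x y v) \<bullet> I u"
  shows "D1 X c x y' = D1 X c x y'' + t *\<^sub>R D12 X Y c x y v"
proof -
  define r where "r = D1 X c x y' - (D1 X c x y'' + t *\<^sub>R D12 X Y c x y v)"
  have "r \<bullet> e = 0" for e
  proof -
    obtain u where u: "T x (I u) = T x e" using I by blast
    then have "T x (e - I u) = 0" using linear_diff[OF linear_T[OF x]] by simp
    then have "r \<bullet> (e - I u) = 0"
      using D1_kernel[OF x y(2)] D1_kernel[OF x y(3)] D12_kernel[OF x y(1)]
      by (simp add: r_def inner_diff_left inner_add_left)
    moreover have "r \<bullet> I u = 0" using eq[of u] by (simp add: r_def inner_diff_left)
    ultimately show ?thesis by (simp add: inner_diff_right)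
  qed
  from this[of r] show ?thesis by (simp add: r_def)
qed

section \<open>The curvature as a quadratic form\<close>

text \<open>The target of \<open>D1 X c x\<close> has the dimension of \<open>X\<close>, so the
  inverse function theorem is applied after \<open>J\<close>, the adjoint of \<open>R x\<close>,
  which restricts covectors to the range of \<open>R x\<close> and equalises the dimensions. The
  components lost by \<open>J\<close> are recovered with \<open>covector_eqI\<close>. The result
  also shows that the covector line stays in the image of \<open>D1 X c x\<close> for small
  \<open>t\<close>.\<close>

lemma y_curve:
  assumes x: "x \<in> carrier_of X" and y: "y \<in> carrier_of Y"
  obtains \<delta> \<eta> where "0 < \<delta>" "Ck_on 2 {-\<delta><..<\<delta>} \<eta>" "\<eta> 0 = yc y" "\<And>t. t \<in> {-\<delta><..<\<delta>} \<Longrightarrow> \<eta> t \<in> YD y"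
    "\<And>t. t \<in> {-\<delta><..<\<delta>} \<Longrightarrow> D1 X c x (param Y y (\<eta> t)) = D1 X c x y + t *\<^sub>R D12 X Y c x y v"
proof -
  define J where "J = adjoint (R x)"
  have J: "J w \<bullet> k = w \<bullet> R x k" for w k
    using adjoint_works[OF R(1)[OF x], of k w] by (simp add: J_def inner_commute)
  have lJ: "linear J" unfolding J_def by (rule adjoint_linear[OF R(1)[OF x]])
  then have bJ: "bounded_linear J" by (simp add: linear_conv_bounded_linear)
  let ?K = "\<lambda>\<eta>. J (D1 X c x (param Y y \<eta>))"
  have K: "Ck_on 3 (YD y) ?K" by (rule Ck_on_linear_compose[OF open_YD[OF y] bJ D1_Ck[OF x y]])
  have dK: "dd w ?K (yc y) = J (D12 X Y c x y w)" for w
    using dd_linear_compose[OF bJ D1_diff[OF x y yc[OF y]]] by (simp add: D12_dd)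
  \<comment> \<open>A value of \<open>D12\<close> vanishes on the kernel of \<open>T x\<close>, so
    it is zero as soon as \<open>J\<close> kills it; then non-degeneracy applies.\<close>
  have "w = 0" if "J (D12 X Y c x y w) = 0" for w
  proof -
    have "D12 X Y c x y w \<bullet> u = 0" for u
      using T_kernel_inner[OF x y, of u "R x (T x u)" w] R(2)[OF x] J[of "D12 X Y c x y w" "T x u"] that by simp
    from this[of "D12 X Y c x y w"] have "D12 X Y c x y w = D12 X Y c x y 0"
      using linear_0[OF D12_linear[OF x y]] by simp
    then show ?thesis using nondegenerate[OF x y] by (auto dest: injD)
  qed
  then have "inj (\<lambda>w. dd w ?K (yc y))"
    using linear_injective_0[OF linear_compose[OF D12_linear[OF x y] lJ]] by (simp add: dK o_def)
  then obtain U V L where U: "open U" "yc y \<in> U" "U \<subseteq> YD y" "open V" "?K ` U = V" "L ` V = U"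
    "\<And>\<eta>. \<eta> \<in> U \<Longrightarrow> L (?K \<eta>) = \<eta>" "\<And>p. p \<in> V \<Longrightarrow> ?K (L p) = p" "Ck_on 2 V L"
    by (rule inverse_function_Ck[OF open_YD[OF y] yc[OF y] K]) (rule that)
  let ?l = "\<lambda>t::real. ?K (yc y) + t *\<^sub>R J (D12 X Y c x y v)"
  have "?K (yc y) \<in> V" using U(2,5) by blast
  then obtain \<delta> where \<delta>: "0 < \<delta>" "\<And>t. t \<in> {-\<delta><..<\<delta>} \<Longrightarrow> ?l t \<in> V"
    by (rule line_in_open[OF U(4)]) (rule that)
  have "Ck_on 2 {-\<delta><..<\<delta>} (\<lambda>t. L (?l t))"
    by (rule Ck_on_compose[OF open_greaterThanLessThan U(9) Ck_on_line]) (use \<delta> in blast)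
  moreover have "L (?l 0) = yc y" using U(2) U(7)[of "yc y"] by simp
  moreover have inD: "L (?l t) \<in> YD y" if "t \<in> {-\<delta><..<\<delta>}" for t
    using \<delta>(2)[OF that] U(3,6) by blast
  moreover have "D1 X c x (param Y y (L (?l t))) = D1 X c x y + t *\<^sub>R D12 X Y c x y v" if "t \<in> {-\<delta><..<\<delta>}" for t
  proof (rule covector_eqI[OF x y param_Y[OF y inD[OF that]] y, where I = "R x"])
    show "\<exists>u. T x (R x u) = e" for e using R(2)[OF x] by blast
    have "?K (L (?l t)) = J (D1 X c x y) + t *\<^sub>R J (D12 X Y c x y v)"
      using U(8)[OF \<delta>(2)[OF that]] param_yc[OF y] by simp
    then show "D1 X c x (param Y y (L (?l t))) \<bullet> R x u = (D1 X c x y + t *\<^sub>R D12 X Y c x y v) \<bullet> R x u" for u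
      using J by (metis inner_add_left inner_scaleR_left)
  qed
  ultimately show ?thesis using that[of \<delta> "\<lambda>t. L (?l t)"] \<delta>(1) by blast
qed

definition g where
  "g x y v \<xi> = (deriv ^^ 2) (\<lambda>t. c (param X x \<xi>) (c_exp X Y c x (D1 X c x y + t *\<^sub>R D12 X Y c x y v))) 0"

lemma c_exp_eq:
  assumes "x \<in> carrier_of X" "y' \<in> carrier_of Y" "D1 X c x y' = p" shows "c_exp X Y c x p = y'"
  unfolding c_exp_def using inv_into_f_eq[OF twist[OF assms(1)] assms(2,3)] .

text \<open>The curve \<open>\<eta>\<close> does not move with \<open>\<xi>\<close>, so the chain
  rule turns \<open>g\<close> into derivatives of \<open>F\<close> in the fixed directions
  \<open>h\<close> and \<open>k\<close>, of order at most two in \<open>y\<close>. Two of the four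
  derivatives of \<open>c\<close> are left for \<open>\<xi>\<close>.\<close>

lemma g_Ck:
  assumes x: "x \<in> carrier_of X" and y: "y \<in> carrier_of Y"
  shows "Ck_on 2 (XD x) (g x y v)" and "dd u (g x y v) (xc x) = 0"
proof -
  obtain \<delta> \<eta> where e: "0 < \<delta>" "Ck_on 2 {-\<delta><..<\<delta>} \<eta>" "\<eta> 0 = yc y" "\<And>t. t \<in> {-\<delta><..<\<delta>} \<Longrightarrow> \<eta> t \<in> YD y"
    "\<And>t. t \<in> {-\<delta><..<\<delta>} \<Longrightarrow> D1 X c x (param Y y (\<eta> t)) = D1 X c x y + t *\<^sub>R D12 X Y c x y v"
    by (rule y_curve[OF x y]) (rule that)
  let ?F = "F x y" and ?O = "XD x \<times> YD y" and ?I = "{-\<delta><..<\<delta>}"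
  define h where "h = dd 1 \<eta> 0"
  define k where "k = dd 1 (dd 1 \<eta>) 0"
  have oI: "open ?I" "0 \<in> ?I" using e(1) by auto
  have d\<eta>: "\<eta> differentiable (at t)" "dd 1 \<eta> differentiable (at t)" if "t \<in> ?I" for t
    using e(2) that by (auto simp: Ck_on_Suc numeral_2_eq_2)
  have pr: "Ck_on 2 ?I (\<lambda>t. (\<xi>, \<eta> t))" for \<xi> :: 'e
    by (rule Ck_on_Pair[OF oI(1) Ck_on_const e(2)])
  have dpair: "dd 1 (\<lambda>t. (\<xi>, \<gamma> t)) t = (0, dd 1 \<gamma> t)" if "\<gamma> differentiable (at t)" for \<xi> :: 'e and \<gamma> :: "real \<Rightarrow> 'f" and t
    by (rule dd_eqI) (intro has_derivative_Pair has_derivative_const has_derivative_dd that)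
  have d1: "dd 1 (\<lambda>t. (\<xi>, \<eta> t)) 0 = (0, h)" for \<xi> :: 'e
    using dpair[OF d\<eta>(1)[OF oI(2)]] by (simp add: h_def)
  have d2: "dd 1 (dd 1 (\<lambda>t. (\<xi>, \<eta> t))) 0 = (0, k)" for \<xi> :: 'e
  proof -
    have "dd 1 (dd 1 (\<lambda>t. (\<xi>, \<eta> t))) 0 = dd 1 (\<lambda>t. (0::'e, dd 1 \<eta> t)) 0"
      by (rule dd_cong[OF oI]) (rule dpair[OF d\<eta>(1)])
    then show ?thesis using dpair[OF d\<eta>(2)[OF oI(2)]] by (simp add: k_def)
  qed
  have curve: "(deriv ^^ 2) (\<lambda>t. f (\<xi>, \<eta> t)) 0 = dd (0, h) (dd (0, h) f) (\<xi>, yc y) + dd (0, k) f (\<xi>, yc y)"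
    if "\<xi> \<in> XD x" "Ck_on 2 ?O f" for \<xi> f
  proof -
    have "(\<lambda>t. (\<xi>, \<eta> t)) ` ?I \<subseteq> ?O" using e(4) that(1) by blast
    from deriv2_compose_curve[OF open_XYD[OF x y] that(2) oI pr this]
    show ?thesis by (simp add: d1 d2 e(3))
  qed
  let ?G = "\<lambda>p. dd (0, h) (dd (0, h) ?F) p + dd (0, k) ?F p"
  have F4: "Ck_on 4 ?O ?F" by (rule F_Ck[OF x y])
  have F3: "Ck_on 3 ?O (dd w ?F)" for w by (rule Ck_on_dd_less[OF F4]) simp
  have F2: "Ck_on 2 ?O (dd w' (dd w ?F))" for w w' by (rule Ck_on_dd_less[OF F3]) simp
  have G: "Ck_on 2 ?O ?G"
    by (intro Ck_on_add open_XYD[OF x y] F2 Ck_on_le[OF F3]) simp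
  have g: "g x y v \<xi> = ?G (\<xi>, yc y)" if "\<xi> \<in> XD x" for \<xi>
  proof -
    have "g x y v \<xi> = (deriv ^^ 2) (\<lambda>t. ?F (\<xi>, \<eta> t)) 0"
      unfolding g_def
      by (rule deriv2_cong[OF oI]) (simp only: F_def fst_conv snd_conv c_exp_eq[OF x param_Y[OF y e(4)] e(5)])
    then show ?thesis using curve[OF that Ck_on_le[OF F4]] by simp
  qed
  show "Ck_on 2 (XD x) (g x y v)"
    by (rule Ck_on_cong[OF open_XD[OF x] _ Ck_on_fst[OF G open_XD[OF x] yc[OF y]]]) (simp add: g)
  have pt: "(xc x, yc y) \<in> ?O" using xc[OF x] yc[OF y] by blast
  have dif: "dd w (dd w' ?F) differentiable (at (xc x, yc y))" "dd w ?F differentiable (at (xc x, yc y))" for w w'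
    using F_diff[OF x y pt] by blast+
  have "dd u (g x y v) (xc x) = dd u (\<lambda>\<xi>. ?G (\<xi>, yc y)) (xc x)"
    by (rule dd_cong[OF open_XD[OF x] xc[OF x] g])
  also have "\<dots> = dd (u, 0) ?G (xc x, yc y)"
    by (rule dd_fst(2)) (intro differentiable_add dif)
  also have "\<dots> = dd (u, 0) (dd (0, h) (dd (0, h) ?F)) (xc x, yc y) + dd (u, 0) (dd (0, k) ?F) (xc x, yc y)"
    by (rule dd_add[OF dif])
  \<comment> \<open>The derivative along \<open>u\<close> is moved innermost past all
    \<open>y\<close>-derivatives. The result is the same chain rule read backwards for
    \<open>dd (u, 0) ?F\<close>, that is, for the pairing of \<open>D1\<close> with \<open>u\<close>
    along \<open>\<eta>\<close>, which is affine in \<open>t\<close>.\<close>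
  also have "dd (u, 0) (dd (0, k) ?F) (xc x, yc y) = dd (0, k) (dd (u, 0) ?F) (xc x, yc y)"
    by (rule dd_commute[OF open_XYD[OF x y] Ck_on_le[OF F4] pt]) simp
  also have "dd (u, 0) (dd (0, h) (dd (0, h) ?F)) (xc x, yc y) = dd (0, h) (dd (u, 0) (dd (0, h) ?F)) (xc x, yc y)"
    by (rule dd_commute[OF open_XYD[OF x y] Ck_on_le[OF F3] pt]) simp
  also have "\<dots> = dd (0, h) (dd (0, h) (dd (u, 0) ?F)) (xc x, yc y)"
    by (rule dd_cong[OF open_XYD[OF x y] pt], rule dd_commute[OF open_XYD[OF x y] Ck_on_le[OF F4]]) auto
  also have "\<dots> + dd (0, k) (dd (u, 0) ?F) (xc x, yc y) = (deriv ^^ 2) (\<lambda>t. dd (u, 0) ?F (xc x, \<eta> t)) 0"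
    using curve[OF xc[OF x] Ck_on_le[OF F3]] by simp
  also have "\<dots> = (deriv ^^ 2) (\<lambda>t. D1 X c x y \<bullet> u + t *\<^sub>R (D12 X Y c x y v \<bullet> u)) 0"
    by (rule deriv2_cong[OF oI]) (simp add: D1_inner[OF x y e(4), symmetric] e(5) inner_add_left)
  also have "\<dots> = 0"
  proof -
    have d: "deriv (\<lambda>t. a + t *\<^sub>R b) = (\<lambda>t. b)" for a b :: real
      by (rule ext, rule DERIV_imp_deriv) (auto intro!: derivative_eq_intros)
    show ?thesis by (simp only: numeral_2_eq_2 funpow.simps comp_apply id_apply d deriv_const)
  qed
  finally show "dd u (g x y v) (xc x) = 0" .
qed

definition H where "H x y v u = dd u (dd u (g x y v)) (xc x)"

lemma H_curve:
  assumes x: "x \<in> carrier_of X" and y: "y \<in> carrier_of Y"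
    and I: "open I" "0 \<in> I" "Ck_on 2 I \<gamma>" "\<gamma> ` I \<subseteq> XD x" "\<gamma> 0 = xc x"
  shows "(deriv ^^ 2) (\<lambda>s. g x y v (\<gamma> s)) 0 = H x y v (dd 1 \<gamma> 0)"
  using deriv2_compose_curve[OF open_XD[OF x] g_Ck(1)[OF x y] I(1-4)] g_Ck(2)[OF x y]
  by (simp add: I(5) H_def)

text \<open>Within a level set the cost changes by a term that is constant in \<open>y\<close>, and
  two derivatives in \<open>t\<close> remove it.\<close>

lemma g_level:
  assumes x: "x \<in> carrier_of X" and y: "y \<in> carrier_of Y"
    and \<xi>: "\<xi> \<in> XD x" "\<xi>' \<in> XD x" "Q x \<xi>' = Q x \<xi>"
  shows "g x y v \<xi>' = g x y v \<xi>"
proof -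
  obtain \<delta> \<eta> where e: "0 < \<delta>" "Ck_on 2 {-\<delta><..<\<delta>} \<eta>" "\<eta> 0 = yc y" "\<And>t. t \<in> {-\<delta><..<\<delta>} \<Longrightarrow> \<eta> t \<in> YD y"
    "\<And>t. t \<in> {-\<delta><..<\<delta>} \<Longrightarrow> D1 X c x (param Y y (\<eta> t)) = D1 X c x y + t *\<^sub>R D12 X Y c x y v"
    by (rule y_curve[OF x y]) (rule that)
  let ?f = "\<lambda>\<xi> t. c (param X x \<xi>) (c_exp X Y c x (D1 X c x y + t *\<^sub>R D12 X Y c x y v))"
  have "?f \<xi>' t = ?f \<xi> t + (c (param X x \<xi>') y\<^sub>0 - c (param X x \<xi>) y\<^sub>0)" if "t \<in> {-\<delta><..<\<delta>}" for t
    unfolding c_exp_eq[OF x param_Y[OF y e(4)[OF that]] e(5)[OF that]]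
    by (rule Q_level[OF x \<xi> param_Y[OF y e(4)[OF that]]])
  then have "(deriv ^^ 2) (?f \<xi>') 0 = (deriv ^^ 2) (\<lambda>t. ?f \<xi> t + (c (param X x \<xi>') y\<^sub>0 - c (param X x \<xi>) y\<^sub>0)) 0"
    using e(1) by (intro deriv2_cong[OF open_greaterThanLessThan, of 0 "-\<delta>" \<delta>]) auto
  then show ?thesis by (simp add: deriv2_add_const g_def)
qed

text \<open>A line through \<open>xc x\<close> and its image under
  \<open>\<sigma> \<circ> Q x\<close> meet the same level sets at equal times, so \<open>g\<close>
  agrees along both. By \<open>H_curve\<close> the second derivatives are the values of
  \<open>H\<close> at \<open>u\<close> and at \<open>R x (T x u)\<close>, and the latter depends on
  \<open>T x u\<close> alone.\<close>

lemma H_T: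
  assumes x: "x \<in> carrier_of X" and y: "y \<in> carrier_of Y" and T: "T x u = T x u'"
  shows "H x y v u = H x y v u'"
proof -
  have "H x y v u = H x y v (R x (T x u))" for u
  proof -
    obtain V \<sigma> where V: "open V" "Q x (xc x) \<in> V" "\<sigma> ` V \<subseteq> XD x" "Ck_on 2 V \<sigma>" "\<sigma> (Q x (xc x)) = xc x"
      "\<And>v. dd v \<sigma> (Q x (xc x)) = R x v" "\<And>\<zeta>. \<zeta> \<in> V \<Longrightarrow> Q x (\<sigma> \<zeta>) = \<zeta>"
      by (rule section_of_Q[OF x]) (rule that)
    let ?S = "{\<xi> \<in> XD x. Q x \<xi> \<in> V}"
    have S: "open ?S" by (rule open_vimage_Ck[OF open_XD[OF x] Q_Ck[OF x] V(1)])
    have "xc x \<in> ?S" using xc[OF x] V(2) by blast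
    then obtain \<epsilon> where \<epsilon>: "0 < \<epsilon>" "\<And>s. s \<in> {-\<epsilon><..<\<epsilon>} \<Longrightarrow> xc x + s *\<^sub>R u \<in> ?S"
      by (rule line_in_open[OF S]) (rule that)
    let ?I = "{-\<epsilon><..<\<epsilon>}" and ?\<gamma> = "\<lambda>s. xc x + s *\<^sub>R u"
    have I: "open ?I" "0 \<in> ?I" using \<epsilon>(1) by auto
    have sub: "?\<gamma> ` ?I \<subseteq> XD x" using \<epsilon>(2) by blast
    have 1: "(deriv ^^ 2) (\<lambda>s. g x y v (?\<gamma> s)) 0 = H x y v u"
      using H_curve[OF x y I Ck_on_line sub] by simp
    have q: "Ck_on 2 ?I (\<lambda>s. Q x (?\<gamma> s))"
      by (rule Ck_on_compose[OF I(1) Ck_on_le[OF Q_Ck[OF x]] Ck_on_line sub]) simp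
    have sq: "Ck_on 2 ?I (\<lambda>s. \<sigma> (Q x (?\<gamma> s)))"
      by (rule Ck_on_compose[OF I(1) V(4) q]) (use \<epsilon>(2) in blast)
    have inD: "\<sigma> (Q x (?\<gamma> s)) \<in> XD x" if "s \<in> ?I" for s using \<epsilon>(2)[OF that] V(3) by blast
    have dq: "dd 1 (\<lambda>s. Q x (?\<gamma> s)) 0 = T x u"
    proof -
      have "?\<gamma> differentiable (at 0)" by (rule Ck_on_imp_differentiable[OF Ck_on_line[of 1 UNIV]]) auto
      moreover have "Q x differentiable (at (?\<gamma> 0))" using Q_diff[OF x xc[OF x]] by simp
      ultimately show ?thesis by (subst dd_compose) (auto simp: T_def)
    qed
    have dsq: "dd 1 (\<lambda>s. \<sigma> (Q x (?\<gamma> s))) 0 = R x (T x u)"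
    proof -
      have 1: "(\<lambda>s. Q x (?\<gamma> s)) differentiable (at 0)" using Ck_on_imp_differentiable[OF q _ I(2)] by simp
      have 2: "\<sigma> differentiable (at (Q x (?\<gamma> 0)))" using Ck_on_imp_differentiable[OF V(4) _ V(2)] by simp
      show ?thesis using dd_compose[OF 1 2, of 1] dq V(6) by simp
    qed
    have "H x y v u = (deriv ^^ 2) (\<lambda>s. g x y v (\<sigma> (Q x (?\<gamma> s)))) 0"
      unfolding 1[symmetric]
    proof (rule deriv2_cong[OF I])
      fix s assume s: "s \<in> ?I"
      have "Q x (\<sigma> (Q x (?\<gamma> s))) = Q x (?\<gamma> s)" using \<epsilon>(2)[OF s] V(7) by blast
      then show "g x y v (?\<gamma> s) = g x y v (\<sigma> (Q x (?\<gamma> s)))"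
        using g_level[OF x y _ inD[OF s], of "?\<gamma> s" v] sub s by fastforce
    qed
    also have "\<dots> = H x y v (R x (T x u))"
      using H_curve[OF x y I sq] inD V(5) dsq by (simp add: image_subset_iff)
    finally show ?thesis .
  qed
  from this[of u] this[of u'] T show ?thesis by simp
qed

end

section \<open>Comparison of (A3W) along a local map into \<open>X\<close>\<close>

context cost
begin

text \<open>(A3W) at one point, with the curve replaced by its velocity; the factor is the one of
  \<open>MTW\<close>.\<close>

definition A3W_at where
  "A3W_at x \<longleftrightarrow> (\<forall>y\<in>carrier_of Y. \<forall>u v. u \<bullet> D12 X Y c x y v = 0 \<longrightarrow> 0 \<le> - 3 / 2 * H x y v u)"

text \<open>Stated in coordinates because \<open>\<iota>\<close> is only C^2: for the quotient it is
  a section supplied by the inverse function theorem. The function \<open>a\<close> is the part of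
  the cost that is free of \<open>y\<close>, and \<open>surj\<close> says that the quotient map
  composed with \<open>\<iota>\<close> is a submersion at \<open>w\<close>.\<close>

lemma A3W_at_iff:
  fixes W :: "('w, 'd::euclidean_space) atlas" and cW :: "'w \<Rightarrow> 'b \<Rightarrow> real"
  assumes W: "smooth_atlas W" "w \<in> carrier_of W" and x: "x \<in> carrier_of X"
    and O': "open O'" "coord W w w \<in> O'" "O' \<subseteq> coord W w ` cdom W w"
    and \<iota>: "Ck_on 2 O' \<iota>" "\<iota> ` O' \<subseteq> XD x" "\<iota> (coord W w w) = xc x"
    and a: "a differentiable (at (coord W w w))"
    and cW: "\<And>\<omega> y. \<omega> \<in> O' \<Longrightarrow> y \<in> carrier_of Y \<Longrightarrow> cW (param W w \<omega>) y = c (param X x (\<iota> \<omega>)) y - a \<omega>"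
    and surj: "\<And>e. \<exists>u. T x (dd u \<iota> (coord W w w)) = e"
  shows "(\<forall>y\<in>carrier_of Y. \<forall>u v. u \<bullet> D12 W Y cW w y v = 0 \<longrightarrow>
      (\<forall>\<beta>. smooth_curve W \<beta> \<and> \<beta> 0 = w \<and> velocity W \<beta> = u \<longrightarrow> 0 \<le> MTW W Y cW y \<beta> v)) \<longleftrightarrow> A3W_at x"
proof -
  let ?w = "coord W w w"
  define I where "I u = dd u \<iota> ?w" for u
  have d\<iota>: "\<iota> differentiable (at ?w)" using Ck_on_imp_differentiable[OF \<iota>(1) _ O'(2)] by simp
  have lI: "linear I" using linear_dd[OF d\<iota>] by (simp add: I_def[abs_def])
  define J where "J = adjoint I"
  have J: "J r \<bullet> u = r \<bullet> I u" for r u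
    using adjoint_works[OF lI, of u r] by (simp add: J_def inner_commute)
  have bJ: "bounded_linear J"
    unfolding J_def linear_conv_bounded_linear[symmetric] by (rule adjoint_linear[OF lI])
  define \<alpha> where "\<alpha> = (\<Sum>i\<in>Basis. dd i a ?w *\<^sub>R i)"
  have \<alpha>: "\<alpha> \<bullet> u = dd u a ?w" for u
    using linear_basis_sum[OF linear_dd[OF a], of u]
    unfolding \<alpha>_def inner_sum_left inner_scaleR_left by (simp add: inner_commute[of _ u] mult.commute)
  \<comment> \<open>Covectors pull back by \<open>J\<close>, the adjoint of the derivative of
    \<open>\<iota>\<close>. The term \<open>a\<close> contributes a fixed covector
    \<open>\<alpha>\<close>, which cancels in differences and in derivatives in
    \<open>y\<close>.\<close>
  have D1: "D1 W cW w y = J (D1 X c x y) - \<alpha>" if y: "y \<in> carrier_of Y" for y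
  proof -
    let ?f = "\<lambda>\<omega>. c (param X x (\<iota> \<omega>)) y"
    have dc: "(\<lambda>\<xi>. c (param X x \<xi>) y) differentiable (at (\<iota> ?w))"
      unfolding \<iota>(3) by (rule param_diff_X[OF x y xc[OF x]])
    have df: "?f differentiable (at ?w)" by (rule differentiable_compose_at[OF d\<iota> dc])
    have "(\<lambda>\<omega>. cW (param W w \<omega>) y) differentiable (at ?w)"
      by (rule differentiable_cong_open[OF O'(1,2) _ differentiable_diff[OF df a]]) (simp add: cW y)
    then have da: "differentiable_at W (\<lambda>w'. cW w' y) w" by (simp add: differentiable_at_def)
    have "D1 W cW w y \<bullet> u = (J (D1 X c x y) - \<alpha>) \<bullet> u" for u
    proof -
      have "D1 W cW w y \<bullet> u = dd u (\<lambda>\<omega>. cW (param W w \<omega>) y) ?w"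
        unfolding D1_def by (rule differential_inner[OF da])
      also have "\<dots> = dd u (\<lambda>\<omega>. ?f \<omega> - a \<omega>) ?w"
        by (rule dd_cong[OF O'(1,2)]) (simp add: cW y)
      also have "\<dots> = dd u ?f ?w - dd u a ?w" by (rule dd_diff[OF df a])
      also have "dd u ?f ?w = D1 X c x y \<bullet> I u"
        using dd_compose[OF d\<iota> dc] by (simp add: D1_dd[OF x y] I_def \<iota>(3))
      finally show ?thesis by (simp add: inner_diff_left J \<alpha>)
    qed
    then show ?thesis using vector_eq_rdot by blast
  qed
  have D12: "D12 W Y cW w y v = J (D12 X Y c x y v)" if y: "y \<in> carrier_of Y" for y v
  proof -
    note d = D1_diff[OF x y yc[OF y]]
    have dJ: "(\<lambda>\<eta>. J (D1 X c x (param Y y \<eta>))) differentiable (at (yc y))"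
      using bounded_linear.has_derivative[OF bJ has_derivative_dd[OF d]] differentiable_def by blast
    have "D12 W Y cW w y v = dd v (\<lambda>\<eta>. D1 W cW w (param Y y \<eta>)) (yc y)" by (simp add: D12_def dd_def)
    also have "\<dots> = dd v (\<lambda>\<eta>. J (D1 X c x (param Y y \<eta>)) - \<alpha>) (yc y)"
      by (rule dd_cong[OF open_YD[OF y] yc[OF y]]) (rule D1[OF param_Y[OF y]])
    also have "\<dots> = dd v (\<lambda>\<eta>. J (D1 X c x (param Y y \<eta>))) (yc y)"
      using dd_diff[OF dJ differentiable_const, of v \<alpha>] by simp
    also have "\<dots> = J (D12 X Y c x y v)" using dd_linear_compose[OF bJ d] by (simp add: D12_dd)
    finally show ?thesis .
  qed
  \<comment> \<open>\<open>J\<close> can have a kernel, but it separates the covectors in question: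
    they agree up to a part that vanishes on the kernel of \<open>T x\<close>, and the range of
    \<open>I\<close> meets every fibre of \<open>T x\<close>.\<close>
  have key: "D1 X c x y' = D1 X c x y'' + t *\<^sub>R D12 X Y c x y v"
    if y: "y \<in> carrier_of Y" "y' \<in> carrier_of Y" "y'' \<in> carrier_of Y"
      and eq: "D1 W cW w y' = D1 W cW w y'' + t *\<^sub>R D12 W Y cW w y v" for y y' y'' t v
  proof (rule covector_eqI[OF x y, where I = I])
    show "\<exists>u. T x (I u) = e" for e using surj by (simp add: I_def)
    show "D1 X c x y' \<bullet> I u = (D1 X c x y'' + t *\<^sub>R D12 X Y c x y v) \<bullet> I u" for u
      using arg_cong[OF eq, of "\<lambda>r. r \<bullet> u"] by (simp add: D1 D12 y inner_diff_left inner_add_left J)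
  qed
  have inj: "inj_on (D1 W cW w) (carrier_of Y)"
  proof (rule inj_onI)
    fix y y' assume y: "y \<in> carrier_of Y" "y' \<in> carrier_of Y" "D1 W cW w y = D1 W cW w y'"
    \<comment> \<open>The case \<open>t = 0\<close>; the point \<open>y\<^sub>0\<close> merely fills
      a place that the factor 0 erases.\<close>
    then have "D1 X c x y = D1 X c x y'" using key[OF y\<^sub>0 y(1,2), of 0] by simp
    then show "y = y'" using twist[OF x] y by (auto dest: inj_onD)
  qed
  \<comment> \<open>An equation on \<open>X\<close> pulls back to \<open>W\<close>, so a point that
    solves it also solves the one on \<open>W\<close>; by injectivity it is the point that
    \<open>c_exp\<close> selects there.\<close>
  have cexp: "c_exp W Y cW w (D1 W cW w y + t *\<^sub>R D12 W Y cW w y v) = y'"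
    if "y \<in> carrier_of Y" "y' \<in> carrier_of Y" "D1 X c x y' = D1 X c x y + t *\<^sub>R D12 X Y c x y v" for y y' t v
    unfolding c_exp_def using that
    by (intro inv_into_f_eq[OF inj]) (simp_all add: D1 D12 linear_add linear_scale
        bounded_linear.linear[OF bJ])
  have MTW: "MTW W Y cW y \<beta> v = - 3 / 2 * H x y v (I (velocity W \<beta>))"
    if y: "y \<in> carrier_of Y" and \<beta>: "smooth_curve W \<beta>" "\<beta> 0 = w" for y \<beta> v
  proof -
    obtain \<delta> \<eta> where e: "0 < \<delta>" "Ck_on 2 {-\<delta><..<\<delta>} \<eta>" "\<eta> 0 = yc y" "\<And>t. t \<in> {-\<delta><..<\<delta>} \<Longrightarrow> \<eta> t \<in> YD y"
      "\<And>t. t \<in> {-\<delta><..<\<delta>} \<Longrightarrow> D1 X c x (param Y y (\<eta> t)) = D1 X c x y + t *\<^sub>R D12 X Y c x y v"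
      by (rule y_curve[OF x y]) (rule that)
    obtain \<epsilon> where \<epsilon>: "0 < \<epsilon>" "Ck_curve 2 W \<epsilon> \<beta>" using \<beta>(1) by (auto simp: smooth_curve_def)
    have w: "\<beta> 0 \<in> cdom W w" using chart_at(2)[OF W(2)] \<beta>(2) by simp
    obtain K where K: "open K" "0 \<in> K" "K \<subseteq> {-\<epsilon><..<\<epsilon>}" "\<beta> ` K \<subseteq> cdom W w" "Ck_on 2 K (\<lambda>s. coord W w (\<beta> s))"
      by (rule Ck_curve_maximal_chart[OF W(1) atlas_maximal[OF W(1) chart_at(1)[OF W(2)]] \<epsilon>(2,1) w]) (rule that)
    let ?\<Omega> = "\<lambda>s. coord W w (\<beta> s)"
    let ?K = "{s \<in> K. ?\<Omega> s \<in> O'}"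
    have oK: "open ?K" by (rule open_vimage_Ck[OF K(1,5) O'(1)])
    have zK: "0 \<in> ?K" using K(2) \<beta>(2) O'(2) by simp
    have \<gamma>: "Ck_on 2 ?K (\<lambda>s. \<iota> (?\<Omega> s))"
      by (rule Ck_on_compose[OF oK \<iota>(1) Ck_on_subset[OF K(5)]]) auto
    have \<gamma>X: "(\<lambda>s. \<iota> (?\<Omega> s)) ` ?K \<subseteq> XD x" using \<iota>(2) by blast
    have d\<Omega>: "?\<Omega> differentiable (at 0)" "velocity W \<beta> = dd 1 ?\<Omega> 0"
      using velocity_curve[OF W(1) \<epsilon>(2,1)] \<beta>(2) by simp_all
    have d\<gamma>: "dd 1 (\<lambda>s. \<iota> (?\<Omega> s)) 0 = I (velocity W \<beta>)"
      using dd_compose[OF d\<Omega>(1), of \<iota>] d\<iota> \<beta>(2) d\<Omega>(2) by (simp add: I_def)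
    \<comment> \<open>Along \<open>\<beta>\<close> the term \<open>- a (?\<Omega> s)\<close> is
      constant in \<open>t\<close>, so two derivatives in \<open>t\<close> leave
      \<open>g\<close>.\<close>
    have inner: "(deriv ^^ 2) (\<lambda>t. cW (\<beta> s) (c_exp W Y cW w (D1 W cW w y + t *\<^sub>R D12 W Y cW w y v))) 0
        = g x y v (\<iota> (?\<Omega> s))" if s: "s \<in> ?K" for s
    proof -
      have "\<beta> s = param W w (?\<Omega> s)" using s K(4) param_coord[OF W] by (metis (no_types, lifting) image_subset_iff mem_Collect_eq)
      then have hb: "cW (\<beta> s) y' = c (param X x (\<iota> (?\<Omega> s))) y' + - a (?\<Omega> s)" if "y' \<in> carrier_of Y" for y'
        using cW[OF _ that, of "?\<Omega> s"] s by simp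
      have hc: "cW (\<beta> s) (c_exp W Y cW w (D1 W cW w y + t *\<^sub>R D12 W Y cW w y v))
          = c (param X x (\<iota> (?\<Omega> s))) (c_exp X Y c x (D1 X c x y + t *\<^sub>R D12 X Y c x y v)) + - a (?\<Omega> s)"
        if "t \<in> {-\<delta><..<\<delta>}" for t
        unfolding c_exp_eq[OF x param_Y[OF y e(4)[OF that]] e(5)[OF that]]
          cexp[OF y param_Y[OF y e(4)[OF that]] e(5)[OF that]]
        by (rule hb[OF param_Y[OF y e(4)[OF that]]])
      have "0 \<in> {-\<delta><..<\<delta>}" using e(1) by simp
      from trans[OF deriv2_cong[OF open_greaterThanLessThan this hc] deriv2_add_const]
      show ?thesis unfolding g_def .
    qed
    have "(deriv ^^ 2) (\<lambda>s. (deriv ^^ 2) (\<lambda>t. cW (\<beta> s) (c_exp W Y cW w (D1 W cW w y + t *\<^sub>R D12 W Y cW w y v))) 0) 0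
        = (deriv ^^ 2) (\<lambda>s. g x y v (\<iota> (?\<Omega> s))) 0"
      by (rule deriv2_cong[OF oK zK inner])
    also have "\<dots> = H x y v (I (velocity W \<beta>))"
      using H_curve[OF x y oK zK \<gamma> \<gamma>X] \<iota>(3) \<beta>(2) d\<gamma> by simp
    finally show ?thesis by (simp add: MTW_def \<beta>(2))
  qed
  show ?thesis
  proof
    assume P: "A3W_at x"
    show "\<forall>y\<in>carrier_of Y. \<forall>u v. u \<bullet> D12 W Y cW w y v = 0 \<longrightarrow>
      (\<forall>\<beta>. smooth_curve W \<beta> \<and> \<beta> 0 = w \<and> velocity W \<beta> = u \<longrightarrow> 0 \<le> MTW W Y cW y \<beta> v)"
    proof (intro ballI allI impI, elim conjE)
      fix y u v \<beta> assume y: "y \<in> carrier_of Y" and u: "u \<bullet> D12 W Y cW w y v = 0"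
        and \<beta>: "smooth_curve W \<beta>" "\<beta> 0 = w" "velocity W \<beta> = u"
      have "I u \<bullet> D12 X Y c x y v = 0" using u J by (simp add: D12[OF y] inner_commute)
      then show "0 \<le> MTW W Y cW y \<beta> v" using P y \<beta> by (simp add: MTW A3W_at_def)
    qed
  next
    assume A: "\<forall>y\<in>carrier_of Y. \<forall>u v. u \<bullet> D12 W Y cW w y v = 0 \<longrightarrow>
      (\<forall>\<beta>. smooth_curve W \<beta> \<and> \<beta> 0 = w \<and> velocity W \<beta> = u \<longrightarrow> 0 \<le> MTW W Y cW y \<beta> v)"
    show "A3W_at x" unfolding A3W_at_def
    proof (intro ballI allI impI)
      fix y u v assume y: "y \<in> carrier_of Y" and u: "u \<bullet> D12 X Y c x y v = 0"
      \<comment> \<open>\<open>u\<close> may fail to be tangent to the image of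
        \<open>\<iota>\<close>. It is replaced by \<open>I u'\<close> with the same image under
        \<open>T x\<close>, which changes neither the orthogonality nor \<open>H\<close>.\<close>
      obtain u' where u': "T x (I u') = T x u" using surj unfolding I_def by blast
      obtain \<beta> where \<beta>: "smooth_curve W \<beta>" "\<beta> 0 = w" "velocity W \<beta> = u'"
        by (rule coordinate_line[OF W]) (rule that)
      have "u' \<bullet> D12 W Y cW w y v = 0"
        using u J T_kernel_inner[OF x y u'] by (simp add: D12[OF y] inner_commute)
      then have "0 \<le> MTW W Y cW y \<beta> v" using A y \<beta> by blast
      then show "0 \<le> - 3 / 2 * H x y v u" using H_T[OF x y u'] MTW[OF y \<beta>(1,2)] \<beta>(3) by simp
    qed
  qed
qed

lemma A3W_X_iff: "A3W X Y c \<longleftrightarrow> (\<forall>x\<in>carrier_of X. A3W_at x)"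
proof -
  have "(\<forall>y\<in>carrier_of Y. \<forall>u v. u \<bullet> D12 X Y c x y v = 0 \<longrightarrow>
      (\<forall>\<beta>. smooth_curve X \<beta> \<and> \<beta> 0 = x \<and> velocity X \<beta> = u \<longrightarrow> 0 \<le> MTW X Y c y \<beta> v)) \<longleftrightarrow> A3W_at x"
    if x: "x \<in> carrier_of X" for x
  proof (rule A3W_at_iff[where \<iota> = "\<lambda>\<xi>. \<xi>" and a = "\<lambda>_. 0", OF X x x open_XD[OF x] xc[OF x] _ Ck_on_id])
    show "\<exists>u. T x (dd u (\<lambda>\<xi>. \<xi>) (xc x)) = e" for e
      using surjD[OF surj_T[OF x], of e] by (auto simp: dd_bounded_linear[OF bounded_linear_ident])
  qed auto
  then show ?thesis unfolding A3W_def by simp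
qed

section \<open>The quotient\<close>

lemma A3W_Z_iff:
  assumes Z: "Z = quotient_manifold X Y c y\<^sub>0"
    and b: "\<And>z x y. z \<in> carrier_of Z \<Longrightarrow> x \<in> z \<Longrightarrow> y \<in> carrier_of Y \<Longrightarrow>
        differentiable_at Y (b z) y \<and> D2 Y b z y = D2 Y c x y"
    and b0: "\<And>z. z \<in> carrier_of Z \<Longrightarrow> b z y\<^sub>0 = 0"
  shows "A3W Z Y b \<longleftrightarrow> (\<forall>x\<in>carrier_of X. A3W_at x)"
proof -
  define cl where "cl x = {x' \<in> carrier_of X. D2 Y c x' y\<^sub>0 = D2 Y c x y\<^sub>0}" for x
  define C where "C = cl ` carrier_of X"
  define \<phi> where "\<phi> = (\<lambda>z. the_elem ((\<lambda>x. D2 Y c x y\<^sub>0) ` z))"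
  have "carrier_of X // {(x, x'). x \<in> carrier_of X \<and> x' \<in> level_set X Y c y\<^sub>0 x} = C"
    unfolding quotient_def C_def cl_def level_set_def Image_def by auto
  then have Z': "Z = {(C, \<phi>)}" by (simp add: Z quotient_manifold_def \<phi>_def)
  have cZ: "carrier_of Z = C" by (simp add: Z' carrier_of_def)
  have clx: "x \<in> cl x" if "x \<in> carrier_of X" for x using that by (simp add: cl_def)
  have \<phi>: "\<phi> (cl x) = D2 Y c x y\<^sub>0" if "x \<in> carrier_of X" for x
  proof -
    have "(\<lambda>x. D2 Y c x y\<^sub>0) ` cl x = {D2 Y c x y\<^sub>0}" using clx[OF that] by (auto simp: cl_def)
    then show ?thesis by (simp add: \<phi>_def)
  qed
  have inj: "inj_on \<phi> C"
  proof (rule inj_onI)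
    fix z z' assume "z \<in> C" "z' \<in> C" "\<phi> z = \<phi> z'"
    then obtain x x' where "x \<in> carrier_of X" "x' \<in> carrier_of X" "z = cl x" "z' = cl x'" "D2 Y c x y\<^sub>0 = D2 Y c x' y\<^sub>0"
      using \<phi> unfolding C_def by fastforce
    then show "z = z'" by (simp add: cl_def)
  qed
  have inv: "inv_into C \<phi> (D2 Y c x y\<^sub>0) = cl x" if "x \<in> carrier_of X" for x
    using inv_into_f_f[OF inj, of "cl x"] that by (simp add: \<phi> C_def)
  have Qin: "Q x \<xi> \<in> \<phi> ` C" if "x \<in> carrier_of X" "\<xi> \<in> XD x" for x \<xi>
    using param_X[OF that] \<phi> by (force simp: Q_def C_def)
  \<comment> \<open>By a local section, every covector near a value of the quotient map is again a
    value.\<close>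
  have op: "open (\<phi> ` C)"
  proof (subst open_subopen, intro ballI)
    fix \<zeta> assume "\<zeta> \<in> \<phi> ` C"
    then obtain x where x: "x \<in> carrier_of X" "\<zeta> = D2 Y c x y\<^sub>0" using \<phi> unfolding C_def by auto
    obtain V \<sigma> where V: "open V" "Q x (xc x) \<in> V" "\<sigma> ` V \<subseteq> XD x" "Ck_on 2 V \<sigma>" "\<sigma> (Q x (xc x)) = xc x"
      "\<And>v. dd v \<sigma> (Q x (xc x)) = R x v" "\<And>\<zeta>. \<zeta> \<in> V \<Longrightarrow> Q x (\<sigma> \<zeta>) = \<zeta>"
      by (rule section_of_Q[OF x(1)]) (rule that)
    have "V \<subseteq> \<phi> ` C"
    proof
      fix \<zeta>' assume "\<zeta>' \<in> V"
      then show "\<zeta>' \<in> \<phi> ` C" using V(7)[of \<zeta>'] Qin[OF x(1), of "\<sigma> \<zeta>'"] V(3) by (metis imageI subsetD)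
    qed
    moreover have "\<zeta> \<in> V" using V(2) x param_xc[OF x(1)] by (simp add: Q_def)
    ultimately show "\<exists>T. open T \<and> \<zeta> \<in> T \<and> T \<subseteq> \<phi> ` C" using V(1) by blast
  qed
  have Zat: "smooth_atlas Z"
  proof -
    have "Ck_on k (\<phi> ` C) (\<lambda>\<xi>. \<phi> (inv_into C \<phi> \<xi>))" for k
      by (rule Ck_on_cong[OF op _ Ck_on_id]) (simp add: f_inv_into_f)
    then show ?thesis using inj op by (simp add: Z' smooth_atlas_def is_chart_def compatible_def smooth_on_def)
  qed
  have chart: "cdom Z z = C" "coord Z z = \<phi>" if "z \<in> C" for z
  proof -
    have "(cdom Z z, coord Z z) \<in> {(C, \<phi>)}"
      using chart_at(1)[of z Z] that by (subst Z'[symmetric]) (simp add: cZ)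
    then show "cdom Z z = C" "coord Z z = \<phi>" by simp_all
  qed
  have bc: "b (cl x) y = c x y - c x y\<^sub>0" if x: "x \<in> carrier_of X" and y: "y \<in> carrier_of Y" for x y
  proof -
    have z: "cl x \<in> carrier_of Z" using x by (simp add: cZ C_def)
    have "b (cl x) y - c x y = b (cl x) y\<^sub>0 - c x y\<^sub>0"
      using b[OF z clx[OF x]] c_differentiable_Y[OF x]
      by (intro differential_eq_constant[OF Y Y_connected _ _ _ y y\<^sub>0]) (auto simp: D2_def)
    then show ?thesis using b0[OF z] by simp
  qed
  have "(\<forall>y\<in>carrier_of Y. \<forall>u v. u \<bullet> D12 Z Y b (cl x) y v = 0 \<longrightarrow>
      (\<forall>\<beta>. smooth_curve Z \<beta> \<and> \<beta> 0 = cl x \<and> velocity Z \<beta> = u \<longrightarrow> 0 \<le> MTW Z Y b y \<beta> v)) \<longleftrightarrow> A3W_at x"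
    if x: "x \<in> carrier_of X" for x
  proof -
    obtain V \<sigma> where V: "open V" "Q x (xc x) \<in> V" "\<sigma> ` V \<subseteq> XD x" "Ck_on 2 V \<sigma>" "\<sigma> (Q x (xc x)) = xc x"
      "\<And>v. dd v \<sigma> (Q x (xc x)) = R x v" "\<And>\<zeta>. \<zeta> \<in> V \<Longrightarrow> Q x (\<sigma> \<zeta>) = \<zeta>"
      by (rule section_of_Q[OF x]) (rule that)
    have zC: "cl x \<in> C" using x by (simp add: C_def)
    have co: "coord Z (cl x) (cl x) = Q x (xc x)"
      by (simp add: chart(2)[OF zC] \<phi>[OF x] Q_def param_xc[OF x])
    have d\<sigma>: "\<sigma> differentiable (at (Q x (xc x)))" using Ck_on_imp_differentiable[OF V(4) _ V(2)] by simp
    have VC: "V \<subseteq> \<phi> ` C"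
    proof
      fix \<zeta>' assume "\<zeta>' \<in> V"
      then show "\<zeta>' \<in> \<phi> ` C" using V(7)[of \<zeta>'] Qin[OF x, of "\<sigma> \<zeta>'"] V(3) by (metis imageI subsetD)
    qed
    show ?thesis
    \<comment> \<open>\<open>a\<close> is the cost at \<open>y\<^sub>0\<close> along the section,
      the term subtracted by the normalisation of \<open>b\<close>; it varies with
      \<open>\<zeta>\<close> but not with \<open>y\<close>.\<close>
    proof (rule A3W_at_iff[where \<iota> = \<sigma> and a = "\<lambda>\<zeta>. c (param X x (\<sigma> \<zeta>)) y\<^sub>0", OF Zat _ x V(1)])
      show "cl x \<in> carrier_of Z" using zC by (simp add: cZ)
      show "V \<subseteq> coord Z (cl x) ` cdom Z (cl x)" using VC by (simp add: chart[OF zC])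
      show "coord Z (cl x) (cl x) \<in> V" "\<sigma> (coord Z (cl x) (cl x)) = xc x" unfolding co by (fact V)+
      show "Ck_on 2 V \<sigma>" "\<sigma> ` V \<subseteq> XD x" by (fact V)+
      show "(\<lambda>\<zeta>. c (param X x (\<sigma> \<zeta>)) y\<^sub>0) differentiable (at (coord Z (cl x) (cl x)))"
        unfolding co by (rule differentiable_compose_at[OF d\<sigma>]) (simp add: V(5) param_diff_X[OF x y\<^sub>0 xc[OF x]])
      show "\<exists>u. T x (dd u \<sigma> (coord Z (cl x) (cl x))) = e" for e
        unfolding co V(6) using R(2)[OF x] by blast
      show "b (param Z (cl x) \<zeta>) y = c (param X x (\<sigma> \<zeta>)) y - c (param X x (\<sigma> \<zeta>)) y\<^sub>0"
        if "\<zeta> \<in> V" "y \<in> carrier_of Y" for \<zeta> y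
      proof -
        have s: "\<sigma> \<zeta> \<in> XD x" using V(3) that by blast
        have "param Z (cl x) \<zeta> = inv_into C \<phi> (D2 Y c (param X x (\<sigma> \<zeta>)) y\<^sub>0)"
          using V(7)[OF that(1)] by (simp add: param_eq chart[OF zC] Q_def)
        also have "\<dots> = cl (param X x (\<sigma> \<zeta>))" by (rule inv[OF param_X[OF x s]])
        finally show ?thesis using bc[OF param_X[OF x s] that(2)] by simp
      qed
    qed
  qed
  then show ?thesis unfolding A3W_def cZ C_def by simp
qed

end

section \<open>Transverse surfaces\<close>

text \<open>As a pullback along an injective chart, the topology inherits the Hausdorff property and
  second countability from the model space. The transverse surface constructed below has a single
  chart.\<close>

lemma mfd_topology_single:
  fixes \<psi> :: "'a \<Rightarrow> 'e::euclidean_space"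
  assumes ch: "is_chart (U, \<psi>)"
  shows "mfd_topology {(U, \<psi>)} = pullback_topology U \<psi> euclidean"
proof -
  note inj = is_chartD(1)[OF ch] and op = is_chartD(2)[OF ch]
  have "(W \<subseteq> carrier_of {(U, \<psi>)} \<and> (\<forall>(V, \<phi>)\<in>{(U, \<psi>)}. open (\<phi> ` (W \<inter> V)))) \<longleftrightarrow>
      openin (pullback_topology U \<psi> euclidean) W" for W
  proof -
    have "W \<subseteq> U \<and> open (\<psi> ` W) \<longleftrightarrow> (\<exists>O'. open O' \<and> W = \<psi> -` O' \<inter> U)"
    proof
      assume "W \<subseteq> U \<and> open (\<psi> ` W)"
      then show "\<exists>O'. open O' \<and> W = \<psi> -` O' \<inter> U" using inj by (intro exI[of _ "\<psi> ` W"]) (auto dest: inj_onD)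
    next
      assume "\<exists>O'. open O' \<and> W = \<psi> -` O' \<inter> U"
      then obtain O' where "open O'" "W = \<psi> -` O' \<inter> U" by blast
      moreover from this have "\<psi> ` W = O' \<inter> \<psi> ` U" by blast
      ultimately show "W \<subseteq> U \<and> open (\<psi> ` W)" using op by auto
    qed
    then show ?thesis by (auto simp: carrier_of_def openin_pullback_topology Int_absorb2)
  qed
  then show ?thesis unfolding mfd_topology_def by (simp add: openin_inverse)
qed

lemma smooth_manifold_single:
  fixes \<psi> :: "'a \<Rightarrow> 'e::euclidean_space"
  assumes ch: "is_chart (U, \<psi>)"
  shows "smooth_manifold {(U, \<psi>)}"
proof -
  note inj = is_chartD(1)[OF ch] and op = is_chartD(2)[OF ch]
  let ?P = "pullback_topology U \<psi> euclidean"
  have "Ck_on k (\<psi> ` U) (\<lambda>\<xi>. \<psi> (inv_into U \<psi> \<xi>))" for k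
    by (rule Ck_on_cong[OF op _ Ck_on_id]) (simp add: f_inv_into_f)
  then have "compatible (U, \<psi>) (U, \<psi>)" using op by (simp add: compatible_def smooth_on_def)
  moreover have "Hausdorff_space ?P"
  proof (rule Hausdorff_space_injective_preimage)
    show "continuous_map ?P euclidean \<psi>" using continuous_map_pullback[OF continuous_map_id, where A = U and f = \<psi>] by simp
  qed (use inj in \<open>simp_all add: topspace_pullback_topology\<close>)
  moreover have "second_countable ?P"
  proof -
    obtain B :: "'e set set" where B: "countable B" "topological_basis B"
      using ex_countable_basis by blast
    have "\<exists>V\<in>(\<lambda>V. \<psi> -` V \<inter> U) ` B. x \<in> V \<and> V \<subseteq> W" if W: "openin ?P W" "x \<in> W" for W x
    proof -
      obtain O' where O': "open O'" "W = \<psi> -` O' \<inter> U" using W(1) by (auto simp: openin_pullback_topology)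
      have "\<psi> x \<in> O'" using W(2) O'(2) by blast
      then obtain V where V: "V \<in> B" "\<psi> x \<in> V" "V \<subseteq> O'"
        by (rule topological_basisE[OF B(2) O'(1)]) (rule that)
      have "x \<in> \<psi> -` V \<inter> U" "\<psi> -` V \<inter> U \<subseteq> W" using V(2,3) W(2) unfolding O'(2) by auto
      then show ?thesis using V(1) by (intro bexI[of _ "\<psi> -` V \<inter> U"]) simp_all
    qed
    moreover have "openin ?P V" if "V \<in> (\<lambda>V. \<psi> -` V \<inter> U) ` B" for V
      using that topological_basis_open[OF B(2)] by (auto simp: openin_pullback_topology)
    ultimately show ?thesis unfolding second_countable_def
      using B(1) by (intro exI[of _ "(\<lambda>V. \<psi> -` V \<inter> U) ` B"]) auto
  qed
  ultimately show ?thesis using ch by (simp add: smooth_manifold_def mfd_topology_single)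
qed

text \<open>Tangent vectors of \<open>S\<close> are velocities of curves of \<open>A\<close> that
  merely run inside the set \<open>S\<close>. Slice coordinates show that such a curve is C^1 near 0
  in the chart of \<open>S\<close> at \<open>p\<close>, so its velocity comes from one in that
  chart.\<close>

lemma tangent_to_submanifold:
  fixes A :: "('a, 'g::euclidean_space) atlas" and S :: "('a, 'e::euclidean_space) atlas"
  assumes A: "smooth_atlas A" and S: "embedded_submanifold A S" and p: "p \<in> carrier_of S"
    and O': "open O'" "coord S p p \<in> O'" and \<iota>: "\<And>\<eta>. \<eta> \<in> O' \<Longrightarrow> \<iota> \<eta> = coord A p (param S p \<eta>)"
      "\<iota> differentiable (at (coord S p p))"
    and u: "u \<in> tangent_to A (carrier_of S) p"
  shows "\<exists>u'. u = dd u' \<iota> (coord S p p)"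
proof -
  have Sat: "smooth_atlas S"
    by (rule smooth_manifold_atlas) (use S in \<open>simp add: embedded_submanifold_def\<close>)
  obtain \<gamma> \<epsilon> where \<gamma>: "u = velocity A \<gamma>" "\<gamma> 0 = p" "0 < \<epsilon>" "Ck_curve 1 A \<epsilon> \<gamma>" "\<gamma> ` {-\<epsilon><..<\<epsilon>} \<subseteq> carrier_of S"
    using u unfolding tangent_to_def by blast
  obtain U \<phi> and j :: "'e \<Rightarrow> 'g" where s: "(U, \<phi>) \<in> maximal_atlas A" "p \<in> U" "linear j" "inj j"
    "\<phi> ` (U \<inter> carrier_of S) = \<phi> ` U \<inter> range j" "(U \<inter> carrier_of S, \<lambda>x. inv j (\<phi> x)) \<in> maximal_atlas S"
    using S p unfolding embedded_submanifold_def by meson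
  let ?US = "U \<inter> carrier_of S" and ?\<chi> = "\<lambda>x. inv j (\<phi> x)"
  \<comment> \<open>\<open>inv j\<close> is unspecified off \<open>range j\<close>; a linear left
    inverse agrees with it on the range, where the curve stays, and preserves regularity.\<close>
  obtain j' where j': "linear j'" "j' \<circ> j = id" using linear_injective_left_inverse[OF s(3,4)] by blast
  have inv_j: "inv j \<xi> = j' \<xi>" if "\<xi> \<in> range j" for \<xi>
    using that inv_f_f[OF s(4)] j'(2) by (auto simp: o_def fun_eq_iff)
  obtain K where K: "open K" "0 \<in> K" "K \<subseteq> {-\<epsilon><..<\<epsilon>}" "\<gamma> ` K \<subseteq> U" "Ck_on 1 K (\<lambda>s. \<phi> (\<gamma> s))"
    by (rule Ck_curve_maximal_chart[OF A s(1) \<gamma>(4,3)]) (use \<gamma>(2) s(2) in simp, rule that)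
  have \<gamma>US: "\<gamma> s \<in> ?US" if "s \<in> K" for s using that K(3,4) \<gamma>(5) by blast
  have "Ck_on 1 K (\<lambda>s. j' (\<phi> (\<gamma> s)))"
    using j'(1) by (intro Ck_on_linear_compose[OF K(1) _ K(5)]) (simp add: linear_conv_bounded_linear)
  then have \<chi>: "Ck_on 1 K (\<lambda>s. ?\<chi> (\<gamma> s))"
  proof (rule Ck_on_cong[OF K(1), rotated])
    fix s assume "s \<in> K"
    then have "\<phi> (\<gamma> s) \<in> \<phi> ` U \<inter> range j" using \<gamma>US[of s] s(5) by blast
    then show "j' (\<phi> (\<gamma> s)) = ?\<chi> (\<gamma> s)" using inv_j by simp
  qed
  have pS: "p \<in> cdom S p" "(cdom S p, coord S p) \<in> S" using chart_at[OF p] by auto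
  have comp: "compatible (?US, ?\<chi>) (cdom S p, coord S p)" using s(6) pS(2) by (simp add: maximal_atlas_def)
  have ch: "is_chart (?US, ?\<chi>)" using s(6) by (simp add: maximal_atlas_def)
  let ?K = "{s \<in> K. ?\<chi> (\<gamma> s) \<in> ?\<chi> ` (?US \<inter> cdom S p)}"
  have oK: "open ?K" by (rule open_vimage_Ck[OF K(1) \<chi> compatibleD(1)[OF comp]])
  have dom: "\<gamma> s \<in> cdom S p" if "s \<in> ?K" for s
  proof -
    have "?\<chi> (\<gamma> s) \<in> ?\<chi> ` (?US \<inter> cdom S p)" using that by simp
    then obtain q where q: "q \<in> ?US" "q \<in> cdom S p" "?\<chi> (\<gamma> s) = ?\<chi> q" by blast
    have "\<gamma> s = q" using inj_onD[OF is_chartD(1)[OF ch] q(3)] \<gamma>US[of s] that q(1) by blast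
    then show ?thesis using q(2) by simp
  qed
  have "Ck_on 1 ?K (\<lambda>s. coord S p (inv_into ?US ?\<chi> (?\<chi> (\<gamma> s))))"
    by (rule Ck_on_compose[OF oK compatibleD(2)[OF comp] Ck_on_subset[OF \<chi>]]) auto
  then have \<delta>: "Ck_on 1 ?K (\<lambda>s. coord S p (\<gamma> s))"
  proof (rule Ck_on_cong[OF oK, rotated])
    fix s assume "s \<in> ?K"
    then have "\<gamma> s \<in> ?US" using \<gamma>US by blast
    then show "coord S p (inv_into ?US ?\<chi> (?\<chi> (\<gamma> s))) = coord S p (\<gamma> s)" using inv_chart[OF ch] by simp
  qed
  let ?K' = "{s \<in> ?K. coord S p (\<gamma> s) \<in> O'}"
  have oK': "open ?K'" by (rule open_vimage_Ck[OF oK \<delta> O'(1)])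
  have "\<gamma> 0 \<in> ?US" using \<gamma>US[OF K(2)] .
  then have zK: "0 \<in> ?K" using K(2) \<gamma>(2) pS(1) by auto
  then have zK': "0 \<in> ?K'" using \<gamma>(2) O'(2) by simp
  have d\<delta>: "(\<lambda>s. coord S p (\<gamma> s)) differentiable (at 0)" using Ck_on_imp_differentiable[OF \<delta> _ zK] by simp
  have "u = dd 1 (\<lambda>s. coord A p (\<gamma> s)) 0"
    using velocity_curve(1)[OF A \<gamma>(4,3)] \<gamma>(1,2) by simp
  also have "\<dots> = dd 1 (\<lambda>s. \<iota> (coord S p (\<gamma> s))) 0"
  proof (rule dd_cong[OF oK' zK'])
    fix s assume "s \<in> ?K'"
    then have "\<iota> (coord S p (\<gamma> s)) = coord A p (param S p (coord S p (\<gamma> s)))" using \<iota>(1) by blast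
    then show "coord A p (\<gamma> s) = \<iota> (coord S p (\<gamma> s))"
      using param_coord[OF Sat p dom[of s]] \<open>s \<in> ?K'\<close> by simp
  qed
  also have "\<dots> = dd (dd 1 (\<lambda>s. coord S p (\<gamma> s)) 0) \<iota> (coord S p p)"
    using dd_compose[OF d\<delta>, of \<iota>] \<iota>(2) \<gamma>(2) by simp
  finally show ?thesis by blast
qed

section \<open>Tangent spaces of level sets and transversality\<close>

context cost
begin

abbreviation L where "L x \<equiv> level_set X Y c y\<^sub>0 x"

text \<open>Describes \<open>T\<close> at the starting point of a curve without using the chart
  there, so that the curve may be given in the chart of another point.\<close>

lemma T_velocity:
  assumes \<beta>: "Ck_curve 1 X \<epsilon> \<beta>" "0 < \<epsilon>"
  shows "T (\<beta> 0) (velocity X \<beta>) = dd 1 (\<lambda>s. D2 Y c (\<beta> s) y\<^sub>0) 0"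
proof -
  let ?p = "\<beta> 0"
  have p: "?p \<in> carrier_of X" using \<beta> by (auto simp: Ck_curve_def image_subset_iff)
  obtain K where K: "open K" "0 \<in> K" "\<beta> ` K \<subseteq> cdom X ?p"
    by (rule Ck_curve_maximal_chart[OF X atlas_maximal[OF X chart_at(1)[OF p]] \<beta> chart_at(2)[OF p]]) (rule that)
  note v = velocity_curve[OF X \<beta> zero_less_one]
  have "dd 1 (\<lambda>s. D2 Y c (\<beta> s) y\<^sub>0) 0 = dd 1 (\<lambda>s. Q ?p (coord X ?p (\<beta> s))) 0"
    by (rule dd_cong[OF K(1,2)]) (use K(3) param_coord[OF X p] in \<open>auto simp: Q_def\<close>)
  also have "\<dots> = T ?p (velocity X \<beta>)"
    using dd_compose[OF v(2) Q_diff[OF p xc[OF p]]] v(1) by (simp add: T_def)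
  finally show ?thesis by simp
qed

lemma tangent_level:
  assumes "v \<in> tangent_to X (L x) p" shows "T p v = 0"
proof -
  obtain \<gamma> \<epsilon> where \<gamma>: "v = velocity X \<gamma>" "\<gamma> 0 = p" "0 < \<epsilon>" "Ck_curve 1 X \<epsilon> \<gamma>" "\<gamma> ` {-\<epsilon><..<\<epsilon>} \<subseteq> L x"
    using assms unfolding tangent_to_def by blast
  have "dd 1 (\<lambda>s. D2 Y c (\<gamma> s) y\<^sub>0) 0 = dd 1 (\<lambda>s::real. D2 Y c x y\<^sub>0) 0"
    by (rule dd_cong[where S = "{-\<epsilon><..<\<epsilon>}"]) (use \<gamma>(3,5) in \<open>auto simp: level_set_def image_subset_iff\<close>)
  then show ?thesis using T_velocity[OF \<gamma>(4,3)] \<gamma>(1,2) by simp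
qed

text \<open>Together with \<open>tangent_level\<close> this identifies the tangent space of a level
  set with the kernel of \<open>T p\<close>. The straightened line in direction \<open>v\<close>
  runs in the level set; it need not be smooth, as the straightening map is only C^2.\<close>

lemma kernel_tangent_level:
  assumes p: "p \<in> L x" and v: "T p v = 0"
  shows "v \<in> tangent_to X (L x) p"
proof -
  have pX: "p \<in> carrier_of X" and px: "D2 Y c p y\<^sub>0 = D2 Y c x y\<^sub>0" using p by (auto simp: level_set_def)
  obtain W \<Psi> where W: "open W" "xc p \<in> W" "\<Psi> ` W \<subseteq> XD p" "Ck_on 2 W \<Psi>" "\<Psi> (xc p) = xc p"
    "\<And>v. dd v \<Psi> (xc p) = v" "\<And>\<theta>. \<theta> \<in> W \<Longrightarrow> Q p (\<Psi> \<theta>) = Q p (xc p) + T p (\<theta> - xc p)"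
    by (rule straightening[OF pX]) (rule that)
  obtain \<epsilon> where \<epsilon>: "0 < \<epsilon>" "\<And>s. s \<in> {-\<epsilon><..<\<epsilon>} \<Longrightarrow> xc p + s *\<^sub>R v \<in> W"
    by (rule line_in_open[OF W(1,2)]) (rule that)
  let ?l = "\<lambda>s::real. xc p + s *\<^sub>R v" and ?I = "{-\<epsilon><..<\<epsilon>}"
  define \<gamma> where "\<gamma> s = inv_into (cdom X p) (coord X p) (\<Psi> (?l s))" for s
  have "Ck_on 1 ?I (\<lambda>s. \<Psi> (?l s))"
    by (rule Ck_on_compose[OF open_greaterThanLessThan Ck_on_le[OF W(4)] Ck_on_line]) (use \<epsilon> in auto)
  moreover have inD: "\<Psi> (?l s) \<in> XD p" if "s \<in> ?I" for s using \<epsilon>(2)[OF that] W(3) by blast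
  ultimately have c: "Ck_curve 1 X \<epsilon> \<gamma>" unfolding \<gamma>_def
    by (intro Ck_curve_chart[OF X chart_at(1)[OF pX]]) auto
  have \<gamma>': "\<gamma> s = param X p (\<Psi> (?l s))" for s by (simp add: \<gamma>_def param_eq)
  have \<gamma>0: "\<gamma> 0 = p" using param_xc[OF pX] W(5) by (simp add: \<gamma>')
  have "velocity X \<gamma> = dd 1 (\<lambda>s. coord X p (\<gamma> s)) 0" using velocity_curve(1)[OF X c \<epsilon>(1)] \<gamma>0 by simp
  also have "\<dots> = dd 1 (\<lambda>s. \<Psi> (?l s)) 0"
    by (rule dd_cong[where S = "{-\<epsilon><..<\<epsilon>}"]) (use \<epsilon>(1) inD in \<open>auto simp: \<gamma>' coord_param\<close>)
  also have "\<dots> = v"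
  proof -
    have "?l differentiable (at 0)" by (rule Ck_on_imp_differentiable[OF Ck_on_line[of 1 UNIV]]) auto
    moreover have "\<Psi> differentiable (at (?l 0))" using Ck_on_imp_differentiable[OF W(4) _ W(2)] by simp
    ultimately show ?thesis using W(6) by (subst dd_compose) auto
  qed
  finally have "velocity X \<gamma> = v" .
  moreover have "\<gamma> s \<in> L x" if "s \<in> ?I" for s
  proof -
    have "Q p (\<Psi> (?l s)) = Q p (xc p)"
      using W(7)[OF \<epsilon>(2)[OF that]] linear_scale[OF linear_T[OF pX], of s v] v by simp
    then show ?thesis using param_X[OF pX inD[OF that]] px
      by (simp add: level_set_def \<gamma>' Q_def param_xc[OF pX])
  qed
  ultimately show ?thesis unfolding tangent_to_def using c \<gamma>0 \<epsilon>(1) by blast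
qed

lemma A3W_S_iff:
  fixes S :: "('a, 'f) atlas"
  assumes S: "embedded_submanifold X S" and tr: "\<And>x. x \<in> carrier_of X \<Longrightarrow> transverse X (carrier_of S) (L x)"
  shows "A3W S Y c \<longleftrightarrow> (\<forall>x\<in>carrier_of S. A3W_at x)"
proof -
  have Sat: "smooth_atlas S"
    by (rule smooth_manifold_atlas) (use S in \<open>simp add: embedded_submanifold_def\<close>)
  have SX: "carrier_of S \<subseteq> carrier_of X" using S by (simp add: embedded_submanifold_def)
  have "(\<forall>y\<in>carrier_of Y. \<forall>u v. u \<bullet> D12 S Y c x y v = 0 \<longrightarrow>
      (\<forall>\<beta>. smooth_curve S \<beta> \<and> \<beta> 0 = x \<and> velocity S \<beta> = u \<longrightarrow> 0 \<le> MTW S Y c y \<beta> v)) \<longleftrightarrow> A3W_at x"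
    if xS: "x \<in> carrier_of S" for x
  proof -
    have x: "x \<in> carrier_of X" using xS SX by blast
    let ?\<iota> = "\<lambda>\<eta>. coord X x (inv_into (cdom S x) (coord S x) \<eta>)"
    obtain O' where O': "open O'" "coord S x x \<in> O'" "O' \<subseteq> coord S x ` cdom S x"
      "inv_into (cdom S x) (coord S x) ` O' \<subseteq> cdom X x" and \<iota>: "\<And>k. Ck_on k O' ?\<iota>"
      by (rule submanifold_inclusion[OF X S chart_at(2)[OF x] chart_at(2)[OF xS] chart_at(1)[OF x] chart_at(1)[OF xS]])
         (rule that)
    have inD: "param S x \<eta> \<in> cdom X x" if "\<eta> \<in> O'" for \<eta> using O'(4) that by (auto simp: param_eq)
    show ?thesis
    proof (rule A3W_at_iff[where \<iota> = ?\<iota> and a = "\<lambda>_. 0", OF Sat xS x O'(1,2,3) \<iota>])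
      show "?\<iota> ` O' \<subseteq> XD x" using O'(4) by blast
      show "?\<iota> (coord S x x) = xc x" using param_coord[OF Sat xS chart_at(2)[OF xS]] by (simp add: param_eq)
      show "c (param S x \<eta>) y = c (param X x (?\<iota> \<eta>)) y - 0" if "\<eta> \<in> O'" for \<eta> y
        using param_coord[OF X x inD[OF that]] by (simp add: param_eq)
      show "\<exists>u. T x (dd u ?\<iota> (coord S x x)) = e" for e
      proof -
        have "x \<in> carrier_of S \<inter> L x" using xS x by (simp add: level_set_def)
        \<comment> \<open>Transversality is applied to the lift \<open>R x e\<close>.
          \<open>T x\<close> kills its part along the level set, so the part tangent to
          \<open>S\<close> already has image \<open>e\<close>.\<close>
        then obtain u v where uv: "u \<in> tangent_to X (carrier_of S) x" "v \<in> tangent_to X (L x) x" "R x e = u + v"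
          using tr[OF x] unfolding transverse_def by blast
        have "\<exists>u'. u = dd u' ?\<iota> (coord S x x)"
          using Ck_on_imp_differentiable[OF \<iota>[of 1] _ O'(2)]
          by (intro tangent_to_submanifold[OF X S xS O'(1,2) _ _ uv(1)]) (auto simp: param_eq)
        moreover have "T x u = e"
          using linear_add[OF linear_T[OF x], of u v] tangent_level[OF uv(2)] uv(3) R(2)[OF x, of e] by simp
        ultimately show ?thesis by blast
      qed
    qed simp
  qed
  then show ?thesis unfolding A3W_def by simp
qed

text \<open>In the chart at \<open>x\<close> the surface is a small disc around \<open>x\<close> in the affine space through
  \<open>xc x\<close> that is spanned by the right inverse \<open>R x\<close> of \<open>T x\<close>.\<close>

lemma transverse_surface:
  assumes x: "x \<in> carrier_of X"
  obtains S :: "('a, 'f) atlas" where "embedded_submanifold X S" "x \<in> carrier_of S"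
    "\<And>x'. x' \<in> carrier_of X \<Longrightarrow> transverse X (carrier_of S) (L x')"
proof -
  let ?l = "\<lambda>a. xc x + R x a"
  have bR: "bounded_linear (R x)" "linear (R x)" using R(1)[OF x] by (simp_all add: linear_conv_bounded_linear)
  have bT: "bounded_linear (T x)" using linear_T[OF x] by (simp add: linear_conv_bounded_linear)
  have l: "Ck_on k UNIV ?l" for k
    by (intro Ck_on_add Ck_on_const Ck_on_bounded_linear bR open_UNIV)
  have dl: "?l differentiable (at a)" "dd b ?l a = R x b" for a b
  proof -
    have "(?l has_derivative (\<lambda>b. 0 + R x b)) (at a)"
      by (intro has_derivative_add has_derivative_const bounded_linear_imp_has_derivative bR)
    then show "?l differentiable (at a)" "dd b ?l a = R x b"
      using dd_eqI by (auto simp: differentiable_def)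
  qed
  let ?D = "{a \<in> UNIV. ?l a \<in> XD x}"
  have D: "open ?D" by (rule open_vimage_Ck[OF open_UNIV l open_XD[OF x]])
  \<comment> \<open>The quotient map along the affine slice. Its derivative at 0 is the identity, so
    it is invertible on a neighbourhood \<open>U\<close>, which becomes the parameter domain of the
    surface.\<close>
  let ?K = "\<lambda>a. Q x (?l a)"
  have K: "Ck_on 3 ?D ?K" by (rule Ck_on_compose[OF D Q_Ck[OF x] Ck_on_subset[OF l]]) auto
  have dK: "dd b ?K a = dd (R x b) (Q x) (?l a)" if "a \<in> ?D" for a b
    using dd_compose[OF dl(1) Q_diff[OF x], of a b] that by (simp add: dl(2))
  have zD: "0 \<in> ?D" using xc[OF x] linear_0[OF bR(2)] by simp
  have "dd b ?K 0 = b" for b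
    using dK[OF zD] R(2)[OF x] linear_0[OF bR(2)] by (simp add: T_def)
  then have "inj (\<lambda>b. dd b ?K 0)" by (simp add: inj_on_def)
  then obtain U V G where U: "open U" "0 \<in> U" "U \<subseteq> ?D" "open V" "?K ` U = V" "G ` V = U"
    "\<And>a. a \<in> U \<Longrightarrow> G (?K a) = a" "\<And>z. z \<in> V \<Longrightarrow> ?K (G z) = z" "Ck_on 2 V G"
    by (rule inverse_function_Ck[OF D zD K]) (rule that)
  \<comment> \<open>Transversality is required at every point of the surface, not only at
    \<open>x\<close>; the local inverse \<open>G\<close> keeps the derivative of \<open>?K\<close>
    invertible on all of \<open>U\<close>.\<close>
  have surj: "\<exists>b. dd (R x b) (Q x) (?l a) = e" if a: "a \<in> U" for a e
  proof -
    have aD: "a \<in> ?D" using a U(3) by blast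
    have d: "?K differentiable (at a)" using Ck_on_imp_differentiable[OF K _ aD] by simp
    have "?K a \<in> V" using U(5) a by blast
    then have dG: "G differentiable (at (?K a))" using Ck_on_imp_differentiable[OF U(9)] by simp
    have "dd b (\<lambda>a. G (?K a)) a = b" for b
      using dd_cong[OF U(1) a, of "\<lambda>a. G (?K a)" "\<lambda>a. a" b] U(7) dd_bounded_linear[OF bounded_linear_ident] by simp
    then have "b = 0" if "dd b ?K a = 0" for b
      using dd_compose[OF d dG, of b] linear_0[OF linear_dd[OF dG]] that by simp
    then have "inj (\<lambda>b. dd b ?K a)" using linear_injective_0[OF linear_dd[OF d]] by blast
    then have "surj (\<lambda>b. dd b ?K a)" by (rule linear_injective_imp_surjective[OF linear_dd[OF d]]) simp
    then obtain b where "e = dd b ?K a" by (rule surjE)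
    then show ?thesis using dK[OF aD] by auto
  qed
  define SS where "SS = (\<lambda>a. param X x (?l a)) ` U"
  \<comment> \<open>Inverts the parametrisation, since \<open>T x\<close> undoes
    \<open>R x\<close>.\<close>
  define \<psi> where "\<psi> p = T x (coord X x p - xc x)" for p
  define S where "S = {(SS, \<psi>)}"
  have UX: "?l a \<in> XD x" if "a \<in> U" for a using U(3) that by blast
  have co: "coord X x (param X x (?l a)) = ?l a" if "a \<in> U" for a by (rule coord_param[OF UX[OF that]])
  have \<psi>: "\<psi> (param X x (?l a)) = a" if "a \<in> U" for a
    using R(2)[OF x] by (simp add: \<psi>_def co[OF that])
  have \<psi>S: "\<psi> ` SS = U" using \<psi> by (force simp: SS_def image_image)
  have chS: "is_chart (SS, \<psi>)"
  proof -
    have "inj_on \<psi> SS" using \<psi> by (auto simp: SS_def inj_on_def)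
    then show ?thesis using \<psi>S U(1) by (simp add: is_chart_def)
  qed
  have cS: "carrier_of S = SS" by (simp add: S_def carrier_of_def)
  have SSX: "SS \<subseteq> cdom X x" using param_in[OF UX] by (auto simp: SS_def)
  have mfd: "smooth_manifold S" unfolding S_def by (rule smooth_manifold_single[OF chS])
  \<comment> \<open>The translated chart at \<open>x\<close> serves as slice chart with
    \<open>j = R x\<close>. Restricting it to points with \<open>\<psi> p \<in> U\<close> cuts the
    slice down to exactly \<open>SS\<close>.\<close>
  let ?\<phi> = "\<lambda>p. coord X x p - xc x" and ?U' = "{p \<in> cdom X x. \<psi> p \<in> U}"
  have SSU: "SS \<subseteq> ?U'" using SSX \<psi>S by blast
  have injR: "inj (R x)" using R(2)[OF x] by (metis injI)
  have chX: "is_chart (cdom X x, coord X x)" by (rule atlas_chart[OF X chart_at(1)[OF x]])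
  have iU: "inv_into (cdom X x) (coord X x) (coord X x p) = p" if "p \<in> cdom X x" for p by (rule inv_chart[OF chX that])
  have inj\<phi>: "inj_on ?\<phi> (cdom X x)" using is_chartD(1)[OF chX] by (auto simp: inj_on_def)
  have i\<phi>: "inv_into ?U' ?\<phi> (?\<phi> p) = p" if "p \<in> ?U'" for p
    by (rule inv_into_f_f[OF inj_on_subset[OF inj\<phi>] that]) blast
  have trU: "open {\<xi> \<in> XD x. T x (\<xi> - xc x) \<in> U}"
    by (rule open_vimage_Ck[OF open_XD[OF x] Ck_on_linear_compose[OF open_XD[OF x] bT Ck_on_diff[OF open_XD[OF x] Ck_on_id Ck_on_const]] U(1)])
  have op\<phi>: "open (?\<phi> ` (?U' \<inter> W))" if "open (coord X x ` (cdom X x \<inter> W))" for W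
  proof -
    have "?\<phi> ` (?U' \<inter> W) = (\<lambda>\<xi>. \<xi> - xc x) ` ({\<xi> \<in> XD x. T x (\<xi> - xc x) \<in> U} \<inter> coord X x ` (cdom X x \<inter> W))"
      using is_chartD(1)[OF chX] by (auto simp: \<psi>_def image_iff dest: inj_onD)
    then show ?thesis using open_translation_subtract[OF open_Int[OF trU that], of "xc x"] by simp
  qed
  have max\<phi>: "(?U', ?\<phi>) \<in> maximal_atlas X"
  proof -
    have comp: "compatible (?U', ?\<phi>) (W, \<omega>)" if "(W, \<omega>) \<in> X" for W \<omega>
    proof -
      have cc: "compatible (cdom X x, coord X x) (W, \<omega>)" by (rule atlas_compatible[OF X chart_at(1)[OF x] that])
      have chW: "is_chart (W, \<omega>)" by (rule atlas_chart[OF X that])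
      have o1: "open (?\<phi> ` (?U' \<inter> W))" by (rule op\<phi>[OF compatibleD(1)[OF cc]])
      have eq: "\<omega> ` (?U' \<inter> W) = {\<xi> \<in> \<omega> ` (cdom X x \<inter> W). T x (coord X x (inv_into W \<omega> \<xi>) - xc x) \<in> U}"
        using inv_chart[OF chW] by (auto simp: \<psi>_def)
      have "Ck_on 0 (\<omega> ` (cdom X x \<inter> W)) (\<lambda>\<xi>. T x (coord X x (inv_into W \<omega> \<xi>) - xc x))"
        by (intro Ck_on_linear_compose[OF compatibleD(3)[OF cc] bT] Ck_on_diff compatibleD[OF cc] Ck_on_const)
      then have o2: "open (\<omega> ` (?U' \<inter> W))"
        unfolding eq by (rule open_vimage_Ck[OF compatibleD(3)[OF cc] _ U(1)])
      have "Ck_on k (?\<phi> ` (?U' \<inter> W)) (\<lambda>\<xi>. \<omega> (inv_into ?U' ?\<phi> \<xi>))" for k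
      proof -
        have "Ck_on k (?\<phi> ` (?U' \<inter> W)) (\<lambda>\<xi>. \<omega> (inv_into (cdom X x) (coord X x) (\<xi> + xc x)))"
          by (rule Ck_on_compose[OF o1 compatibleD(2)[OF cc] Ck_on_add[OF o1 Ck_on_id Ck_on_const]]) auto
        then show ?thesis by (rule Ck_on_cong[OF o1, rotated]) (auto simp: i\<phi> iU)
      qed
      moreover have "Ck_on k (\<omega> ` (?U' \<inter> W)) (\<lambda>\<eta>. ?\<phi> (inv_into W \<omega> \<eta>))" for k
        by (rule Ck_on_diff[OF o2 Ck_on_subset[OF compatibleD(4)[OF cc]] Ck_on_const]) auto
      ultimately show ?thesis using o1 o2 by (simp add: compatible_def smooth_on_def)
    qed
    have "is_chart (?U', ?\<phi>)"
      using op\<phi>[of UNIV] open_XD[OF x] inj_on_subset[OF inj\<phi>, of ?U'] by (auto simp: is_chart_def)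
    then show ?thesis using comp cdom_subset[OF x] by (auto simp: maximal_atlas_def)
  qed
  have \<chi>: "inv (R x) (?\<phi> p) = \<psi> p" if "p \<in> SS" for p
    using that inv_f_f[OF injR] by (auto simp: SS_def co \<psi>)
  have slice: "?\<phi> ` (?U' \<inter> SS) = ?\<phi> ` ?U' \<inter> range (R x)"
  proof (intro equalityI subsetI)
    fix \<theta> assume "\<theta> \<in> ?\<phi> ` (?U' \<inter> SS)"
    then show "\<theta> \<in> ?\<phi> ` ?U' \<inter> range (R x)" by (auto simp: SS_def co)
  next
    fix \<theta> assume "\<theta> \<in> ?\<phi> ` ?U' \<inter> range (R x)"
    then obtain p a where p: "p \<in> ?U'" "\<theta> = ?\<phi> p" "\<theta> = R x a" by blast
    then have "a \<in> U" using R(2)[OF x, of a] by (simp add: \<psi>_def)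
    moreover have "p = param X x (?l a)"
    proof -
      have "coord X x p = ?l a" using p(2,3) by (simp add: algebra_simps)
      then show ?thesis using p(1) param_coord[OF X x, of p] by simp
    qed
    ultimately have "p \<in> SS" by (auto simp: SS_def)
    then show "\<theta> \<in> ?\<phi> ` (?U' \<inter> SS)" using p by blast
  qed
  have maxS: "(?U' \<inter> SS, \<lambda>p. inv (R x) (?\<phi> p)) \<in> maximal_atlas S"
  proof -
    let ?\<chi> = "\<lambda>p. inv (R x) (?\<phi> p)"
    have e: "?U' \<inter> SS = SS" using SSU by blast
    have im: "?\<chi> ` SS = U" using \<chi> \<psi>S by (metis (mono_tags, lifting) image_cong)
    have ij: "inj_on ?\<chi> SS" using is_chartD(1)[OF chS] \<chi> by (simp add: inj_on_def)
    have 1: "\<psi> (inv_into SS ?\<chi> \<xi>) = \<xi>" if "\<xi> \<in> U" for \<xi>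
    proof -
      have "\<xi> \<in> ?\<chi> ` SS" using that im by simp
      from inv_into_into[OF this] f_inv_into_f[OF this] show ?thesis using \<chi> by metis
    qed
    have 2: "?\<chi> (inv_into SS \<psi> \<xi>) = \<xi>" if "\<xi> \<in> U" for \<xi>
    proof -
      have "\<xi> \<in> \<psi> ` SS" using that \<psi>S by simp
      from inv_into_into[OF this] f_inv_into_f[OF this] show ?thesis using \<chi> by metis
    qed
    have "Ck_on k U (\<lambda>\<xi>. \<psi> (inv_into SS ?\<chi> \<xi>))" "Ck_on k U (\<lambda>\<xi>. ?\<chi> (inv_into SS \<psi> \<xi>))" for k
      using Ck_on_cong[OF U(1) _ Ck_on_id[of k U]] 1 2 by simp_all
    then show ?thesis
      using im ij U(1) \<psi>S by (simp add: e maximal_atlas_def is_chart_def compatible_def smooth_on_def S_def carrier_of_def)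
  qed
  have emb: "embedded_submanifold X S" unfolding embedded_submanifold_def
  proof (intro conjI ballI mfd)
    show "carrier_of S \<subseteq> carrier_of X" using SSX cdom_subset[OF x] cS by blast
    fix p assume "p \<in> carrier_of S"
    then have "p \<in> ?U'" using SSU cS by blast
    then show "\<exists>U \<phi>. \<exists>j :: 'f \<Rightarrow> 'e. (U, \<phi>) \<in> maximal_atlas X \<and> p \<in> U \<and> linear j \<and> inj j \<and>
        \<phi> ` (U \<inter> carrier_of S) = \<phi> ` U \<inter> range j \<and> (U \<inter> carrier_of S, \<lambda>x. inv j (\<phi> x)) \<in> maximal_atlas S"
      using max\<phi> bR(2) injR slice maxS unfolding cS by blast
  qed
  have xS: "x \<in> carrier_of S"
    unfolding cS SS_def using U(2) linear_0[OF bR(2)] param_xc[OF x] by (intro image_eqI[of _ _ 0]) auto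
  have "transverse X (carrier_of S) (L x')" if x': "x' \<in> carrier_of X" for x'
    unfolding transverse_def
  proof (intro ballI allI)
    fix p w assume p: "p \<in> carrier_of S \<inter> L x'"
    have pX: "p \<in> carrier_of X" using p by (simp add: level_set_def)
    obtain a where a: "a \<in> U" "p = param X x (?l a)" using p cS SS_def by auto
    \<comment> \<open>Moving the parameter in direction \<open>b\<close> gives a curve in the
      surface whose velocity has the same image under \<open>T p\<close> as \<open>w\<close>. The
      difference lies in the kernel and is therefore tangent to the level set.\<close>
    obtain b where b: "dd (R x b) (Q x) (?l a) = T p w" using surj[OF a(1)] by blast
    obtain \<epsilon> where \<epsilon>: "0 < \<epsilon>" "\<And>s. s \<in> {-\<epsilon><..<\<epsilon>} \<Longrightarrow> a + s *\<^sub>R b \<in> U"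
      by (rule line_in_open[OF U(1) a(1)]) (rule that)
    define \<beta> where "\<beta> s = inv_into (cdom X x) (coord X x) (?l (a + s *\<^sub>R b))" for s :: real
    have "Ck_on 1 {-\<epsilon><..<\<epsilon>} (\<lambda>s. ?l (a + s *\<^sub>R b))"
      by (rule Ck_on_compose[OF open_greaterThanLessThan l Ck_on_line]) auto
    moreover have "(\<lambda>s. ?l (a + s *\<^sub>R b)) ` {-\<epsilon><..<\<epsilon>} \<subseteq> XD x" using UX \<epsilon>(2) by blast
    ultimately have \<beta>: "Ck_curve 1 X \<epsilon> \<beta>" unfolding \<beta>_def by (rule Ck_curve_chart[OF X chart_at(1)[OF x]])
    have \<beta>': "\<beta> s = param X x (?l (a + s *\<^sub>R b))" for s by (simp add: \<beta>_def param_eq)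
    have \<beta>0: "\<beta> 0 = p" by (simp add: \<beta>' a(2))
    have \<beta>S: "\<beta> ` {-\<epsilon><..<\<epsilon>} \<subseteq> carrier_of S" using \<epsilon>(2) by (auto simp: \<beta>' cS SS_def)
    let ?u = "velocity X \<beta>"
    have u: "?u \<in> tangent_to X (carrier_of S) p" unfolding tangent_to_def using \<beta> \<epsilon>(1) \<beta>0 \<beta>S by blast
    have "T p ?u = dd 1 (\<lambda>s. ?K (a + s *\<^sub>R b)) 0"
      using T_velocity[OF \<beta> \<epsilon>(1)] \<beta>0 by (simp add: \<beta>' Q_def)
    also have "\<dots> = dd b ?K a"
    proof -
      have "(\<lambda>s::real. a + s *\<^sub>R b) differentiable (at 0)" by (rule Ck_on_imp_differentiable[OF Ck_on_line[of 1 UNIV]]) auto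
      moreover have "?K differentiable (at (a + 0 *\<^sub>R b))"
        using Ck_on_imp_differentiable[OF K, of a] U(3) a(1) by auto
      ultimately show ?thesis by (subst dd_compose) auto
    qed
    also have "\<dots> = T p w" using dK[of a] U(3) a(1) b by auto
    finally have "T p (w - ?u) = 0" using linear_diff[OF linear_T[OF pX]] by simp
    then have "w - ?u \<in> tangent_to X (L x') p" using p by (intro kernel_tangent_level) auto
    then show "\<exists>u\<in>tangent_to X (carrier_of S) p. \<exists>v\<in>tangent_to X (L x') p. w = u + v"
      using u by (intro bexI[of _ ?u] bexI[of _ "w - ?u"]) auto
  qed
  then show ?thesis using that[of S] emb xS by blast
qed

end

theorem theorem3p8:
  fixes M :: "('a, 'g::euclidean_space) atlas" and N :: "('b, 'h::euclidean_space) atlas"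
    and X :: "('a, 'e::euclidean_space) atlas" and Y :: "('b, 'f::euclidean_space) atlas"
    and c :: "'a \<Rightarrow> 'b \<Rightarrow> real" and y\<^sub>0 :: 'b
    and Z :: "('a set, 'f) atlas" and b :: "'a set \<Rightarrow> 'b \<Rightarrow> real"
  assumes dim: "DIM('e) \<ge> DIM('f)"
    and larger: "smooth_manifold M" "smooth_manifold N"
    and X: "smooth_manifold X" "embedded_submanifold M X"
      "compactin (mfd_topology M) (mfd_topology M closure_of carrier_of X)"
    and Y: "smooth_manifold Y" "embedded_submanifold N Y"
      "compactin (mfd_topology N) (mfd_topology N closure_of carrier_of Y)"
    and Y_connected: "connected_space (mfd_topology Y)"
    and C4: "Ck_on_product 4 M N (mfd_topology M closure_of carrier_of X)
               (mfd_topology N closure_of carrier_of Y) c"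
    and A1: "\<forall>x\<in>carrier_of X. inj_on (D1 X c x) (mfd_topology N closure_of carrier_of Y)"
    and A2: "\<forall>x\<in>carrier_of X. \<forall>y\<in>carrier_of Y. inj (D12 X Y c x y)"
    and level_connected: "\<forall>x\<in>carrier_of X. \<forall>y\<in>carrier_of Y.
          connectedin (mfd_topology X) (level_set X Y c y x)"
    and level_indep: "\<forall>x\<in>carrier_of X. \<forall>y\<in>carrier_of Y. \<forall>y'\<in>carrier_of Y.
          level_set X Y c y x = level_set X Y c y' x"
    and y0: "y\<^sub>0 \<in> carrier_of Y"
    and Z: "Z = quotient_manifold X Y c y\<^sub>0"
    and b: "\<forall>z\<in>carrier_of Z. \<forall>x\<in>z. \<forall>y\<in>carrier_of Y.
          differentiable_at Y (b z) y \<and> D2 Y b z y = D2 Y c x y"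
    and b_y0: "\<forall>z\<in>carrier_of Z. b z y\<^sub>0 = 0"
  shows "(A3W Z Y b \<longleftrightarrow> A3W X Y c) \<and>
         (A3W X Y c \<longleftrightarrow>
            (\<forall>S :: ('a, 'f) atlas.
               embedded_submanifold X S \<and>
               (\<forall>x\<in>carrier_of X. transverse X (carrier_of S) (level_set X Y c y\<^sub>0 x)) \<longrightarrow>
               A3W S Y c))"
proof -
  interpret cost X Y c y\<^sub>0
  proof
    show "smooth_atlas X" by (rule smooth_manifold_atlas[OF X(1)])
    show "smooth_manifold Y" "connected_space (mfd_topology Y)" "y\<^sub>0 \<in> carrier_of Y" by (fact Y(1) Y_connected y0)+
    show "Ck_on 4 (\<phi> ` U \<times> \<psi> ` V) (\<lambda>p. c (inv_into U \<phi> (fst p)) (inv_into V \<psi> (snd p)))"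
      if "(U, \<phi>) \<in> X" "(V, \<psi>) \<in> Y" for U \<phi> V \<psi>
      by (rule Ck_on_product_submanifold[OF larger X(2) Y(2) C4 that])
    have "carrier_of Y \<subseteq> mfd_topology N closure_of carrier_of Y"
      using Y(2) topspace_mfd[OF larger(2)] by (intro closure_of_subset) (auto simp: embedded_submanifold_def)
    then show "inj_on (D1 X c x) (carrier_of Y)" if "x \<in> carrier_of X" for x
      using A1 that inj_on_subset by blast
    show "inj (D12 X Y c x y)" if "x \<in> carrier_of X" "y \<in> carrier_of Y" for x y
      using A2 that by blast
    show "D2 Y c x' y = D2 Y c x y" if "x \<in> carrier_of X" "x' \<in> carrier_of X" "y \<in> carrier_of Y"
      "D2 Y c x' y\<^sub>0 = D2 Y c x y\<^sub>0" for x x' y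
    proof -
      have "x' \<in> level_set X Y c y\<^sub>0 x" using that by (simp add: level_set_def)
      also have "level_set X Y c y\<^sub>0 x = level_set X Y c y x" using level_indep that(1,3) y0 by blast
      finally show ?thesis by (simp add: level_set_def)
    qed
  qed
  have "A3W Z Y b \<longleftrightarrow> (\<forall>x\<in>carrier_of X. A3W_at x)"
    by (rule A3W_Z_iff[OF Z]) (use b b_y0 in blast)+
  moreover have "(\<forall>S :: ('a, 'f) atlas. embedded_submanifold X S \<and>
      (\<forall>x\<in>carrier_of X. transverse X (carrier_of S) (level_set X Y c y\<^sub>0 x)) \<longrightarrow> A3W S Y c)
    \<longleftrightarrow> (\<forall>x\<in>carrier_of X. A3W_at x)" (is "?surfaces \<longleftrightarrow> _")
  proof
    assume P: "\<forall>x\<in>carrier_of X. A3W_at x"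
    show ?surfaces
    proof (intro allI impI, elim conjE)
      fix S :: "('a, 'f) atlas"
      assume S: "embedded_submanifold X S" "\<forall>x\<in>carrier_of X. transverse X (carrier_of S) (level_set X Y c y\<^sub>0 x)"
      have "carrier_of S \<subseteq> carrier_of X" using S(1) by (simp add: embedded_submanifold_def)
      then show "A3W S Y c" using A3W_S_iff[OF S(1)] S(2) P by blast
    qed
  next
    assume A: ?surfaces
    show "\<forall>x\<in>carrier_of X. A3W_at x"
    proof
      fix x assume "x \<in> carrier_of X"
      then obtain S :: "('a, 'f) atlas" where S: "embedded_submanifold X S" "x \<in> carrier_of S"
        "\<And>x'. x' \<in> carrier_of X \<Longrightarrow> transverse X (carrier_of S) (level_set X Y c y\<^sub>0 x')"
        by (rule transverse_surface) (rule that)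
      then have "A3W S Y c" using A by blast
      then show "A3W_at x" using A3W_S_iff[OF S(1,3)] S(2) by blast
    qed
  qed
  ultimately show ?thesis using A3W_X_iff by blast
qed

end
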